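(* Let $\mathbf{SkePerLC}$ be the category of all locally compact Hausdorff spaces and all skeletal perfect maps between them. Let $\mathbf{DSkePerLC}$ be the category whose objects are all complete local contact algebras and whose morphisms $\varphi:(A,\rho,\mathbb{B})\to(B,\eta,\mathbb{B}')$ are all complete Boolean homomorphisms $\varphi:A\to B$ satisfying (L1) for all $a,b\in A$, $\varphi(a)\,\eta\,\varphi(b)$ implies $a\,\rho\,b$; (L2) $b\in\mathbb{B}'$ implies $\varphi_\Lambda(b)\in\mathbb{B}$; and (L3) $a\in\mathbb{B}$ implies $\varphi(a)\in\mathbb{B}'$. Then the categories $\mathbf{SkePerLC}$ and $\mathbf{DSkePerLC}$ are dually equivalent.
   Context: A function $f:X\to Y$ between topological spaces is skeletal if $\mathrm{int}(f^{-1}(\mathrm{cl}(V)))\subseteq \mathrm{cl}(f^{-1}(V))$ for every open $V\subseteq Y$. A map is perfect if it is continuous, closed, and all its point inverses are compact. Maps are not assumed to be onto. (For perfect maps between locally compact Hausdorff spaces, skeletal is the same as quasi-open, i.e. $\mathrm{int}(f(U))\neq\emptyset$ for each non-empty open $U$.) A contact algebra $(B,C)$ is a Boolean algebra $B=(B,0,1,\vee,\wedge,{}^* )$ ($0=1$ is allowed; $^*$ is complement) with a binary relation $C$ on $B$ such that: (C1) $a\neq 0$ implies $aCa$; (C2) $aCb$ implies $a\ne 0$ and $b\neq 0$; (C3) $aCb$ implies $bCa$; (C4) $aC(b\vee c)$ iff $aCb$ or $aCc$. Write $a\ll_C b$ iff not $aCb^*$. A local contact algebra $(B,\rho,\mathbb{B})$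 consists of a contact algebra $(B,\rho)$ and an ideal $\mathbb{B}$ of $B$ (possibly non-proper) such that: (BC1) if $a\in\mathbb{B}$, $c\in B$ and $a\ll_\rho c$ then $a\ll_\rho b\ll_\rho c$ for some $b\in\mathbb{B}$; (BC2) if $a\rho b$ then there is $c\in\mathbb{B}$ with $a\rho(c\wedge b)$; (BC3) if $a\ne 0$ then there is $b\in\mathbb{B}\setminus\{0\}$ with $b\ll_\rho a$. It is complete if $B$ is a complete Boolean algebra. A complete Boolean homomorphism is one preserving all joins and meets. For such $\varphi:A\to B$, $\varphi_\Lambda:B\to A$ denotes its left adjoint: $b\le\varphi(a)$ iff $\varphi_\Lambda(b)\le a$. Composition of morphisms is composition of functions. Two categories are dually equivalent if one is equivalent to the opposite of the other. *)

theory Defs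
  imports "HOL-Analysis.Analysis"
begin

section \<open>Categories and equivalence\<close>

text \<open>
  Hom-sets need not be disjoint, so composition and the arrow part of a functor take the objects
  as arguments: \<open>Cmp C a b c g f\<close> is the composite of \<open>f \<in> Hom C a b\<close> and \<open>g \<in> Hom C b c\<close>.
\<close>

record ('o, 'm) category =
  Obj :: "'o set"
  Hom :: "'o \<Rightarrow> 'o \<Rightarrow> 'm set"
  Idt :: "'o \<Rightarrow> 'm"
  Cmp :: "'o \<Rightarrow> 'o \<Rightarrow> 'o \<Rightarrow> 'm \<Rightarrow> 'm \<Rightarrow> 'm"

definition is_category :: "('o, 'm) category \<Rightarrow> bool" where
  "is_category C \<longleftrightarrow>
     (\<forall>a\<in>Obj C. Idt C a \<in> Hom C a a) \<and>
     (\<forall>a\<in>Obj C. \<forall>b\<in>Obj C. \<forall>c\<in>Obj C. \<forall>f\<in>Hom C a b. \<forall>g\<in>Hom C b c.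
        Cmp C a b c g f \<in> Hom C a c) \<and>
     (\<forall>a\<in>Obj C. \<forall>b\<in>Obj C. \<forall>f\<in>Hom C a b.
        Cmp C a a b f (Idt C a) = f \<and> Cmp C a b b (Idt C b) f = f) \<and>
     (\<forall>a\<in>Obj C. \<forall>b\<in>Obj C. \<forall>c\<in>Obj C. \<forall>d\<in>Obj C.
        \<forall>f\<in>Hom C a b. \<forall>g\<in>Hom C b c. \<forall>h\<in>Hom C c d.
        Cmp C a b d (Cmp C b c d h g) f = Cmp C a c d h (Cmp C a b c g f))"

definition opposite :: "('o, 'm) category \<Rightarrow> ('o, 'm) category" where
  "opposite C =
     \<lparr>Obj = Obj C,
      Hom = (\<lambda>a b. Hom C b a),
      Idt = Idt C,
      Cmp = (\<lambda>a b c g f. Cmp C c b a f g)\<rparr>"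

definition is_iso :: "('o, 'm) category \<Rightarrow> 'o \<Rightarrow> 'o \<Rightarrow> 'm \<Rightarrow> bool" where
  "is_iso C a b f \<longleftrightarrow>
     f \<in> Hom C a b \<and>
     (\<exists>g\<in>Hom C b a. Cmp C a b a g f = Idt C a \<and> Cmp C b a b f g = Idt C b)"

record ('o, 'm, 'p, 'n) fctr =
  OMap :: "'o \<Rightarrow> 'p"
  AMap :: "'o \<Rightarrow> 'o \<Rightarrow> 'm \<Rightarrow> 'n"

definition is_functor ::
  "('o, 'm) category \<Rightarrow> ('p, 'n) category \<Rightarrow> ('o, 'm, 'p, 'n) fctr \<Rightarrow> bool" where
  "is_functor C D F \<longleftrightarrow>
     (\<forall>a\<in>Obj C. OMap F a \<in> Obj D) \<and>
     (\<forall>a\<in>Obj C. \<forall>b\<in>Obj C. \<forall>f\<in>Hom C a b. AMap F a b f \<in> Hom D (OMap F a) (OMap F b)) \<and>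
     (\<forall>a\<in>Obj C. AMap F a a (Idt C a) = Idt D (OMap F a)) \<and>
     (\<forall>a\<in>Obj C. \<forall>b\<in>Obj C. \<forall>c\<in>Obj C. \<forall>f\<in>Hom C a b. \<forall>g\<in>Hom C b c.
        AMap F a c (Cmp C a b c g f) =
        Cmp D (OMap F a) (OMap F b) (OMap F c) (AMap F b c g) (AMap F a b f))"

definition id_fctr :: "('o, 'm, 'o, 'm) fctr" where
  "id_fctr = \<lparr>OMap = (\<lambda>a. a), AMap = (\<lambda>a b f. f)\<rparr>"

definition comp_fctr ::
  "('p, 'n, 'q, 'k) fctr \<Rightarrow> ('o, 'm, 'p, 'n) fctr \<Rightarrow> ('o, 'm, 'q, 'k) fctr" where
  "comp_fctr G F =
     \<lparr>OMap = (\<lambda>a. OMap G (OMap F a)),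
      AMap = (\<lambda>a b f. AMap G (OMap F a) (OMap F b) (AMap F a b f))\<rparr>"

definition is_nat_iso ::
  "('o, 'm) category \<Rightarrow> ('p, 'n) category \<Rightarrow>
   ('o, 'm, 'p, 'n) fctr \<Rightarrow> ('o, 'm, 'p, 'n) fctr \<Rightarrow> ('o \<Rightarrow> 'n) \<Rightarrow> bool" where
  "is_nat_iso C D F G \<tau> \<longleftrightarrow>
     (\<forall>a\<in>Obj C. is_iso D (OMap F a) (OMap G a) (\<tau> a)) \<and>
     (\<forall>a\<in>Obj C. \<forall>b\<in>Obj C. \<forall>f\<in>Hom C a b.
        Cmp D (OMap F a) (OMap F b) (OMap G b) (\<tau> b) (AMap F a b f) =
        Cmp D (OMap F a) (OMap G a) (OMap G b) (AMap G a b f) (\<tau> a))"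

definition equivalent :: "('o, 'm) category \<Rightarrow> ('p, 'n) category \<Rightarrow> bool" where
  "equivalent C D \<longleftrightarrow>
     is_category C \<and> is_category D \<and>
     (\<exists>F G \<eta> \<epsilon>. is_functor C D F \<and> is_functor D C G \<and>
        is_nat_iso C C id_fctr (comp_fctr G F) \<eta> \<and>
        is_nat_iso D D (comp_fctr F G) id_fctr \<epsilon>)"

definition dually_equivalent :: "('o, 'm) category \<Rightarrow> ('p, 'n) category \<Rightarrow> bool" where
  "dually_equivalent C D \<longleftrightarrow> equivalent C (opposite D)"


section \<open>Skeletal perfect maps\<close>

definition skeletal_map :: "'a topology \<Rightarrow> 'b topology \<Rightarrow> ('a \<Rightarrow> 'b) \<Rightarrow> bool" where
  "skeletal_map X Y f \<longleftrightarrow>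
     f \<in> topspace X \<rightarrow> topspace Y \<and>
     (\<forall>V. openin Y V \<longrightarrow>
        X interior_of {x \<in> topspace X. f x \<in> Y closure_of V}
          \<subseteq> X closure_of {x \<in> topspace X. f x \<in> V})"

text \<open>
  The library's \<^const>\<open>perfect_map\<close> is not used because it includes surjectivity. A proper map in
  the library's sense is a closed map with compact fibres; it need not be continuous.
\<close>

definition perfect_into :: "'a topology \<Rightarrow> 'b topology \<Rightarrow> ('a \<Rightarrow> 'b) \<Rightarrow> bool" where
  "perfect_into X Y f \<longleftrightarrow> continuous_map X Y f \<and> proper_map X Y f"

text \<open>
  The argument \<open>\<S>\<close> only serves to bound the size of the spaces (see the section on size below).
  Maps are extensional on the underlying set, so that equality of morphisms is equality of
  functions between the underlying sets.
\<close>

definition SkePerLC :: "'a topology set \<Rightarrow> ('a topology, 'a \<Rightarrow> 'a) category" where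
  "SkePerLC \<S> =
     \<lparr>Obj = {X \<in> \<S>. locally_compact_space X \<and> Hausdorff_space X},
      Hom = (\<lambda>X Y. {f \<in> extensional (topspace X). skeletal_map X Y f \<and> perfect_into X Y f}),
      Idt = (\<lambda>X. restrict (\<lambda>x. x) (topspace X)),
      Cmp = (\<lambda>X Y Z g f. compose (topspace X) g f)\<rparr>"


section \<open>Local contact algebras\<close>

record 'a balg =
  carr :: "'a set"
  zer :: 'a
  uni :: 'a
  join :: "'a \<Rightarrow> 'a \<Rightarrow> 'a"
  meet :: "'a \<Rightarrow> 'a \<Rightarrow> 'a"
  cmpl :: "'a \<Rightarrow> 'a"

record 'a contact_alg = "'a balg" +
  contact :: "'a \<Rightarrow> 'a \<Rightarrow> bool"

record 'a lca = "'a contact_alg" +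
  bounded_elts :: "'a set"

text \<open>Huntington's axioms, relative to the carrier; \<open>0 = 1\<close> is allowed.\<close>

definition boolean_alg :: "('a, 'z) balg_scheme \<Rightarrow> bool" where
  "boolean_alg B \<longleftrightarrow>
     zer B \<in> carr B \<and> uni B \<in> carr B \<and>
     (\<forall>a\<in>carr B. cmpl B a \<in> carr B) \<and>
     (\<forall>a\<in>carr B. \<forall>b\<in>carr B. join B a b \<in> carr B \<and> meet B a b \<in> carr B) \<and>
     (\<forall>a\<in>carr B. \<forall>b\<in>carr B. join B a b = join B b a \<and> meet B a b = meet B b a) \<and>
     (\<forall>a\<in>carr B. \<forall>b\<in>carr B. \<forall>c\<in>carr B.
        meet B a (join B b c) = join B (meet B a b) (meet B a c) \<and>
        join B a (meet B b c) = meet B (join B a b) (join B a c)) \<and>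
     (\<forall>a\<in>carr B. join B a (zer B) = a \<and> meet B a (uni B) = a) \<and>
     (\<forall>a\<in>carr B. join B a (cmpl B a) = uni B \<and> meet B a (cmpl B a) = zer B)"

definition leq :: "('a, 'z) balg_scheme \<Rightarrow> 'a \<Rightarrow> 'a \<Rightarrow> bool" where
  "leq B a b \<longleftrightarrow> meet B a b = a"

definition is_join :: "('a, 'z) balg_scheme \<Rightarrow> 'a set \<Rightarrow> 'a \<Rightarrow> bool" where
  "is_join B S x \<longleftrightarrow>
     x \<in> carr B \<and> (\<forall>s\<in>S. leq B s x) \<and> (\<forall>y\<in>carr B. (\<forall>s\<in>S. leq B s y) \<longrightarrow> leq B x y)"

definition is_meet :: "('a, 'z) balg_scheme \<Rightarrow> 'a set \<Rightarrow> 'a \<Rightarrow> bool" where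
  "is_meet B S x \<longleftrightarrow>
     x \<in> carr B \<and> (\<forall>s\<in>S. leq B x s) \<and> (\<forall>y\<in>carr B. (\<forall>s\<in>S. leq B y s) \<longrightarrow> leq B y x)"

definition complete_boolean_alg :: "('a, 'z) balg_scheme \<Rightarrow> bool" where
  "complete_boolean_alg B \<longleftrightarrow>
     boolean_alg B \<and> (\<forall>S\<subseteq>carr B. (\<exists>x. is_join B S x) \<and> (\<exists>x. is_meet B S x))"

definition contact_algebra :: "('a, 'z) contact_alg_scheme \<Rightarrow> bool" where
  "contact_algebra B \<longleftrightarrow>
     boolean_alg B \<and>
     (\<forall>a\<in>carr B. a \<noteq> zer B \<longrightarrow> contact B a a) \<and>
     (\<forall>a\<in>carr B. \<forall>b\<in>carr B. contact B a b \<longrightarrow> a \<noteq> zer B \<and> b \<noteq> zer B) \<and>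
     (\<forall>a\<in>carr B. \<forall>b\<in>carr B. contact B a b \<longrightarrow> contact B b a) \<and>
     (\<forall>a\<in>carr B. \<forall>b\<in>carr B. \<forall>c\<in>carr B.
        contact B a (join B b c) \<longleftrightarrow> contact B a b \<or> contact B a c)"

definition way_inside :: "('a, 'z) contact_alg_scheme \<Rightarrow> 'a \<Rightarrow> 'a \<Rightarrow> bool" where
  "way_inside B a b \<longleftrightarrow> \<not> contact B a (cmpl B b)"

definition is_ideal :: "('a, 'z) balg_scheme \<Rightarrow> 'a set \<Rightarrow> bool" where
  "is_ideal B I \<longleftrightarrow>
     I \<subseteq> carr B \<and> zer B \<in> I \<and>
     (\<forall>a\<in>I. \<forall>b\<in>carr B. leq B b a \<longrightarrow> b \<in> I) \<and>
     (\<forall>a\<in>I. \<forall>b\<in>I. join B a b \<in> I)"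

definition local_contact_algebra :: "'a lca \<Rightarrow> bool" where
  "local_contact_algebra B \<longleftrightarrow>
     contact_algebra B \<and> is_ideal B (bounded_elts B) \<and>
     (\<forall>a\<in>bounded_elts B. \<forall>c\<in>carr B. way_inside B a c \<longrightarrow>
        (\<exists>b\<in>bounded_elts B. way_inside B a b \<and> way_inside B b c)) \<and>
     (\<forall>a\<in>carr B. \<forall>b\<in>carr B. contact B a b \<longrightarrow>
        (\<exists>c\<in>bounded_elts B. contact B a (meet B c b))) \<and>
     (\<forall>a\<in>carr B. a \<noteq> zer B \<longrightarrow>
        (\<exists>b\<in>bounded_elts B - {zer B}. way_inside B b a))"

definition complete_lca :: "'a lca \<Rightarrow> bool" where
  "complete_lca B \<longleftrightarrow> local_contact_algebra B \<and> complete_boolean_alg B"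

definition boolean_hom ::
  "('a, 'z) balg_scheme \<Rightarrow> ('b, 'y) balg_scheme \<Rightarrow> ('a \<Rightarrow> 'b) \<Rightarrow> bool" where
  "boolean_hom A B \<phi> \<longleftrightarrow>
     \<phi> \<in> carr A \<rightarrow> carr B \<and> \<phi> (zer A) = zer B \<and> \<phi> (uni A) = uni B \<and>
     (\<forall>a\<in>carr A. \<phi> (cmpl A a) = cmpl B (\<phi> a)) \<and>
     (\<forall>a\<in>carr A. \<forall>b\<in>carr A.
        \<phi> (join A a b) = join B (\<phi> a) (\<phi> b) \<and> \<phi> (meet A a b) = meet B (\<phi> a) (\<phi> b))"

definition complete_boolean_hom ::
  "('a, 'z) balg_scheme \<Rightarrow> ('b, 'y) balg_scheme \<Rightarrow> ('a \<Rightarrow> 'b) \<Rightarrow> bool" where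
  "complete_boolean_hom A B \<phi> \<longleftrightarrow>
     boolean_hom A B \<phi> \<and>
     (\<forall>S x. S \<subseteq> carr A \<longrightarrow> is_join A S x \<longrightarrow> is_join B (\<phi> ` S) (\<phi> x)) \<and>
     (\<forall>S x. S \<subseteq> carr A \<longrightarrow> is_meet A S x \<longrightarrow> is_meet B (\<phi> ` S) (\<phi> x))"

text \<open>
  Well defined for complete homomorphisms of complete Boolean algebras: there the described
  element exists and is unique for every \<open>b \<in> carr B\<close>.
\<close>

definition left_adj ::
  "('a, 'z) balg_scheme \<Rightarrow> ('b, 'y) balg_scheme \<Rightarrow> ('a \<Rightarrow> 'b) \<Rightarrow> 'b \<Rightarrow> 'a" where
  "left_adj A B \<phi> b =
     (THE c. c \<in> carr A \<and> (\<forall>a\<in>carr A. leq B b (\<phi> a) \<longleftrightarrow> leq A c a))"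

definition DSkePerLC_hom :: "'a lca \<Rightarrow> 'b lca \<Rightarrow> ('a \<Rightarrow> 'b) \<Rightarrow> bool" where
  "DSkePerLC_hom A B \<phi> \<longleftrightarrow>
     complete_boolean_hom A B \<phi> \<and>
     (\<forall>a\<in>carr A. \<forall>b\<in>carr A. contact B (\<phi> a) (\<phi> b) \<longrightarrow> contact A a b) \<and>
     (\<forall>b\<in>bounded_elts B. left_adj A B \<phi> b \<in> bounded_elts A) \<and>
     (\<forall>a\<in>bounded_elts A. \<phi> a \<in> bounded_elts B)"

definition DSkePerLC :: "'a lca set \<Rightarrow> ('a lca, 'a \<Rightarrow> 'a) category" where
  "DSkePerLC \<A> =
     \<lparr>Obj = {A \<in> \<A>. complete_lca A},
      Hom = (\<lambda>A B. {\<phi> \<in> extensional (carr A). DSkePerLC_hom A B \<phi>}),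
      Idt = (\<lambda>A. restrict (\<lambda>x. x) (carr A)),
      Cmp = (\<lambda>A B C \<psi> \<phi>. compose (carr A) \<psi> \<phi>)\<rparr>"


section \<open>Size\<close>

text \<open>
  ``All spaces'' and ``all algebras'' have to be read relative to a universe, since every space in
  HOL lives on some type. Two readings are provided for.

  \<^item> The type \<open>'u\<close> is a universe if its cardinality is a strong limit; the small sets are those
    strictly smaller than \<open>'u\<close>, and then all small spaces and all small algebras are considered.
    (Without closure under powersets the two categories would not match: an infinite discrete
    space has as many regular closed sets as it has subsets.)

  \<^item> Without any assumption on the type \<open>'v\<close>: all complete local contact algebras on subsets of
    \<open>'v\<close>, and all spaces on subsets of \<open>'v set\<close> with at most as many regular closed sets as \<open>'v\<close>
    has elements. A locally compact Hausdorff space with that many regular closed sets has no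
    more points than \<open>'v set\<close> has elements, so up to homeomorphism every such space occurs; and
    every locally compact Hausdorff space on a type \<open>'a\<close> occurs for \<open>'v = 'a set\<close>.
\<close>

definition universe :: "'u set \<Rightarrow> bool" where
  "universe U \<longleftrightarrow> (\<forall>A::'u set. A \<prec> U \<longrightarrow> Pow A \<prec> U)"

definition small_spaces :: "'u topology set" where
  "small_spaces = {X. topspace X \<prec> (UNIV :: 'u set)}"

definition small_algebras :: "'u lca set" where
  "small_algebras = {A. carr A \<prec> (UNIV :: 'u set)}"

definition regular_closed_sets :: "'a topology \<Rightarrow> 'a set set" where
  "regular_closed_sets X = {F. X closure_of (X interior_of F) = F}"

definition bounded_spaces :: "'v set topology set" where
  "bounded_spaces = {X. regular_closed_sets X \<lesssim> (UNIV :: 'v set)}"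

end

theory Submission
  imports Defs
begin

text \<open>
  A space \<open>X\<close> is sent to the algebra of its regular closed sets, in which two sets are in contact
  if they meet and are bounded if they are compact. A map \<open>f : X \<rightarrow> Y\<close> is sent to
  \<open>F \<mapsto> cl f\<^sup>-(int F)\<close>, where \<open>f\<^sup>-\<close> denotes preimages. That \<open>f\<close> is skeletal makes
  this operation send \<open>cl V\<close> to \<open>cl f\<^sup>-(V)\<close> for every open \<open>V\<close> (\<open>rc_map_closure_of\<close>).
  Therefore it is functorial in \<open>f\<close> and preserves joins; by skeletality again it preserves
  complements, so that it is a complete homomorphism.
  Perfectness gives the three conditions on morphisms; here (L2) is used in the form that
  every bounded element lies below the image of a bounded element (\<open>DSkePerLC_hom_iff\<close>).

  The result is a contravariant functor, and it is enough that it is full, faithful and essentially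
  surjective (\<open>equivalentI\<close>).

  \<^item> It is faithful since, if \<open>f x \<noteq> g x\<close>, a small regular closed neighbourhood of \<open>f x\<close> is sent
    to a set containing \<open>x\<close> by the operation of \<open>f\<close> but not by that of \<open>g\<close> (\<open>rc_map_faithful\<close>).

  \<^item> It is full since a morphism \<open>\<phi>\<close> is induced by the map that takes \<open>x\<close> to a common point of all
    \<open>F\<close> with \<open>x\<close> in the interior of \<open>\<phi> F\<close> (\<open>rc_map_full\<close>).

  \<^item> It is essentially surjective since every complete local contact algebra is the regular closed
    algebra of a space (\<open>region_iso\<close>). The points of this space are the filters that have a base
    of bounded elements with respect to the relation \<open>\<lless>\<close> and decide every pair \<open>a \<lless> b\<close> with \<open>a\<close>
    bounded. Each ultrafilter with a bounded element contains one, and so Stone's prime ideal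
    argument supplies the points needed for contact and for compactness.

  The size of the spaces and of the algebras matters only in one respect: the regular closed sets
  of a space have to fit into the type of the algebras, and the points of an algebra into the
  type of the spaces (\<open>dually_equivalentI\<close>).
\<close>

section \<open>Equivalences of categories\<close>

lemma is_category_opposite:
  assumes "is_category C"
  shows "is_category (opposite C)"
  using assms unfolding is_category_def opposite_def by auto

lemma is_iso_opposite: "is_iso (opposite C) a b f \<longleftrightarrow> is_iso C b a f"
  unfolding is_iso_def opposite_def by auto

definition full_functor ::
  "('o, 'm) category \<Rightarrow> ('p, 'n) category \<Rightarrow> ('o, 'm, 'p, 'n) fctr \<Rightarrow> bool" where
  "full_functor C D F \<longleftrightarrow>
     (\<forall>a\<in>Obj C. \<forall>b\<in>Obj C. Hom D (OMap F a) (OMap F b) \<subseteq> AMap F a b ` Hom C a b)"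

definition faithful_functor ::
  "('o, 'm) category \<Rightarrow> ('p, 'n) category \<Rightarrow> ('o, 'm, 'p, 'n) fctr \<Rightarrow> bool" where
  "faithful_functor C D F \<longleftrightarrow>
     (\<forall>a\<in>Obj C. \<forall>b\<in>Obj C. inj_on (AMap F a b) (Hom C a b))"

definition essentially_surjective ::
  "('o, 'm) category \<Rightarrow> ('p, 'n) category \<Rightarrow> ('o, 'm, 'p, 'n) fctr \<Rightarrow> bool" where
  "essentially_surjective C D F \<longleftrightarrow>
     (\<forall>d\<in>Obj D. \<exists>c\<in>Obj C. \<exists>e. is_iso D (OMap F c) d e)"

text \<open>
  The quasi-inverse sends \<open>d\<close> to a chosen object \<open>G d\<close> with an isomorphism
  \<open>e d : F (G d) \<rightarrow> d\<close>, and an arrow \<open>h : d \<rightarrow> d'\<close> to the unique arrow that \<open>F\<close> maps to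
  the composite of \<open>e d\<close>, \<open>h\<close> and the inverse of \<open>e d'\<close>. Since \<open>F\<close> is faithful, equations
  between arrows of \<open>C\<close> can be checked after applying \<open>F\<close>.
\<close>

lemma equivalentI:
  assumes C: "is_category C" and D: "is_category D" and F: "is_functor C D F"
    and full: "full_functor C D F" and faithful: "faithful_functor C D F"
    and surj: "essentially_surjective C D F"
  shows "equivalent C D"
proof -
  note idD = D[unfolded is_category_def, THEN conjunct1, rule_format]
  have cmpD: "Cmp D a b c g f \<in> Hom D a c"
    if "f \<in> Hom D a b" "g \<in> Hom D b c" "a \<in> Obj D" "b \<in> Obj D" "c \<in> Obj D" for a b c f g
    using D that unfolding is_category_def by blast
  have unitD: "Cmp D a a b f (Idt D a) = f" "Cmp D a b b (Idt D b) f = f"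
    if "f \<in> Hom D a b" "a \<in> Obj D" "b \<in> Obj D" for a b f
    using D that unfolding is_category_def by blast+
  have assocD: "Cmp D a b d (Cmp D b c d h g) f = Cmp D a c d h (Cmp D a b c g f)"
    if "f \<in> Hom D a b" "g \<in> Hom D b c" "h \<in> Hom D c d"
      "a \<in> Obj D" "b \<in> Obj D" "c \<in> Obj D" "d \<in> Obj D" for a b c d f g h
    using D that unfolding is_category_def by blast
  have idC: "Idt C a \<in> Hom C a a" if "a \<in> Obj C" for a
    using C that unfolding is_category_def by blast
  have cmpC: "Cmp C a b c g f \<in> Hom C a c"
    if "f \<in> Hom C a b" "g \<in> Hom C b c" "a \<in> Obj C" "b \<in> Obj C" "c \<in> Obj C" for a b c f g
    using C that unfolding is_category_def by blast
  have FO: "OMap F a \<in> Obj D" if "a \<in> Obj C" for a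
    using F that unfolding is_functor_def by blast
  have FH: "AMap F a b f \<in> Hom D (OMap F a) (OMap F b)"
    if "f \<in> Hom C a b" "a \<in> Obj C" "b \<in> Obj C" for a b f
    using F that unfolding is_functor_def by blast
  have FI: "AMap F a a (Idt C a) = Idt D (OMap F a)" if "a \<in> Obj C" for a
    using F that unfolding is_functor_def by blast
  have FC: "AMap F a c (Cmp C a b c g f) =
        Cmp D (OMap F a) (OMap F b) (OMap F c) (AMap F b c g) (AMap F a b f)"
    if "f \<in> Hom C a b" "g \<in> Hom C b c" "a \<in> Obj C" "b \<in> Obj C" "c \<in> Obj C" for a b c f g
    using F that unfolding is_functor_def by blast
  have F_eqD: "f = g" if "AMap F a b f = AMap F a b g" "f \<in> Hom C a b" "g \<in> Hom C a b"
    "a \<in> Obj C" "b \<in> Obj C" for a b f g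
    using faithful that unfolding faithful_functor_def inj_on_def by blast

  define lift where "lift a b h = inv_into (Hom C a b) (AMap F a b) h" for a b h
  have lift: "lift a b h \<in> Hom C a b" "AMap F a b (lift a b h) = h"
    if "h \<in> Hom D (OMap F a) (OMap F b)" "a \<in> Obj C" "b \<in> Obj C" for a b h
  proof -
    have "h \<in> AMap F a b ` Hom C a b" using full that unfolding full_functor_def by blast
    then show "lift a b h \<in> Hom C a b" "AMap F a b (lift a b h) = h"
      unfolding lift_def by (rule inv_into_into, rule f_inv_into_f)
  qed

  have "\<forall>d\<in>Obj D. \<exists>c e e'. c \<in> Obj C \<and> e \<in> Hom D (OMap F c) d \<and> e' \<in> Hom D d (OMap F c) \<and>
      Cmp D (OMap F c) d (OMap F c) e' e = Idt D (OMap F c) \<and> Cmp D d (OMap F c) d e e' = Idt D d"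
    using surj unfolding essentially_surjective_def is_iso_def by blast
  then obtain G0 e e' where
    G0: "\<And>d. d \<in> Obj D \<Longrightarrow> G0 d \<in> Obj C"
    and e: "\<And>d. d \<in> Obj D \<Longrightarrow> e d \<in> Hom D (OMap F (G0 d)) d"
    and e': "\<And>d. d \<in> Obj D \<Longrightarrow> e' d \<in> Hom D d (OMap F (G0 d))"
    and e'e: "\<And>d. d \<in> Obj D \<Longrightarrow>
       Cmp D (OMap F (G0 d)) d (OMap F (G0 d)) (e' d) (e d) = Idt D (OMap F (G0 d))"
    and ee': "\<And>d. d \<in> Obj D \<Longrightarrow> Cmp D d (OMap F (G0 d)) d (e d) (e' d) = Idt D d"
    by metis
  have FG: "OMap F (G0 d) \<in> Obj D" if "d \<in> Obj D" for d
    using FO G0 that by blast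
  \<comment> \<open>The arrow that \<open>F\<close> has to send \<open>G h\<close> to if \<open>e\<close> is to be natural.\<close>
  define conj where "conj d d' h = Cmp D (OMap F (G0 d)) d' (OMap F (G0 d')) (e' d')
      (Cmp D (OMap F (G0 d)) d d' h (e d))" for d d' h
  have conj: "conj d d' h \<in> Hom D (OMap F (G0 d)) (OMap F (G0 d'))"
    if "h \<in> Hom D d d'" "d \<in> Obj D" "d' \<in> Obj D" for d d' h
    unfolding conj_def using that e e' FG by (blast intro: cmpD)
  have e_conj: "Cmp D (OMap F (G0 d)) (OMap F (G0 d')) d' (e d') (conj d d' h)
      = Cmp D (OMap F (G0 d)) d d' h (e d)"
    if h: "h \<in> Hom D d d'" and d: "d \<in> Obj D" and d': "d' \<in> Obj D" for d d' h
  proof -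
    have he: "Cmp D (OMap F (G0 d)) d d' h (e d) \<in> Hom D (OMap F (G0 d)) d'"
      using h d d' e FG by (blast intro: cmpD)
    show ?thesis
      unfolding conj_def assocD[OF he e'[OF d'] e[OF d'] FG[OF d] d' FG[OF d'] d', symmetric]
      using ee'[OF d'] unitD(2)[OF he FG[OF d] d'] by simp
  qed
  have conj_unique: "k = conj d d' h"
    if k: "k \<in> Hom D (OMap F (G0 d)) (OMap F (G0 d'))"
      and eq: "Cmp D (OMap F (G0 d)) (OMap F (G0 d')) d' (e d') k = Cmp D (OMap F (G0 d)) d d' h (e d)"
      and h: "h \<in> Hom D d d'" and d: "d \<in> Obj D" and d': "d' \<in> Obj D" for d d' h k
    unfolding conj_def eq[symmetric]
      assocD[OF k e[OF d'] e'[OF d'] FG[OF d] FG[OF d'] d' FG[OF d'], symmetric] e'e[OF d']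
    using unitD(2)[OF k FG[OF d] FG[OF d']] by simp
  have conj_id: "conj d d (Idt D d) = Idt D (OMap F (G0 d))" if d: "d \<in> Obj D" for d
    using conj_unique[OF idD[OF FG[OF d]] _ idD[OF d] d d]
      unitD[OF e[OF d] FG[OF d] d] by simp
  have conj_cmp: "conj a c (Cmp D a b c g f) =
      Cmp D (OMap F (G0 a)) (OMap F (G0 b)) (OMap F (G0 c)) (conj b c g) (conj a b f)"
    if f: "f \<in> Hom D a b" and g: "g \<in> Hom D b c" and a: "a \<in> Obj D" and b: "b \<in> Obj D"
      and c: "c \<in> Obj D" for a b c f g
  proof -
    note o = FG[OF a] FG[OF b] FG[OF c]
    have cf: "conj a b f \<in> Hom D (OMap F (G0 a)) (OMap F (G0 b))" using conj[OF f a b] .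
    have cg: "conj b c g \<in> Hom D (OMap F (G0 b)) (OMap F (G0 c))" using conj[OF g b c] .
    have "Cmp D (OMap F (G0 a)) (OMap F (G0 c)) c (e c)
        (Cmp D (OMap F (G0 a)) (OMap F (G0 b)) (OMap F (G0 c)) (conj b c g) (conj a b f)) =
       Cmp D (OMap F (G0 a)) (OMap F (G0 b)) c
         (Cmp D (OMap F (G0 b)) b c g (e b)) (conj a b f)"
      using assocD[OF cf cg e[OF c] o c] e_conj[OF g b c] by simp
    also have "\<dots> = Cmp D (OMap F (G0 a)) b c g (Cmp D (OMap F (G0 a)) a b f (e a))"
      using assocD[OF cf e[OF b] g o(1,2) b c] e_conj[OF f a b] by simp
    also have "\<dots> = Cmp D (OMap F (G0 a)) a c (Cmp D a b c g f) (e a)"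
      using assocD[OF e[OF a] f g o(1) a b c] by simp
    finally show ?thesis
      using conj_unique[OF cmpD[OF cf cg o] _ cmpD[OF f g a b c] a c] by simp
  qed

  define G where "G = \<lparr>OMap = G0, AMap = (\<lambda>d d' h. lift (G0 d) (G0 d') (conj d d' h))\<rparr>"
  have G_simps: "OMap G d = G0 d" "AMap G d d' h = lift (G0 d) (G0 d') (conj d d' h)" for d d' h
    by (simp_all add: G_def)
  note liftG = lift[OF conj G0 G0]
  have G_functor: "is_functor D C G"
    unfolding is_functor_def G_simps
  proof (intro conjI ballI)
    fix a assume a: "a \<in> Obj D"
    show "lift (G0 a) (G0 a) (conj a a (Idt D a)) = Idt C (G0 a)"
      by (rule F_eqD[of "G0 a" "G0 a"])
         (use a conj_id[OF a] FI[OF G0[OF a]] liftG[OF idD[OF a] a a a a] idC G0 in auto)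
  next
    fix a b c f g
    assume a: "a \<in> Obj D" and b: "b \<in> Obj D" and c: "c \<in> Obj D"
      and f: "f \<in> Hom D a b" and g: "g \<in> Hom D b c"
    note lf = liftG[OF f a b a b] and lg = liftG[OF g b c b c]
      and lgf = liftG[OF cmpD[OF f g a b c] a c a c]
    show "lift (G0 a) (G0 c) (conj a c (Cmp D a b c g f)) =
        Cmp C (G0 a) (G0 b) (G0 c) (lift (G0 b) (G0 c) (conj b c g)) (lift (G0 a) (G0 b) (conj a b f))"
      by (rule F_eqD[of "G0 a" "G0 c"])
         (use lf lg lgf FC[OF lf(1) lg(1)] conj_cmp[OF f g a b c] a b c G0 cmpC in auto)
  qed (auto simp: G0 liftG)

  have "is_iso D (OMap F (G0 d)) d (e d)" if "d \<in> Obj D" for d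
    using e e' ee' e'e that unfolding is_iso_def by blast
  then have \<epsilon>: "is_nat_iso D D (comp_fctr F G) id_fctr e"
    unfolding is_nat_iso_def comp_fctr_def id_fctr_def
    using e_conj liftG by (auto simp: G_simps)

  define \<eta> where "\<eta> c = lift c (G0 (OMap F c)) (e' (OMap F c))" for c
  have \<eta>: "\<eta> c \<in> Hom C c (G0 (OMap F c))" "AMap F c (G0 (OMap F c)) (\<eta> c) = e' (OMap F c)"
    if "c \<in> Obj C" for c
    using lift[OF e'[OF FO[OF that]] that G0[OF FO[OF that]]] by (auto simp: \<eta>_def)
  have \<eta>_iso: "is_iso C c (G0 (OMap F c)) (\<eta> c)" if c: "c \<in> Obj C" for c
  proof -
    note Fc = FO[OF c] and GFc = G0[OF FO[OF c]]
    define \<eta>' where "\<eta>' = lift (G0 (OMap F c)) c (e (OMap F c))"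
    have \<eta>': "\<eta>' \<in> Hom C (G0 (OMap F c)) c" "AMap F (G0 (OMap F c)) c \<eta>' = e (OMap F c)"
      using lift[OF e[OF Fc] GFc c] by (auto simp: \<eta>'_def)
    have "Cmp C c (G0 (OMap F c)) c \<eta>' (\<eta> c) = Idt C c"
      by (rule F_eqD[of c c])
         (use FC[OF \<eta>(1)[OF c] \<eta>'(1) c GFc c] \<eta>(2)[OF c] \<eta>'(2) ee'[OF Fc] FI[OF c]
            cmpC[OF \<eta>(1)[OF c] \<eta>'(1) c GFc c] idC[OF c] c in auto)
    moreover have "Cmp C (G0 (OMap F c)) c (G0 (OMap F c)) (\<eta> c) \<eta>' = Idt C (G0 (OMap F c))"
      by (rule F_eqD[of "G0 (OMap F c)" "G0 (OMap F c)"])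
         (use FC[OF \<eta>'(1) \<eta>(1)[OF c] GFc c GFc] \<eta>(2)[OF c] \<eta>'(2) e'e[OF Fc] FI[OF GFc]
            cmpC[OF \<eta>'(1) \<eta>(1)[OF c] GFc c GFc] idC[OF GFc] GFc in auto)
    ultimately show ?thesis
      using \<eta>(1)[OF c] \<eta>'(1) unfolding is_iso_def by blast
  qed
  have "is_nat_iso C C id_fctr (comp_fctr G F) \<eta>"
    unfolding is_nat_iso_def comp_fctr_def id_fctr_def
  proof (simp add: \<eta>_iso G_simps, intro ballI)
    fix a b f assume a: "a \<in> Obj C" and b: "b \<in> Obj C" and f: "f \<in> Hom C a b"
    note Fa = FO[OF a] and Fb = FO[OF b] and Ff = FH[OF f a b]
    note GFa = G0[OF Fa] and GFb = G0[OF Fb]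
    let ?k = "lift (G0 (OMap F a)) (G0 (OMap F b)) (conj (OMap F a) (OMap F b) (AMap F a b f))"
    note k = liftG[OF Ff Fa Fb Fa Fb]
    note he = cmpD[OF e[OF Fa] Ff FG[OF Fa] Fa Fb]
    have "Cmp D (OMap F a) (OMap F (G0 (OMap F a))) (OMap F (G0 (OMap F b)))
        (conj (OMap F a) (OMap F b) (AMap F a b f)) (e' (OMap F a))
      = Cmp D (OMap F a) (OMap F b) (OMap F (G0 (OMap F b))) (e' (OMap F b)) (AMap F a b f)"
      unfolding conj_def assocD[OF e'[OF Fa] he e'[OF Fb] Fa FG[OF Fa] Fb FG[OF Fb]]
        assocD[OF e'[OF Fa] e[OF Fa] Ff Fa FG[OF Fa] Fa Fb]
      using ee'[OF Fa] unitD(1)[OF Ff Fa Fb] by simp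
    then show "Cmp C a b (G0 (OMap F b)) (\<eta> b) f = Cmp C a (G0 (OMap F a)) (G0 (OMap F b)) ?k (\<eta> a)"
      using F_eqD[of a "G0 (OMap F b)"] FC[OF f \<eta>(1)[OF b] a b GFb] FC[OF \<eta>(1)[OF a] k(1) a GFa GFb]
        \<eta>(2)[OF a] \<eta>(2)[OF b] k(2) cmpC[OF f \<eta>(1)[OF b] a b GFb] cmpC[OF \<eta>(1)[OF a] k(1) a GFa GFb]
        a GFb by simp
  qed
  with C D F G_functor \<epsilon> show ?thesis
    unfolding equivalent_def by blast
qed

section \<open>Boolean algebras on a carrier\<close>

locale boolean_carrier =
  fixes B :: "('a, 'z) balg_scheme"
  assumes boolean: "boolean_alg B"
begin

lemma closed [simp]:
  "zer B \<in> carr B" "uni B \<in> carr B"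
  "a \<in> carr B \<Longrightarrow> cmpl B a \<in> carr B"
  "a \<in> carr B \<Longrightarrow> b \<in> carr B \<Longrightarrow> join B a b \<in> carr B"
  "a \<in> carr B \<Longrightarrow> b \<in> carr B \<Longrightarrow> meet B a b \<in> carr B"
  using boolean unfolding boolean_alg_def by auto

lemma join_commute: "a \<in> carr B \<Longrightarrow> b \<in> carr B \<Longrightarrow> join B a b = join B b a"
  and meet_commute: "a \<in> carr B \<Longrightarrow> b \<in> carr B \<Longrightarrow> meet B a b = meet B b a"
  and meet_join_distrib: "a \<in> carr B \<Longrightarrow> b \<in> carr B \<Longrightarrow> c \<in> carr B \<Longrightarrow>
    meet B a (join B b c) = join B (meet B a b) (meet B a c)"
  and join_meet_distrib: "a \<in> carr B \<Longrightarrow> b \<in> carr B \<Longrightarrow> c \<in> carr B \<Longrightarrow>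
    join B a (meet B b c) = meet B (join B a b) (join B a c)"
  using boolean unfolding boolean_alg_def by blast+

lemma units [simp]:
  "a \<in> carr B \<Longrightarrow> join B a (zer B) = a" "a \<in> carr B \<Longrightarrow> meet B a (uni B) = a"
  "a \<in> carr B \<Longrightarrow> join B a (cmpl B a) = uni B" "a \<in> carr B \<Longrightarrow> meet B a (cmpl B a) = zer B"
  using boolean unfolding boolean_alg_def by auto

text \<open>Through the dual algebra, laws proved for joins also hold for meets.\<close>

lemma dual:
  "boolean_carrier \<lparr>carr = carr B, zer = uni B, uni = zer B, join = meet B, meet = join B, cmpl = cmpl B\<rparr>"
  using boolean unfolding boolean_carrier_def boolean_alg_def balg.select_convs by blast

lemma join_idem [simp]: "a \<in> carr B \<Longrightarrow> join B a a = a"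
  using join_meet_distrib[of a a "cmpl B a", symmetric] by simp

lemma join_uni [simp]: "a \<in> carr B \<Longrightarrow> join B a (uni B) = uni B"
  using join_meet_distrib[of a "cmpl B a" "uni B", symmetric]
    meet_commute[of "uni B" "join B a (uni B)"] by simp

lemma join_absorb [simp]: "a \<in> carr B \<Longrightarrow> b \<in> carr B \<Longrightarrow> join B a (meet B a b) = a"
  using meet_join_distrib[of a "uni B" b] join_commute[of "uni B" b] by simp

end

context boolean_carrier
begin

lemma meet_idem [simp]: "a \<in> carr B \<Longrightarrow> meet B a a = a"
  and meet_zer [simp]: "a \<in> carr B \<Longrightarrow> meet B a (zer B) = zer B"
  and meet_absorb [simp]: "a \<in> carr B \<Longrightarrow> b \<in> carr B \<Longrightarrow> meet B a (join B a b) = a"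
  using boolean_carrier.join_idem[OF dual] boolean_carrier.join_uni[OF dual] boolean_carrier.join_absorb[OF dual]
  by auto

lemma split_by_cmpl:
  assumes "a \<in> carr B" "x \<in> carr B"
  shows "join B (meet B x a) (meet B x (cmpl B a)) = x"
  using assms meet_join_distrib[of x a "cmpl B a"] by simp

text \<open>
  Huntington's axioms do not contain associativity. Both bracketings have the same meet with
  \<open>a\<close> and the same meet with the complement of \<open>a\<close>, and an element is the join of these two.
\<close>

lemma join_assoc:
  assumes a: "a \<in> carr B" and b: "b \<in> carr B" and c: "c \<in> carr B"
  shows "join B a (join B b c) = join B (join B a b) c"
proof -
  let ?x = "join B a (join B b c)" and ?y = "join B (join B a b) c" and ?n = "cmpl B a"
  have "meet B a ?x = a" using a b c by simp
  moreover have "meet B a ?y = a"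
    using a b c by (simp add: meet_join_distrib[of a "join B a b" c])
  moreover have "meet B ?n ?x = join B (meet B ?n b) (meet B ?n c)"
    using a b c join_commute[of "zer B"] by (simp add: meet_join_distrib meet_commute[of ?n a])
  moreover have "meet B ?n ?y = join B (meet B ?n b) (meet B ?n c)"
    using a b c join_commute[of "zer B"] by (simp add: meet_join_distrib meet_commute[of ?n a])
  ultimately show ?thesis
    using a b c split_by_cmpl[of a ?x] split_by_cmpl[of a ?y]
      meet_commute[of a ?x] meet_commute[of a ?y] meet_commute[of ?n ?x] meet_commute[of ?n ?y]
    by simp
qed

end

context boolean_carrier
begin

lemma meet_assoc:
  "a \<in> carr B \<Longrightarrow> b \<in> carr B \<Longrightarrow> c \<in> carr B \<Longrightarrow> meet B a (meet B b c) = meet B (meet B a b) c"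
  using boolean_carrier.join_assoc[OF dual] by auto

lemma leq_join_iff: "a \<in> carr B \<Longrightarrow> b \<in> carr B \<Longrightarrow> leq B a b \<longleftrightarrow> join B a b = b"
  unfolding leq_def by (metis join_absorb join_commute meet_absorb meet_commute closed)

lemma leq_refl [simp]: "a \<in> carr B \<Longrightarrow> leq B a a"
  unfolding leq_def by simp

lemma leq_antisym: "leq B a b \<Longrightarrow> leq B b a \<Longrightarrow> a \<in> carr B \<Longrightarrow> b \<in> carr B \<Longrightarrow> a = b"
  unfolding leq_def by (metis meet_commute)

lemma leq_trans:
  "leq B a b \<Longrightarrow> leq B b c \<Longrightarrow> a \<in> carr B \<Longrightarrow> b \<in> carr B \<Longrightarrow> c \<in> carr B \<Longrightarrow> leq B a c"
  unfolding leq_def by (metis meet_assoc)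

lemma zer_leq [simp]: "a \<in> carr B \<Longrightarrow> leq B (zer B) a"
  unfolding leq_def using meet_commute[of "zer B" a] by simp

lemma leq_uni [simp]: "a \<in> carr B \<Longrightarrow> leq B a (uni B)"
  unfolding leq_def by simp

lemma leq_zer: "a \<in> carr B \<Longrightarrow> leq B a (zer B) \<Longrightarrow> a = zer B"
  unfolding leq_def by simp

lemma meet_leq1 [simp]: "a \<in> carr B \<Longrightarrow> b \<in> carr B \<Longrightarrow> leq B (meet B a b) a"
  unfolding leq_def by (metis meet_assoc meet_commute meet_idem closed(5))

lemma meet_leq2 [simp]: "a \<in> carr B \<Longrightarrow> b \<in> carr B \<Longrightarrow> leq B (meet B a b) b"
  by (metis meet_leq1 meet_commute)

lemma leq_meetI:
  "leq B c a \<Longrightarrow> leq B c b \<Longrightarrow> a \<in> carr B \<Longrightarrow> b \<in> carr B \<Longrightarrow> c \<in> carr B \<Longrightarrow> leq B c (meet B a b)"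
  unfolding leq_def by (metis meet_assoc)

lemma leq_join1 [simp]: "a \<in> carr B \<Longrightarrow> b \<in> carr B \<Longrightarrow> leq B a (join B a b)"
  unfolding leq_def by simp

lemma leq_join2 [simp]: "a \<in> carr B \<Longrightarrow> b \<in> carr B \<Longrightarrow> leq B b (join B a b)"
  by (metis leq_join1 join_commute)

lemma join_leqI:
  "leq B a c \<Longrightarrow> leq B b c \<Longrightarrow> a \<in> carr B \<Longrightarrow> b \<in> carr B \<Longrightarrow> c \<in> carr B \<Longrightarrow> leq B (join B a b) c"
  using leq_join_iff join_assoc by (metis closed(4))

lemma cmpl_unique:
  assumes a: "a \<in> carr B" and b: "b \<in> carr B" and "join B a b = uni B" "meet B a b = zer B"
  shows "b = cmpl B a"
proof -
  have "meet B b (join B a (cmpl B a)) = meet B b (cmpl B a)"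
    using assms meet_commute[of b a] join_commute[of "zer B"]
    by (simp add: meet_join_distrib del: units(3))
  moreover have "meet B (cmpl B a) (join B a b) = meet B (cmpl B a) b"
    using a b meet_commute[of "cmpl B a" a] join_commute[of "zer B"]
    by (simp add: meet_join_distrib)
  ultimately show ?thesis
    using assms meet_commute[of b "cmpl B a"] by simp
qed

lemma cmpl_cmpl [simp]: "a \<in> carr B \<Longrightarrow> cmpl B (cmpl B a) = a"
  by (metis cmpl_unique closed(3) join_commute meet_commute units(3,4))

lemma cmpl_zer [simp]: "cmpl B (zer B) = uni B"
  by (metis cmpl_unique closed(1,2) join_uni meet_zer meet_commute)

lemma cmpl_uni [simp]: "cmpl B (uni B) = zer B"
  by (metis cmpl_cmpl cmpl_zer closed(1))

lemma leq_cmpl_iff: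
  assumes a: "a \<in> carr B" and b: "b \<in> carr B"
  shows "leq B a (cmpl B b) \<longleftrightarrow> meet B a b = zer B"
proof
  assume "leq B a (cmpl B b)"
  then have "meet B a b = meet B a (meet B (cmpl B b) b)"
    using a b unfolding leq_def by (metis meet_assoc closed(3))
  then show "meet B a b = zer B"
    using a b meet_commute[of "cmpl B b" b] by simp
next
  assume "meet B a b = zer B"
  then show "leq B a (cmpl B b)"
    using split_by_cmpl[OF b a] join_commute[of "zer B"] a b unfolding leq_def by simp
qed

lemma meet_cmpl_zer_iff: "a \<in> carr B \<Longrightarrow> b \<in> carr B \<Longrightarrow> meet B a (cmpl B b) = zer B \<longleftrightarrow> leq B a b"
  using leq_cmpl_iff[of a "cmpl B b"] by simp

lemma cmpl_leq_cmpl: "a \<in> carr B \<Longrightarrow> b \<in> carr B \<Longrightarrow> leq B (cmpl B b) (cmpl B a) \<longleftrightarrow> leq B a b"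
  by (metis leq_cmpl_iff meet_cmpl_zer_iff meet_commute closed(3))

lemma leq_cmpl_swap: "a \<in> carr B \<Longrightarrow> b \<in> carr B \<Longrightarrow> leq B a (cmpl B b) \<longleftrightarrow> leq B b (cmpl B a)"
  by (simp add: leq_cmpl_iff meet_commute)

lemma cmpl_join:
  assumes a: "a \<in> carr B" and b: "b \<in> carr B"
  shows "cmpl B (join B a b) = meet B (cmpl B a) (cmpl B b)"
proof (rule leq_antisym)
  show "leq B (cmpl B (join B a b)) (meet B (cmpl B a) (cmpl B b))"
    using a b by (intro leq_meetI) (simp_all add: cmpl_leq_cmpl)
  have "leq B (join B a b) (cmpl B (meet B (cmpl B a) (cmpl B b)))"
    using a b
    by (intro join_leqI) (simp_all add: leq_cmpl_swap[of a] leq_cmpl_swap[of b])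
  then show "leq B (meet B (cmpl B a) (cmpl B b)) (cmpl B (join B a b))"
    using a b by (simp add: leq_cmpl_swap[of "meet B (cmpl B a) (cmpl B b)"])
qed (use a b in auto)

lemma meet_via_join:
  "a \<in> carr B \<Longrightarrow> b \<in> carr B \<Longrightarrow> meet B a b = cmpl B (join B (cmpl B a) (cmpl B b))"
  by (simp add: cmpl_join)

lemma cmpl_meet:
  "a \<in> carr B \<Longrightarrow> b \<in> carr B \<Longrightarrow> cmpl B (meet B a b) = join B (cmpl B a) (cmpl B b)"
  by (simp add: meet_via_join)

lemma is_join_unique: "is_join B S x \<Longrightarrow> is_join B S y \<Longrightarrow> x = y"
  unfolding is_join_def by (blast intro: leq_antisym)

lemma is_join_empty: "is_join B {} (zer B)"
  unfolding is_join_def by simp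

lemma is_join_pair: "a \<in> carr B \<Longrightarrow> b \<in> carr B \<Longrightarrow> is_join B {a, b} (join B a b)"
  unfolding is_join_def by (auto intro: join_leqI)

lemma is_meet_iff:
  assumes S: "S \<subseteq> carr B" and x: "x \<in> carr B"
  shows "is_meet B S x \<longleftrightarrow> is_join B (cmpl B ` S) (cmpl B x)"
proof -
  have sub: "(\<forall>t\<in>cmpl B ` S. leq B t (cmpl B y)) \<longleftrightarrow> (\<forall>s\<in>S. leq B y s)" if "y \<in> carr B" for y
    using S that by (auto simp: cmpl_leq_cmpl subset_iff)
  have "(\<forall>y\<in>carr B. P y) \<longleftrightarrow> (\<forall>y\<in>carr B. P (cmpl B y))" for P
    by (metis closed(3) cmpl_cmpl)
  note this[of "\<lambda>y. (\<forall>t\<in>cmpl B ` S. leq B t y) \<longrightarrow> leq B (cmpl B x) y"]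
  then show ?thesis
    using x sub unfolding is_meet_def is_join_def by (simp add: cmpl_leq_cmpl)
qed

lemma complete_if_joins:
  assumes "\<And>S. S \<subseteq> carr B \<Longrightarrow> \<exists>x. is_join B S x"
  shows "complete_boolean_alg B"
  unfolding complete_boolean_alg_def
proof (intro conjI allI impI boolean)
  fix S assume S: "S \<subseteq> carr B"
  then show "\<exists>x. is_join B S x" by (rule assms)
  have "cmpl B ` S \<subseteq> carr B" using S by auto
  then obtain x where x: "is_join B (cmpl B ` S) x" using assms by blast
  then have "x \<in> carr B" unfolding is_join_def by simp
  with x S show "\<exists>x. is_meet B S x"
    using is_meet_iff[OF S, of "cmpl B x"] by auto
qed

subsection \<open>Ultrafilters\<close>

definition ultrafilter :: "'a set \<Rightarrow> bool" where
  "ultrafilter u \<longleftrightarrow>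
     u \<subseteq> carr B \<and> uni B \<in> u \<and> zer B \<notin> u \<and>
     (\<forall>a\<in>u. \<forall>b\<in>carr B. leq B a b \<longrightarrow> b \<in> u) \<and>
     (\<forall>a\<in>u. \<forall>b\<in>u. meet B a b \<in> u) \<and>
     (\<forall>a\<in>carr B. a \<in> u \<or> cmpl B a \<in> u)"

lemma ultrafilterD:
  assumes "ultrafilter u"
  shows "a \<in> u \<Longrightarrow> a \<in> carr B" "uni B \<in> u" "zer B \<notin> u"
    "a \<in> u \<Longrightarrow> b \<in> carr B \<Longrightarrow> leq B a b \<Longrightarrow> b \<in> u"
    "a \<in> u \<Longrightarrow> b \<in> u \<Longrightarrow> meet B a b \<in> u"
    "a \<in> carr B \<Longrightarrow> a \<in> u \<or> cmpl B a \<in> u"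
    "a \<in> u \<Longrightarrow> cmpl B a \<notin> u"
proof -
  note u = assms[unfolded ultrafilter_def]
  show "a \<in> u \<Longrightarrow> a \<in> carr B" "uni B \<in> u" "zer B \<notin> u"
    "a \<in> u \<Longrightarrow> b \<in> carr B \<Longrightarrow> leq B a b \<Longrightarrow> b \<in> u"
    "a \<in> u \<Longrightarrow> b \<in> u \<Longrightarrow> meet B a b \<in> u"
    "a \<in> carr B \<Longrightarrow> a \<in> u \<or> cmpl B a \<in> u"
    using u by blast+
  show "cmpl B a \<notin> u" if "a \<in> u"
  proof
    assume "cmpl B a \<in> u"
    then have "meet B a (cmpl B a) \<in> u" using u that by blast
    moreover have "a \<in> carr B" using u that by blast
    ultimately show False using u by simp
  qed
qed

lemma is_ideal_zer: "is_ideal B {zer B}"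
  unfolding is_ideal_def by (auto dest: leq_zer)

lemma is_idealD:
  assumes "is_ideal B J"
  shows "J \<subseteq> carr B" "zer B \<in> J" "a \<in> J \<Longrightarrow> b \<in> carr B \<Longrightarrow> leq B b a \<Longrightarrow> b \<in> J"
    "a \<in> J \<Longrightarrow> b \<in> J \<Longrightarrow> join B a b \<in> J"
  using assms unfolding is_ideal_def by blast+

lemma is_ideal_residual:
  assumes J: "is_ideal B J" and x: "x \<in> carr B"
  shows "is_ideal B {y \<in> carr B. meet B y x \<in> J}" "J \<subseteq> {y \<in> carr B. meet B y x \<in> J}"
proof -
  have joins: "meet B (join B a b) x \<in> J"
    if "a \<in> carr B" "b \<in> carr B" "meet B a x \<in> J" "meet B b x \<in> J" for a b
    using is_idealD(4)[OF J] that x meet_join_distrib[of x a b] by (simp add: meet_commute[of x])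
  have down: "meet B b x \<in> J"
    if a: "a \<in> carr B" and b: "b \<in> carr B" and ax: "meet B a x \<in> J" and ba: "leq B b a" for a b
  proof -
    have "leq B (meet B b x) (meet B a x)"
      using a b x ba by (intro leq_meetI) (auto intro: leq_trans[of _ b])
    then show ?thesis
      using is_idealD(3)[OF J ax] b x by simp
  qed
  show "is_ideal B {y \<in> carr B. meet B y x \<in> J}"
    unfolding is_ideal_def
  proof (intro conjI ballI impI)
    have "meet B (zer B) x = zer B" using x meet_commute[of "zer B" x] by simp
    then show "zer B \<in> {y \<in> carr B. meet B y x \<in> J}" using is_idealD(2)[OF J] by simp
  next
    fix a b assume "a \<in> {y \<in> carr B. meet B y x \<in> J}" "b \<in> carr B" "leq B b a"
    then show "b \<in> {y \<in> carr B. meet B y x \<in> J}" using down[of a b] by simp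
  next
    fix a b assume "a \<in> {y \<in> carr B. meet B y x \<in> J}" "b \<in> {y \<in> carr B. meet B y x \<in> J}"
    then show "join B a b \<in> {y \<in> carr B. meet B y x \<in> J}" using joins[of a b] by simp
  qed simp
  show "J \<subseteq> {y \<in> carr B. meet B y x \<in> J}"
  proof
    fix y assume y: "y \<in> J"
    then have "y \<in> carr B" using is_idealD(1)[OF J] by blast
    then show "y \<in> {y \<in> carr B. meet B y x \<in> J}"
      using is_idealD(3)[OF J y, of "meet B y x"] x by simp
  qed
qed

text \<open>
  An ideal maximal among those that contain \<open>I\<close> and miss \<open>a\<close> is prime: otherwise its residuals
  by \<open>x\<close> and by the complement of \<open>x\<close> would both contain \<open>a\<close>, and hence it would contain \<open>a\<close>.
\<close>

lemma ultrafilter_exists: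
  assumes I: "is_ideal B I" and a: "a \<in> carr B" and aI: "a \<notin> I"
  shows "\<exists>u. ultrafilter u \<and> a \<in> u \<and> u \<inter> I = {}"
proof -
  let ?A = "{J. is_ideal B J \<and> I \<subseteq> J \<and> a \<notin> J}"
  have "\<exists>M\<in>?A. \<forall>X\<in>?A. M \<subseteq> X \<longrightarrow> X = M"
  proof (rule subset_Zorn_nonempty)
    show "?A \<noteq> {}" using I aI by blast
    fix \<C> assume ne: "\<C> \<noteq> {}" and ch: "subset.chain ?A \<C>"
    have id: "is_ideal B J" "I \<subseteq> J" "a \<notin> J" if "J \<in> \<C>" for J
      using ch that unfolding subset.chain_def by auto
    have "join B x y \<in> \<Union>\<C>" if xy: "x \<in> J" "J \<in> \<C>" "y \<in> K" "K \<in> \<C>" for x y J K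
    proof -
      have "J \<subseteq> K \<or> K \<subseteq> J" using ch xy unfolding subset.chain_def by blast
      then show ?thesis using xy is_idealD(4)[OF id(1)] by (meson UnionI subsetD)
    qed
    moreover have "\<Union>\<C> \<subseteq> carr B" "\<forall>x\<in>\<Union>\<C>. \<forall>y\<in>carr B. leq B y x \<longrightarrow> y \<in> \<Union>\<C>" "zer B \<in> \<Union>\<C>"
      using is_idealD(1,2,3)[OF id(1)] ne by blast+
    ultimately have "is_ideal B (\<Union>\<C>)"
      unfolding is_ideal_def by blast
    then show "\<Union>\<C> \<in> ?A"
      using id ne by blast
  qed
  then obtain J where "J \<in> ?A" and maxJ: "\<forall>X\<in>?A. J \<subseteq> X \<longrightarrow> X = J" ..
  then have J: "is_ideal B J" and IJ: "I \<subseteq> J" and aJ: "a \<notin> J" by auto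
  have max: "K = J" if "is_ideal B K" "J \<subseteq> K" "a \<notin> K" for K
    using maxJ IJ that by blast
  have res: "meet B a x \<in> J \<or> y \<in> J" if x: "x \<in> carr B" and y: "y \<in> carr B" and yx: "meet B y x = zer B" for x y
  proof (rule ccontr)
    assume neg: "\<not> ?thesis"
    then have "{y \<in> carr B. meet B y x \<in> J} = J"
      using max[OF is_ideal_residual[OF J x]] by blast
    moreover have "meet B y x \<in> J" using yx is_idealD(2)[OF J] by simp
    ultimately show False using y neg by blast
  qed
  have prime: "x \<in> J \<or> cmpl B x \<in> J" if x: "x \<in> carr B" for x
  proof (rule ccontr)
    assume neg: "\<not> ?thesis"
    then have "meet B a x \<in> J" "meet B a (cmpl B x) \<in> J"
      using res[of x "cmpl B x"] res[of "cmpl B x" x] x by (auto simp: meet_commute)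
    then have "join B (meet B a x) (meet B a (cmpl B x)) \<in> J"
      using is_idealD(4)[OF J] by blast
    then show False using aJ a x split_by_cmpl by simp
  qed
  note JB = is_idealD(1)[OF J] and zJ = is_idealD(2)[OF J] and down = is_idealD(3)[OF J]
    and jJ = is_idealD(4)[OF J]
  have oneJ: "uni B \<notin> J" using down[of "uni B" a] a aJ by auto
  have not_both: "cmpl B x \<notin> J" if "x \<in> J" for x
    using jJ[OF that] oneJ JB that by (metis subsetD units(3))
  have "ultrafilter (carr B - J)"
    unfolding ultrafilter_def
  proof (intro conjI ballI impI)
    fix x y assume xy: "x \<in> carr B - J" "y \<in> carr B - J"
    then have "join B (cmpl B x) (cmpl B y) \<in> J" using prime jJ by blast
    then have "meet B x y \<notin> J" using not_both meet_via_join[of x y] xy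
      by (metis DiffD1)
    then show "meet B x y \<in> carr B - J" using xy by simp
  next
    fix x assume "x \<in> carr B"
    then show "x \<in> carr B - J \<or> cmpl B x \<in> carr B - J" using not_both by auto
  qed (use oneJ zJ down in auto)
  then show ?thesis using a aJ IJ by blast
qed

end

section \<open>Complete homomorphisms and their left adjoints\<close>

text \<open>
  Complements and arbitrary joins determine the rest: zero is the empty join, and De Morgan's
  laws give the unit and all meets.
\<close>

lemma complete_boolean_homI:
  assumes A: "boolean_alg A" and B: "boolean_alg B"
    and maps: "\<And>a. a \<in> carr A \<Longrightarrow> \<phi> a \<in> carr B"
    and cmpl: "\<And>a. a \<in> carr A \<Longrightarrow> \<phi> (cmpl A a) = cmpl B (\<phi> a)"
    and joins: "\<And>S x. S \<subseteq> carr A \<Longrightarrow> is_join A S x \<Longrightarrow> is_join B (\<phi> ` S) (\<phi> x)"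
  shows "complete_boolean_hom A B \<phi>"
proof -
  interpret A: boolean_carrier A by (rule boolean_carrier.intro[OF A])
  interpret B: boolean_carrier B by (rule boolean_carrier.intro[OF B])
  have zer: "\<phi> (zer A) = zer B"
    using B.is_join_unique[OF _ B.is_join_empty] joins[OF _ A.is_join_empty] by simp
  have uni: "\<phi> (uni A) = uni B"
    using cmpl[of "zer A"] zer by simp
  have join: "\<phi> (join A a b) = join B (\<phi> a) (\<phi> b)" if "a \<in> carr A" "b \<in> carr A" for a b
    using B.is_join_unique[OF _ B.is_join_pair] joins[OF _ A.is_join_pair[OF that]] that maps by simp
  have meet: "\<phi> (meet A a b) = meet B (\<phi> a) (\<phi> b)" if "a \<in> carr A" "b \<in> carr A" for a b
    using that by (simp add: A.meet_via_join[OF that] B.meet_via_join cmpl join maps)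
  have "is_meet B (\<phi> ` S) (\<phi> x)" if S: "S \<subseteq> carr A" and x: "is_meet A S x" for S x
  proof -
    have xA: "x \<in> carr A" using x unfolding is_meet_def by simp
    have "is_join A (cmpl A ` S) (cmpl A x)"
      using x A.is_meet_iff[OF S xA] by simp
    then have "is_join B (\<phi> ` cmpl A ` S) (\<phi> (cmpl A x))"
      using S by (intro joins) auto
    moreover have "\<phi> ` cmpl A ` S = cmpl B ` \<phi> ` S"
      using S cmpl by (force simp: image_image)
    ultimately show ?thesis
      using B.is_meet_iff[of "\<phi> ` S" "\<phi> x"] S xA maps cmpl[OF xA] by auto
  qed
  with zer uni join meet cmpl maps joins show ?thesis
    unfolding complete_boolean_hom_def boolean_hom_def by auto
qed

lemma complete_boolean_homD:
  assumes "complete_boolean_hom A B \<phi>"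
  shows "a \<in> carr A \<Longrightarrow> \<phi> a \<in> carr B"
    and "\<phi> (zer A) = zer B" and "\<phi> (uni A) = uni B"
    and "a \<in> carr A \<Longrightarrow> \<phi> (cmpl A a) = cmpl B (\<phi> a)"
    and "a \<in> carr A \<Longrightarrow> b \<in> carr A \<Longrightarrow> \<phi> (meet A a b) = meet B (\<phi> a) (\<phi> b)"
    and "a \<in> carr A \<Longrightarrow> b \<in> carr A \<Longrightarrow> leq A a b \<Longrightarrow> leq B (\<phi> a) (\<phi> b)"
    and "S \<subseteq> carr A \<Longrightarrow> is_join A S x \<Longrightarrow> is_join B (\<phi> ` S) (\<phi> x)"
    and "S \<subseteq> carr A \<Longrightarrow> is_meet A S x \<Longrightarrow> is_meet B (\<phi> ` S) (\<phi> x)"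
proof -
  note h = assms[unfolded complete_boolean_hom_def boolean_hom_def]
  show "a \<in> carr A \<Longrightarrow> \<phi> a \<in> carr B" "\<phi> (zer A) = zer B" "\<phi> (uni A) = uni B"
    "a \<in> carr A \<Longrightarrow> \<phi> (cmpl A a) = cmpl B (\<phi> a)"
    and meet: "a \<in> carr A \<Longrightarrow> b \<in> carr A \<Longrightarrow> \<phi> (meet A a b) = meet B (\<phi> a) (\<phi> b)"
    using h by auto
  show "S \<subseteq> carr A \<Longrightarrow> is_join A S x \<Longrightarrow> is_join B (\<phi> ` S) (\<phi> x)"
    and "S \<subseteq> carr A \<Longrightarrow> is_meet A S x \<Longrightarrow> is_meet B (\<phi> ` S) (\<phi> x)"
    using h by blast+
  show "a \<in> carr A \<Longrightarrow> b \<in> carr A \<Longrightarrow> leq A a b \<Longrightarrow> leq B (\<phi> a) (\<phi> b)"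
    using meet unfolding leq_def by metis
qed

text \<open>The left adjoint at \<open>b\<close> is the meet of all \<open>a\<close> with \<open>b \<le> \<phi> a\<close>, since \<open>\<phi>\<close> preserves this meet.\<close>

lemma left_adj_properties:
  assumes A: "complete_boolean_alg A" and B: "boolean_alg B"
    and \<phi>: "complete_boolean_hom A B \<phi>" and b: "b \<in> carr B"
  shows "left_adj A B \<phi> b \<in> carr A"
    and "a \<in> carr A \<Longrightarrow> leq B b (\<phi> a) \<longleftrightarrow> leq A (left_adj A B \<phi> b) a"
proof -
  interpret A: boolean_carrier A
    using A boolean_carrier.intro unfolding complete_boolean_alg_def by blast
  interpret B: boolean_carrier B by (rule boolean_carrier.intro[OF B])
  note D = complete_boolean_homD[OF \<phi>]
  let ?P = "\<lambda>c. c \<in> carr A \<and> (\<forall>a\<in>carr A. leq B b (\<phi> a) \<longleftrightarrow> leq A c a)"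
  define S where "S = {a \<in> carr A. leq B b (\<phi> a)}"
  have S: "S \<subseteq> carr A" unfolding S_def by blast
  then obtain c where c: "is_meet A S c"
    using A unfolding complete_boolean_alg_def by blast
  then have cA: "c \<in> carr A" unfolding is_meet_def by blast
  have "leq B b (\<phi> c)"
    using D(8)[OF S c] b unfolding is_meet_def S_def by blast
  then have "leq B b (\<phi> a)" if "leq A c a" "a \<in> carr A" for a
    using B.leq_trans[of b "\<phi> c" "\<phi> a"] D(1,6) cA that b by blast
  moreover have "leq A c a" if "leq B b (\<phi> a)" "a \<in> carr A" for a
    using c that unfolding is_meet_def S_def by blast
  ultimately have Pc: "?P c" using cA by blast
  have "d = c" if "?P d" for d
    using Pc that A.leq_antisym A.leq_refl by metis
  with Pc have "?P (left_adj A B \<phi> b)"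
    unfolding left_adj_def by (rule theI)
  then show "left_adj A B \<phi> b \<in> carr A"
    and "a \<in> carr A \<Longrightarrow> leq B b (\<phi> a) \<longleftrightarrow> leq A (left_adj A B \<phi> b) a"
    by auto
qed

text \<open>
  The left adjoint at \<open>b\<close> is the least \<open>a\<close> with \<open>b \<le> \<phi> a\<close>, and ideals are closed downwards.
\<close>

lemma left_adj_in_ideal_iff:
  assumes A: "complete_boolean_alg A" and B: "boolean_alg B"
    and \<phi>: "complete_boolean_hom A B \<phi>" and b: "b \<in> carr B" and I: "is_ideal A I"
  shows "left_adj A B \<phi> b \<in> I \<longleftrightarrow> (\<exists>a\<in>I. leq B b (\<phi> a))"
proof -
  interpret A: boolean_carrier A
    using A boolean_carrier.intro unfolding complete_boolean_alg_def by blast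
  note l = left_adj_properties[OF A B \<phi> b]
  show ?thesis
    using l(1) l(2)[OF l(1)] l(2) A.is_idealD(1,3)[OF I] by (meson A.leq_refl subsetD)
qed

section \<open>Local contact algebras and their morphisms\<close>

lemma complete_lcaD:
  assumes "complete_lca A"
  shows "complete_boolean_alg A" "boolean_alg A" "boolean_carrier A" "contact_algebra A"
    "is_ideal A (bounded_elts A)"
  using assms
  unfolding complete_lca_def complete_boolean_alg_def local_contact_algebra_def boolean_carrier_def
  by auto

text \<open>
  Condition (L2) without the left adjoint: every bounded element lies below the image of a
  bounded element. This form is visibly closed under composition.
\<close>

lemma DSkePerLC_hom_iff:
  assumes A: "complete_lca A" and B: "complete_lca B"
  shows "DSkePerLC_hom A B \<phi> \<longleftrightarrow>
    complete_boolean_hom A B \<phi> \<and>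
    (\<forall>a\<in>carr A. \<forall>b\<in>carr A. contact B (\<phi> a) (\<phi> b) \<longrightarrow> contact A a b) \<and>
    (\<forall>b\<in>bounded_elts B. \<exists>a\<in>bounded_elts A. leq B b (\<phi> a)) \<and>
    (\<forall>a\<in>bounded_elts A. \<phi> a \<in> bounded_elts B)"
proof -
  have "bounded_elts B \<subseteq> carr B"
    using complete_lcaD(5)[OF B] unfolding is_ideal_def by blast
  then have "left_adj A B \<phi> b \<in> bounded_elts A \<longleftrightarrow> (\<exists>a\<in>bounded_elts A. leq B b (\<phi> a))"
    if "b \<in> bounded_elts B" "complete_boolean_hom A B \<phi>" for b
    using left_adj_in_ideal_iff[OF complete_lcaD(1)[OF A] complete_lcaD(2)[OF B] that(2) _
        complete_lcaD(5)[OF A]] that(1) by blast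
  then show ?thesis
    unfolding DSkePerLC_hom_def by blast
qed

lemma DSkePerLC_hom_cong:
  assumes A: "complete_lca A" and B: "complete_lca B" and \<phi>: "DSkePerLC_hom A B \<phi>"
    and eq: "\<And>a. a \<in> carr A \<Longrightarrow> \<psi> a = \<phi> a"
  shows "DSkePerLC_hom A B \<psi>"
proof -
  interpret A: boolean_carrier A by (rule complete_lcaD(3)[OF A])
  have img: "\<psi> ` S = \<phi> ` S" if "S \<subseteq> carr A" for S
    using that eq by (intro image_cong) auto
  have h: "complete_boolean_hom A B \<phi>"
    using \<phi> unfolding DSkePerLC_hom_def by blast
  note D = complete_boolean_homD[OF h]
  have "complete_boolean_hom A B \<psi>"
  proof (rule complete_boolean_homI[OF complete_lcaD(2)[OF A] complete_lcaD(2)[OF B]])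
    fix S x assume S: "S \<subseteq> carr A" and x: "is_join A S x"
    then have "x \<in> carr A" unfolding is_join_def by blast
    then show "is_join B (\<psi> ` S) (\<psi> x)" using D(7)[OF S x] img[OF S] eq by simp
  qed (use D eq in auto)
  moreover have "a \<in> carr A" if "a \<in> bounded_elts A" for a
    using A.is_idealD(1)[OF complete_lcaD(5)[OF A]] that by blast
  ultimately show ?thesis
    using \<phi> eq unfolding DSkePerLC_hom_iff[OF A B] by metis
qed

lemma DSkePerLC_hom_id:
  assumes A: "complete_lca A"
  shows "DSkePerLC_hom A A (\<lambda>a. a)"
proof -
  interpret A: boolean_carrier A by (rule complete_lcaD(3)[OF A])
  have "complete_boolean_hom A A (\<lambda>a. a)"
    by (rule complete_boolean_homI) (auto simp: A.boolean)
  moreover have "leq A b b" if "b \<in> bounded_elts A" for b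
    using A.is_idealD(1)[OF complete_lcaD(5)[OF A]] that A.leq_refl by blast
  ultimately show ?thesis
    unfolding DSkePerLC_hom_iff[OF A A] by blast
qed

lemma DSkePerLC_hom_comp:
  assumes A: "complete_lca A" and B: "complete_lca B" and C: "complete_lca C"
    and \<phi>: "DSkePerLC_hom A B \<phi>" and \<psi>: "DSkePerLC_hom B C \<psi>"
  shows "DSkePerLC_hom A C (\<lambda>a. \<psi> (\<phi> a))"
proof -
  interpret B: boolean_carrier B by (rule complete_lcaD(3)[OF B])
  interpret C: boolean_carrier C by (rule complete_lcaD(3)[OF C])
  note f = \<phi>[unfolded DSkePerLC_hom_iff[OF A B]] and g = \<psi>[unfolded DSkePerLC_hom_iff[OF B C]]
  note F = complete_boolean_homD[OF conjunct1[OF f]] and G = complete_boolean_homD[OF conjunct1[OF g]]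
  have "complete_boolean_hom A C (\<lambda>a. \<psi> (\<phi> a))"
  proof (rule complete_boolean_homI[OF complete_lcaD(2)[OF A] complete_lcaD(2)[OF C]])
    fix S x assume S: "S \<subseteq> carr A" and x: "is_join A S x"
    have "\<phi> ` S \<subseteq> carr B" using S F(1) by auto
    then show "is_join C ((\<lambda>a. \<psi> (\<phi> a)) ` S) (\<psi> (\<phi> x))"
      using G(7)[OF _ F(7)[OF S x]] by (simp add: image_image)
  qed (use F G in auto)
  moreover have "\<exists>a\<in>bounded_elts A. leq C c (\<psi> (\<phi> a))" if c: "c \<in> bounded_elts C" for c
  proof -
    obtain b where b: "b \<in> bounded_elts B" "leq C c (\<psi> b)" using g c by blast
    obtain a where a: "a \<in> bounded_elts A" "leq B b (\<phi> a)" using f b by blast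
    have "c \<in> carr C" "b \<in> carr B" "a \<in> carr A"
      using a(1) b(1) c complete_lcaD(5) A B C unfolding is_ideal_def by blast+
    then show ?thesis
      using a b C.leq_trans[OF b(2) G(6)[OF _ _ a(2)]] F(1) G(1) by blast
  qed
  moreover have "contact A a b" if "a \<in> carr A" "b \<in> carr A" "contact C (\<psi> (\<phi> a)) (\<psi> (\<phi> b))" for a b
    using f g that F(1) by blast
  moreover have "\<psi> (\<phi> a) \<in> bounded_elts C" if "a \<in> bounded_elts A" for a
    using f g that by blast
  ultimately show ?thesis
    unfolding DSkePerLC_hom_iff[OF A C] by blast
qed

lemma is_category_DSkePerLC: "is_category (DSkePerLC \<A>)"
proof -
  have maps: "\<phi> \<in> carr A \<rightarrow> carr B" if "DSkePerLC_hom A B \<phi>" for A B :: "'a lca" and \<phi>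
    using that unfolding DSkePerLC_hom_def complete_boolean_hom_def boolean_hom_def by blast
  have "DSkePerLC_hom A A (restrict (\<lambda>a. a) (carr A))" if "complete_lca A" for A :: "'a lca"
    by (rule DSkePerLC_hom_cong[OF that that DSkePerLC_hom_id[OF that]]) simp
  moreover have "DSkePerLC_hom A C (compose (carr A) \<psi> \<phi>)"
    if "complete_lca A" "complete_lca B" "complete_lca C" "DSkePerLC_hom A B \<phi>" "DSkePerLC_hom B C \<psi>"
    for A B C :: "'a lca" and \<phi> \<psi>
    by (rule DSkePerLC_hom_cong[OF that(1,3) DSkePerLC_hom_comp[OF that]]) (simp add: compose_eq)
  moreover have "compose (carr A) \<phi> (restrict (\<lambda>a. a) (carr A)) = \<phi>"
    "compose (carr A) (restrict (\<lambda>a. a) (carr B)) \<phi> = \<phi>"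
    if "\<phi> \<in> extensional (carr A)" "DSkePerLC_hom A B \<phi>" for A B :: "'a lca" and \<phi>
    using that maps[OF that(2)] by (auto simp: compose_def fun_eq_iff extensional_def restrict_def)
  moreover have "compose (carr A) (compose (carr B) \<theta> \<psi>) \<phi> = compose (carr A) \<theta> (compose (carr A) \<psi> \<phi>)"
    if "DSkePerLC_hom A B \<phi>" for A B :: "'a lca" and \<phi> \<psi> \<theta> :: "'a \<Rightarrow> 'a"
    using maps[OF that] by (auto simp: compose_def fun_eq_iff)
  ultimately show ?thesis
    unfolding is_category_def DSkePerLC_def by simp blast
qed

subsection \<open>Isomorphisms\<close>

definition lca_iso :: "'a lca \<Rightarrow> 'b lca \<Rightarrow> ('a \<Rightarrow> 'b) \<Rightarrow> bool" where
  "lca_iso A B \<phi> \<longleftrightarrow>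
     bij_betw \<phi> (carr A) (carr B) \<and>
     (\<forall>a\<in>carr A. \<phi> (cmpl A a) = cmpl B (\<phi> a)) \<and>
     (\<forall>a\<in>carr A. \<forall>b\<in>carr A. leq B (\<phi> a) (\<phi> b) \<longleftrightarrow> leq A a b) \<and>
     (\<forall>a\<in>carr A. \<forall>b\<in>carr A. contact B (\<phi> a) (\<phi> b) \<longleftrightarrow> contact A a b) \<and>
     (\<forall>a\<in>carr A. \<phi> a \<in> bounded_elts B \<longleftrightarrow> a \<in> bounded_elts A)"

lemma lca_iso_inverse:
  assumes A: "complete_lca A" and \<phi>: "lca_iso A B \<phi>"
  shows "lca_iso B A (inv_into (carr A) \<phi>)"
proof -
  interpret A: boolean_carrier A by (rule complete_lcaD(3)[OF A])
  have bij: "bij_betw \<phi> (carr A) (carr B)" using \<phi> unfolding lca_iso_def by blast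
  have eq: "inv_into (carr A) \<phi> (\<phi> a) = a" if "a \<in> carr A" for a
    using bij_betw_inv_into_left[OF bij that] .
  have carr: "carr B = \<phi> ` carr A" using bij unfolding bij_betw_def by simp
  show ?thesis
    using \<phi> bij_betw_inv_into[OF bij] unfolding lca_iso_def carr
    by (simp add: eq flip: bij_betw_def) (metis A.closed(3) eq)
qed

lemma lca_iso_hom:
  assumes A: "complete_lca A" and B: "complete_lca B" and \<phi>: "lca_iso A B \<phi>"
  shows "DSkePerLC_hom A B \<phi>"
proof -
  interpret A: boolean_carrier A by (rule complete_lcaD(3)[OF A])
  interpret B: boolean_carrier B by (rule complete_lcaD(3)[OF B])
  note i = \<phi>[unfolded lca_iso_def]
  have carr: "carr B = \<phi> ` carr A" using i unfolding bij_betw_def by simp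
  have "complete_boolean_hom A B \<phi>"
  proof (rule complete_boolean_homI[OF A.boolean B.boolean])
    fix S x assume S: "S \<subseteq> carr A" and x: "is_join A S x"
    have "s \<in> carr A" if "s \<in> S" for s using S that by blast
    with x i show "is_join B (\<phi> ` S) (\<phi> x)"
      unfolding is_join_def carr by simp
  qed (use i carr in auto)
  moreover have "\<exists>a\<in>bounded_elts A. leq B b (\<phi> a)" if b: "b \<in> bounded_elts B" for b
  proof -
    have bB: "b \<in> carr B"
      using B.is_idealD(1)[OF complete_lcaD(5)[OF B]] b by blast
    then obtain a where "a \<in> carr A" "b = \<phi> a" using carr by blast
    with b bB i B.leq_refl[OF bB] show ?thesis by blast
  qed
  moreover have "\<phi> a \<in> bounded_elts B" if "a \<in> bounded_elts A" for a
    using i A.is_idealD(1)[OF complete_lcaD(5)[OF A]] that by blast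
  ultimately show ?thesis
    using i unfolding DSkePerLC_hom_iff[OF A B] by blast
qed

definition transport_lca :: "('a \<Rightarrow> 'b) \<Rightarrow> 'a lca \<Rightarrow> 'b lca" where
  "transport_lca i A =
     (let j = inv_into (carr A) i in
      \<lparr>carr = i ` carr A, zer = i (zer A), uni = i (uni A),
       join = (\<lambda>x y. i (join A (j x) (j y))), meet = (\<lambda>x y. i (meet A (j x) (j y))),
       cmpl = (\<lambda>x. i (cmpl A (j x))),
       contact = (\<lambda>x y. contact A (j x) (j y)),
       bounded_elts = i ` bounded_elts A\<rparr>)"

lemma transport_lca:
  assumes A: "complete_lca A" and i: "inj_on i (carr A)"
  shows "complete_lca (transport_lca i A)" and "lca_iso A (transport_lca i A) i"
proof -
  interpret A: boolean_carrier A by (rule complete_lcaD(3)[OF A])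
  let ?T = "transport_lca i A"
  have carr [simp]: "carr ?T = i ` carr A" "zer ?T = i (zer A)" "uni ?T = i (uni A)"
    "bounded_elts ?T = i ` bounded_elts A"
    by (simp_all add: transport_lca_def Let_def)
  have bA: "a \<in> carr A" if "a \<in> bounded_elts A" for a
    using A.is_idealD(1)[OF complete_lcaD(5)[OF A]] that by blast
  have ops [simp]:
    "a \<in> carr A \<Longrightarrow> b \<in> carr A \<Longrightarrow> join ?T (i a) (i b) = i (join A a b)"
    "a \<in> carr A \<Longrightarrow> b \<in> carr A \<Longrightarrow> meet ?T (i a) (i b) = i (meet A a b)"
    "a \<in> carr A \<Longrightarrow> cmpl ?T (i a) = i (cmpl A a)"
    "a \<in> carr A \<Longrightarrow> b \<in> carr A \<Longrightarrow> contact ?T (i a) (i b) = contact A a b" for a b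
    using i by (simp_all add: transport_lca_def Let_def inv_into_f_f)
  have eq [simp]: "a \<in> carr A \<Longrightarrow> b \<in> carr A \<Longrightarrow> i a = i b \<longleftrightarrow> a = b" for a b
    using i by (simp add: inj_on_eq_iff)
  have mem [simp]: "a \<in> carr A \<Longrightarrow> i a \<in> i ` bounded_elts A \<longleftrightarrow> a \<in> bounded_elts A" for a
    using bA eq by blast
  have leq [simp]: "a \<in> carr A \<Longrightarrow> b \<in> carr A \<Longrightarrow> leq ?T (i a) (i b) = leq A a b" for a b
    by (simp add: leq_def)
  have way [simp]: "a \<in> carr A \<Longrightarrow> b \<in> carr A \<Longrightarrow> way_inside ?T (i a) (i b) = way_inside A a b" for a b
    by (simp add: way_inside_def)
  note defs = boolean_alg_def contact_algebra_def local_contact_algebra_def complete_lca_def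
  have "boolean_alg ?T"
    unfolding boolean_alg_def
  proof (intro conjI ballI)
    fix x y assume "x \<in> carr ?T" "y \<in> carr ?T"
    then obtain a b where "a \<in> carr A" "b \<in> carr A" "x = i a" "y = i b" by auto
    then show "join ?T x y = join ?T y x" "meet ?T x y = meet ?T y x"
      by (simp_all add: A.join_commute A.meet_commute)
    fix z assume "z \<in> carr ?T"
    then obtain c where "c \<in> carr A" "z = i c" by auto
    with \<open>a \<in> carr A\<close> \<open>b \<in> carr A\<close> \<open>x = i a\<close> \<open>y = i b\<close>
    show "meet ?T x (join ?T y z) = join ?T (meet ?T x y) (meet ?T x z)"
      "join ?T x (meet ?T y z) = meet ?T (join ?T x y) (join ?T x z)"
      using A.meet_join_distrib[of a b c] A.join_meet_distrib[of a b c] by simp_all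
  qed auto
  then interpret T: boolean_carrier ?T by (rule boolean_carrier.intro)
  have "complete_boolean_alg ?T"
  proof (rule T.complete_if_joins)
    fix S assume "S \<subseteq> carr ?T"
    then obtain R where R: "R \<subseteq> carr A" "S = i ` R" by (auto simp: subset_image_iff)
    obtain x where x: "is_join A R x"
      using R(1) complete_lcaD(1)[OF A] unfolding complete_boolean_alg_def by blast
    have "s \<in> carr A" if "s \<in> R" for s using that R(1) by blast
    with x have "is_join ?T S (i x)" unfolding R(2) is_join_def by simp
    then show "\<exists>x. is_join ?T S x" ..
  qed
  moreover have "contact_algebra ?T"
    unfolding contact_algebra_def
  proof (intro conjI T.boolean)
    note ax = complete_lcaD(4)[OF A, unfolded contact_algebra_def]
    show "\<forall>a\<in>carr ?T. a \<noteq> zer ?T \<longrightarrow> contact ?T a a"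
      "\<forall>a\<in>carr ?T. \<forall>b\<in>carr ?T. contact ?T a b \<longrightarrow> a \<noteq> zer ?T \<and> b \<noteq> zer ?T"
      by (clarsimp; use ax in blast)+
    show "\<forall>a\<in>carr ?T. \<forall>b\<in>carr ?T. contact ?T a b \<longrightarrow> contact ?T b a"
      "\<forall>a\<in>carr ?T. \<forall>b\<in>carr ?T. \<forall>c\<in>carr ?T.
        contact ?T a (join ?T b c) \<longleftrightarrow> contact ?T a b \<or> contact ?T a c"
      by (clarsimp; use ax in blast)+
  qed
  moreover have "is_ideal ?T (bounded_elts ?T)"
    unfolding is_ideal_def
  proof (intro conjI)
    note ax = A.is_idealD[OF complete_lcaD(5)[OF A]]
    show "bounded_elts ?T \<subseteq> carr ?T" "zer ?T \<in> bounded_elts ?T" using ax by auto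
    show "\<forall>a\<in>bounded_elts ?T. \<forall>b\<in>carr ?T. leq ?T b a \<longrightarrow> b \<in> bounded_elts ?T"
      "\<forall>a\<in>bounded_elts ?T. \<forall>b\<in>bounded_elts ?T. join ?T a b \<in> bounded_elts ?T"
      by (clarsimp simp: bA; use ax(3,4) in blast)+
  qed
  moreover have "\<forall>a\<in>bounded_elts ?T. \<forall>c\<in>carr ?T. way_inside ?T a c \<longrightarrow>
        (\<exists>b\<in>bounded_elts ?T. way_inside ?T a b \<and> way_inside ?T b c)"
    and "\<forall>a\<in>carr ?T. \<forall>b\<in>carr ?T. contact ?T a b \<longrightarrow>
        (\<exists>c\<in>bounded_elts ?T. contact ?T a (meet ?T c b))"
    and "\<forall>a\<in>carr ?T. a \<noteq> zer ?T \<longrightarrow> (\<exists>b\<in>bounded_elts ?T - {zer ?T}. way_inside ?T b a)"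
  proof -
    have "\<forall>a\<in>bounded_elts A. \<forall>c\<in>carr A. way_inside A a c \<longrightarrow>
        (\<exists>b\<in>bounded_elts A. way_inside A a b \<and> way_inside A b c)"
      and "\<forall>a\<in>carr A. \<forall>b\<in>carr A. contact A a b \<longrightarrow> (\<exists>c\<in>bounded_elts A. contact A a (meet A c b))"
      and "\<forall>a\<in>carr A. a \<noteq> zer A \<longrightarrow> (\<exists>b\<in>bounded_elts A - {zer A}. way_inside A b a)"
      using A unfolding complete_lca_def local_contact_algebra_def by blast+
    note ax = this
    show "\<forall>a\<in>bounded_elts ?T. \<forall>c\<in>carr ?T. way_inside ?T a c \<longrightarrow>
        (\<exists>b\<in>bounded_elts ?T. way_inside ?T a b \<and> way_inside ?T b c)"
    proof clarsimp
      fix a c assume ac: "a \<in> bounded_elts A" "c \<in> carr A" "way_inside ?T (i a) (i c)"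
      then have "way_inside A a c" using bA by simp
      then obtain b where "b \<in> bounded_elts A" "way_inside A a b" "way_inside A b c"
        using ax(1) ac by blast
      with ac bA show "\<exists>b\<in>bounded_elts A. way_inside ?T (i a) (i b) \<and> way_inside ?T (i b) (i c)"
        by (intro bexI[of _ b]) simp_all
    qed
    show "\<forall>a\<in>carr ?T. \<forall>b\<in>carr ?T. contact ?T a b \<longrightarrow>
        (\<exists>c\<in>bounded_elts ?T. contact ?T a (meet ?T c b))"
    proof (clarsimp)
      fix a b assume ab: "a \<in> carr A" "b \<in> carr A" "contact A a b"
      then obtain c where "c \<in> bounded_elts A" "contact A a (meet A c b)" using ax(2) by blast
      with ab bA show "\<exists>c\<in>bounded_elts A. contact ?T (i a) (meet ?T (i c) (i b))"
        by (intro bexI[of _ c]) simp_all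
    qed
    show "\<forall>a\<in>carr ?T. a \<noteq> zer ?T \<longrightarrow> (\<exists>b\<in>bounded_elts ?T - {zer ?T}. way_inside ?T b a)"
    proof clarsimp
      fix a assume "a \<in> carr A" "a \<noteq> zer A"
      then obtain b where "b \<in> bounded_elts A - {zer A}" "way_inside A b a" using ax(3) by blast
      then show "\<exists>b\<in>i ` bounded_elts A - {i (zer A)}. way_inside ?T b (i a)"
        using bA \<open>a \<in> carr A\<close> by (intro bexI[of _ "i b"]) auto
    qed
  qed
  ultimately show "complete_lca ?T"
    unfolding complete_lca_def local_contact_algebra_def by blast
  show "lca_iso A ?T i"
    unfolding lca_iso_def using i by (simp add: bij_betw_def)
qed

section \<open>The algebra of regular closed sets\<close>

lemma regular_closedD:
  assumes "F \<in> regular_closed_sets X"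
  shows "X closure_of (X interior_of F) = F" "closedin X F" "F \<subseteq> topspace X"
  using assms closedin_closure_of[of X "X interior_of F"] closure_of_subset_topspace[of X "X interior_of F"]
  unfolding regular_closed_sets_def by auto

lemma regular_closed_closure_of_open:
  assumes "openin X U"
  shows "X closure_of U \<in> regular_closed_sets X"
proof -
  have "U \<subseteq> X interior_of (X closure_of U)"
    using assms by (intro interior_of_maximal closure_of_subset) (auto dest: openin_subset)
  then have "X closure_of U \<subseteq> X closure_of (X interior_of (X closure_of U))"
    by (rule closure_of_mono)
  moreover have "X closure_of (X interior_of (X closure_of U)) \<subseteq> X closure_of U"
    by (intro closure_of_minimal interior_of_subset) simp
  ultimately show ?thesis unfolding regular_closed_sets_def by blast
qed

lemma regular_closed_interior_of_complement:
  assumes "F \<in> regular_closed_sets X"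
  shows "X interior_of (X closure_of (topspace X - F)) = topspace X - F"
  using regular_closedD(1)[OF assms] by (simp add: closure_of_complement interior_of_complement)

text \<open>
  This is what makes regular closed sets distributive. What remains of the interior of \<open>P \<union> Q\<close>
  outside of both closures is an open set; its part off \<open>P\<close> lies in \<open>Q\<close>, hence in the interior
  of \<open>Q\<close>, and is therefore empty, so that all of it lies in the interior of \<open>P\<close>.
\<close>

lemma interior_of_Un_closed_subset:
  assumes P: "closedin X P" and Q: "closedin X Q"
  shows "X interior_of (P \<union> Q) \<subseteq> X closure_of (X interior_of P) \<union> X closure_of (X interior_of Q)"
proof -
  define W where "W = X interior_of (P \<union> Q)
    - (X closure_of (X interior_of P) \<union> X closure_of (X interior_of Q))"
  have W: "openin X W"
    unfolding W_def by (intro openin_diff closedin_Un) auto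
  have cl: "X interior_of A \<subseteq> X closure_of (X interior_of A)" for A
    by (intro closure_of_subset interior_of_subset_topspace)
  have sub: "W \<subseteq> P \<union> Q"
    using interior_of_subset[of X "P \<union> Q"] unfolding W_def by blast
  then have "W - P \<subseteq> X interior_of Q"
    using W P by (intro interior_of_maximal openin_diff) auto
  then have "W \<subseteq> P" using cl[of Q] unfolding W_def by blast
  then have "W \<subseteq> X interior_of P" using W by (rule interior_of_maximal)
  then have "W = {}" using cl[of P] unfolding W_def by blast
  then show ?thesis unfolding W_def by blast
qed

definition rc_lca :: "'a topology \<Rightarrow> 'a set lca" where
  "rc_lca X =
     \<lparr>carr = regular_closed_sets X, zer = {}, uni = topspace X, join = (\<union>),
      meet = (\<lambda>F G. X closure_of (X interior_of (F \<inter> G))),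
      cmpl = (\<lambda>F. X closure_of (topspace X - F)),
      contact = (\<lambda>F G. F \<inter> G \<noteq> {}),
      bounded_elts = {F \<in> regular_closed_sets X. compactin X F}\<rparr>"

lemma rc_lca_simps [simp]:
  "carr (rc_lca X) = regular_closed_sets X" "zer (rc_lca X) = {}" "uni (rc_lca X) = topspace X"
  "join (rc_lca X) F G = F \<union> G" "meet (rc_lca X) F G = X closure_of (X interior_of (F \<inter> G))"
  "cmpl (rc_lca X) F = X closure_of (topspace X - F)"
  "contact (rc_lca X) F G \<longleftrightarrow> F \<inter> G \<noteq> {}"
  "bounded_elts (rc_lca X) = {F \<in> regular_closed_sets X. compactin X F}"
  by (simp_all add: rc_lca_def)

lemma regular_closed_Un:
  assumes "F \<in> regular_closed_sets X" "G \<in> regular_closed_sets X"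
  shows "F \<union> G \<in> regular_closed_sets X"
proof -
  have "F \<union> G = X closure_of (X interior_of F \<union> X interior_of G)"
    using regular_closedD(1)[OF assms(1)] regular_closedD(1)[OF assms(2)] by simp
  moreover have "openin X (X interior_of F \<union> X interior_of G)" by (simp add: openin_Un)
  ultimately show ?thesis using regular_closed_closure_of_open by metis
qed

lemma boolean_alg_rc: "boolean_alg (rc_lca X)"
  unfolding boolean_alg_def
proof (intro conjI ballI)
  fix a b c
  assume a: "a \<in> carr (rc_lca X)" and b: "b \<in> carr (rc_lca X)" and c: "c \<in> carr (rc_lca X)"
  note aD = regular_closedD[of a X] and bD = regular_closedD[of b X] and cD = regular_closedD[of c X]
  have mono: "A \<subseteq> B \<Longrightarrow> X closure_of (X interior_of A) \<subseteq> X closure_of (X interior_of B)" for A B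
    by (intro closure_of_mono interior_of_mono)
  show "meet (rc_lca X) a (join (rc_lca X) b c)
      = join (rc_lca X) (meet (rc_lca X) a b) (meet (rc_lca X) a c)"
  proof -
    have "X interior_of (a \<inter> b \<union> a \<inter> c)
        \<subseteq> X closure_of (X interior_of (a \<inter> b)) \<union> X closure_of (X interior_of (a \<inter> c))"
      using a b c aD bD cD by (intro interior_of_Un_closed_subset closedin_Int) auto
    then have "X closure_of (X interior_of (a \<inter> (b \<union> c)))
        \<subseteq> X closure_of (X interior_of (a \<inter> b)) \<union> X closure_of (X interior_of (a \<inter> c))"
      by (intro closure_of_minimal) (auto simp: Int_Un_distrib)
    then show ?thesis
      using mono[of "a \<inter> b" "a \<inter> (b \<union> c)"] mono[of "a \<inter> c" "a \<inter> (b \<union> c)"] by auto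
  qed
  show "join (rc_lca X) a (meet (rc_lca X) b c)
      = meet (rc_lca X) (join (rc_lca X) a b) (join (rc_lca X) a c)"
  proof -
    have "X interior_of (a \<union> b \<inter> c) \<subseteq> a \<union> X closure_of (X interior_of (b \<inter> c))"
      using interior_of_Un_closed_subset[of X a "b \<inter> c"] a b c aD bD cD by auto
    then have "X closure_of (X interior_of (a \<union> b \<inter> c)) \<subseteq> a \<union> X closure_of (X interior_of (b \<inter> c))"
      using a aD by (intro closure_of_minimal) auto
    moreover have "a \<subseteq> X closure_of (X interior_of (a \<union> b \<inter> c))"
      using mono[of a "a \<union> b \<inter> c"] a aD by auto
    ultimately show ?thesis
      using mono[of "b \<inter> c" "a \<union> b \<inter> c"] by (auto simp flip: Un_Int_distrib)
  qed
next
  fix a assume a: "a \<in> carr (rc_lca X)"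
  note aD = regular_closedD[of a X]
  show "meet (rc_lca X) a (uni (rc_lca X)) = a"
    using a aD by (simp add: Int_absorb2)
  show "join (rc_lca X) a (cmpl (rc_lca X) a) = uni (rc_lca X)"
    using a aD interior_of_subset[of X a] by (auto simp: closure_of_complement)
  have "X interior_of (X closure_of (topspace X - a)) = topspace X - a"
    using a by (simp add: regular_closed_interior_of_complement)
  then have "X interior_of (a \<inter> X closure_of (topspace X - a)) = {}"
    using interior_of_subset[of X a] by (auto simp: interior_of_Int)
  then show "meet (rc_lca X) a (cmpl (rc_lca X) a) = zer (rc_lca X)" by simp
  show "cmpl (rc_lca X) a \<in> carr (rc_lca X)"
    using a aD by (simp add: regular_closed_closure_of_open openin_diff)
qed (auto simp: regular_closed_closure_of_open regular_closed_Un Int_commute,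
     auto simp: regular_closed_sets_def)

interpretation rc: boolean_carrier "rc_lca X" for X
  by (rule boolean_carrier.intro[OF boolean_alg_rc])

lemma leq_rc_iff:
  assumes "F \<in> regular_closed_sets X" "G \<in> regular_closed_sets X"
  shows "leq (rc_lca X) F G \<longleftrightarrow> F \<subseteq> G"
proof
  assume "leq (rc_lca X) F G"
  then have "F = X closure_of (X interior_of (F \<inter> G))" unfolding leq_def by simp
  also have "\<dots> \<subseteq> X closure_of (X interior_of G)"
    by (intro closure_of_mono interior_of_mono) simp
  finally show "F \<subseteq> G" using regular_closedD(1)[OF assms(2)] by simp
next
  assume "F \<subseteq> G"
  then show "leq (rc_lca X) F G"
    using regular_closedD(1)[OF assms(1)] unfolding leq_def by (simp add: Int_absorb2)
qed

lemma closure_of_UN_closure_of: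
  "X closure_of (\<Union>i\<in>I. X closure_of (A i)) = X closure_of (\<Union>i\<in>I. A i)"
proof
  show "X closure_of (\<Union>i\<in>I. X closure_of (A i)) \<subseteq> X closure_of (\<Union>i\<in>I. A i)"
    by (intro closure_of_minimal UN_least closure_of_mono) auto
  have "X closure_of (\<Union>i\<in>I. A i) = X closure_of (\<Union>i\<in>I. topspace X \<inter> A i)"
    by (metis Int_UN_distrib closure_of_restrict)
  also have "\<dots> \<subseteq> X closure_of (\<Union>i\<in>I. X closure_of (A i))"
    using closure_of_subset_Int[of X] by (intro closure_of_mono UN_mono) auto
  finally show "X closure_of (\<Union>i\<in>I. A i) \<subseteq> X closure_of (\<Union>i\<in>I. X closure_of (A i))" .
qed

lemma closure_of_Union_regular_closed:
  assumes "\<S> \<subseteq> regular_closed_sets X"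
  shows "X closure_of \<Union>\<S> = X closure_of (\<Union>F\<in>\<S>. X interior_of F)"
proof -
  have "(\<Union>F\<in>\<S>. X closure_of (X interior_of F)) = \<Union>\<S>"
    using assms regular_closedD(1) by fastforce
  then show ?thesis
    using closure_of_UN_closure_of[of X "\<lambda>F. X interior_of F" \<S>] by simp
qed

lemma is_join_rc:
  assumes S: "\<S> \<subseteq> regular_closed_sets X"
  shows "is_join (rc_lca X) \<S> (X closure_of \<Union>\<S>)"
proof -
  have top: "\<Union>\<S> \<subseteq> topspace X" using S regular_closedD(3) by blast
  have rc: "X closure_of \<Union>\<S> \<in> regular_closed_sets X"
    unfolding closure_of_Union_regular_closed[OF S]
    by (intro regular_closed_closure_of_open openin_Union) auto
  show ?thesis
    unfolding is_join_def
  proof (intro conjI ballI impI)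
    fix F assume F: "F \<in> \<S>"
    then have "F \<subseteq> X closure_of \<Union>\<S>" using closure_of_subset[OF top] by blast
    then show "leq (rc_lca X) F (X closure_of \<Union>\<S>)" using F S rc by (subst leq_rc_iff) auto
  next
    fix G assume G: "G \<in> carr (rc_lca X)" and ub: "\<forall>F\<in>\<S>. leq (rc_lca X) F G"
    then have "F \<subseteq> G" if "F \<in> \<S>" for F using leq_rc_iff[of F X G] S that by auto
    then have "X closure_of \<Union>\<S> \<subseteq> G"
      using G regular_closedD(2)[of G X] by (intro closure_of_minimal) auto
    then show "leq (rc_lca X) (X closure_of \<Union>\<S>) G" using G rc by (subst leq_rc_iff) auto
  qed (simp add: rc)
qed

lemma is_join_rc_iff:
  assumes S: "\<S> \<subseteq> regular_closed_sets X"
  shows "is_join (rc_lca X) \<S> F \<longleftrightarrow> F = X closure_of \<Union>\<S>"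
  using is_join_rc[OF S] rc.is_join_unique by blast

lemma complete_boolean_alg_rc: "complete_boolean_alg (rc_lca X)"
  using is_join_rc[of _ X] by (intro rc.complete_if_joins) auto

locale LCH_space =
  fixes X :: "'a topology"
  assumes loc_compact: "locally_compact_space X" and Hausdorff: "Hausdorff_space X"
begin

text \<open>
  \<open>H\<close> is the closure of an open set that lies in a compact set and is separated from the
  complement of \<open>W\<close>; as a closure of an open set it is regular closed.
\<close>

lemma compact_neighbourhood:
  assumes K: "compactin X K" and W: "openin X W" and KW: "K \<subseteq> W"
  obtains H where "H \<in> regular_closed_sets X" "compactin X H" "K \<subseteq> X interior_of H" "H \<subseteq> W"
proof -
  have reg: "regular_space X"
    using loc_compact Hausdorff by (rule locally_compact_Hausdorff_imp_regular_space)
  obtain U L where U: "openin X U" and L: "compactin X L" "closedin X L" and "K \<subseteq> U" "U \<subseteq> L"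
    using locally_compact_space_compact_closed_compact[of X] loc_compact Hausdorff K by blast
  obtain P Q where P: "openin X P" and Q: "openin X Q" and "K \<subseteq> P" "topspace X - W \<subseteq> Q" "disjnt P Q"
  proof -
    have "closedin X (topspace X - W)" "disjnt K (topspace X - W)"
      using W KW by (auto simp: disjnt_def)
    then show thesis
      using regular_space_compact_closed_separation[OF reg K] that by blast
  qed
  have PU: "openin X (P \<inter> U)" using P U by (rule openin_Int)
  let ?H = "X closure_of (P \<inter> U)"
  show thesis
  proof (rule that[OF regular_closed_closure_of_open[OF PU]])
    have "?H \<subseteq> L" using L \<open>U \<subseteq> L\<close> by (intro closure_of_minimal) auto
    then show "compactin X ?H" using closed_compactin[OF L(1)] by simp
    have "P \<inter> U \<subseteq> X interior_of ?H"
      using PU by (intro interior_of_maximal closure_of_subset) (auto dest: openin_subset)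
    then show "K \<subseteq> X interior_of ?H" using \<open>K \<subseteq> P\<close> \<open>K \<subseteq> U\<close> by blast
    have "?H \<inter> Q = {}"
      using openin_Int_closure_of_eq_empty[OF Q, of "P \<inter> U"] \<open>disjnt P Q\<close> by (auto simp: disjnt_def)
    then show "?H \<subseteq> W"
      using closure_of_subset_topspace[of X "P \<inter> U"] \<open>topspace X - W \<subseteq> Q\<close> by blast
  qed
qed

lemma point_neighbourhood:
  assumes "openin X W" "x \<in> W"
  obtains H where "H \<in> regular_closed_sets X" "compactin X H" "x \<in> X interior_of H" "H \<subseteq> W"
proof -
  have "compactin X {x}" using assms openin_subset by fastforce
  then show thesis using compact_neighbourhood[of "{x}" W] assms that by auto
qed

lemma separating_neighbourhoods:
  assumes "x \<in> topspace X" "y \<in> topspace X" "x \<noteq> y"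
  obtains H G where "H \<in> regular_closed_sets X" "G \<in> regular_closed_sets X"
    "x \<in> X interior_of H" "y \<in> X interior_of G" "H \<inter> G = {}"
proof -
  obtain U V where U: "openin X U" "x \<in> U" and V: "openin X V" "y \<in> V" and "disjnt U V"
    using Hausdorff assms unfolding Hausdorff_space_def by metis
  obtain H where "H \<in> regular_closed_sets X" "compactin X H" "x \<in> X interior_of H" "H \<subseteq> U"
    by (rule point_neighbourhood[OF U])
  moreover obtain G where "G \<in> regular_closed_sets X" "compactin X G" "y \<in> X interior_of G" "G \<subseteq> V"
    by (rule point_neighbourhood[OF V])
  ultimately show thesis using that \<open>disjnt U V\<close> unfolding disjnt_def by blast
qed

lemma way_inside_rc_iff:
  assumes "F \<in> regular_closed_sets X"
  shows "way_inside (rc_lca X) F G \<longleftrightarrow> F \<subseteq> X interior_of G"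
  using regular_closedD(3)[OF assms] unfolding way_inside_def by (auto simp: closure_of_complement)

text \<open>
  As \<open>F \<lless> G\<close> means \<open>F \<subseteq> int G\<close>, (BC1) and (BC3) are the existence of compact regular closed
  neighbourhoods. For (BC2), take such a neighbourhood \<open>H\<close> of a common point \<open>x\<close> of \<open>F\<close> and \<open>G\<close>:
  since \<open>x \<in> int H\<close> and \<open>G = cl (int G)\<close>, the point \<open>x\<close> belongs to the meet of \<open>H\<close> and \<open>G\<close>.
\<close>

lemma complete_lca_rc: "complete_lca (rc_lca X)"
  unfolding complete_lca_def local_contact_algebra_def
proof (intro conjI ballI impI complete_boolean_alg_rc)
  show "contact_algebra (rc_lca X)"
    unfolding contact_algebra_def by (auto simp: boolean_alg_rc)
  have "F \<in> regular_closed_sets X \<Longrightarrow> leq (rc_lca X) F G \<Longrightarrow> compactin X G \<Longrightarrow>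
      G \<in> regular_closed_sets X \<Longrightarrow> compactin X F" for F G
    using leq_rc_iff closed_compactin regular_closedD(2) by metis
  then show "is_ideal (rc_lca X) (bounded_elts (rc_lca X))"
    unfolding is_ideal_def using rc.closed(1)[of X]
    by (auto simp: regular_closed_Un compactin_Un)
next
  fix F G assume F: "F \<in> bounded_elts (rc_lca X)" and G: "G \<in> carr (rc_lca X)"
    and FG: "way_inside (rc_lca X) F G"
  then have "F \<subseteq> X interior_of G" by (simp add: way_inside_rc_iff)
  then obtain H where "H \<in> regular_closed_sets X" "compactin X H" "F \<subseteq> X interior_of H"
      "H \<subseteq> X interior_of G"
    using compact_neighbourhood[of F "X interior_of G"] F by auto
  then show "\<exists>H\<in>bounded_elts (rc_lca X). way_inside (rc_lca X) F H \<and> way_inside (rc_lca X) H G"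
    using F by (intro bexI[of _ H]) (auto simp: way_inside_rc_iff)
next
  fix F G assume F: "F \<in> carr (rc_lca X)" and G: "G \<in> carr (rc_lca X)"
    and "contact (rc_lca X) F G"
  then obtain x where x: "x \<in> F" "x \<in> G" by auto
  then have "x \<in> topspace X" using regular_closedD(3) F by auto
  then obtain H where H: "H \<in> regular_closed_sets X" "compactin X H" "x \<in> X interior_of H"
      "H \<subseteq> topspace X"
    by (rule point_neighbourhood[OF openin_topspace])
  have "X interior_of H \<inter> X closure_of (X interior_of G)
      \<subseteq> X closure_of (X interior_of H \<inter> X interior_of G)"
    by (intro openin_Int_closure_of_subset) simp
  then have "x \<in> X closure_of (X interior_of (H \<inter> G))"
    using H x G regular_closedD(1)[of G X] by (auto simp: interior_of_Int)
  then show "\<exists>H\<in>bounded_elts (rc_lca X). contact (rc_lca X) F (meet (rc_lca X) H G)"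
    using H x by (intro bexI[of _ H]) auto
next
  fix F assume F: "F \<in> carr (rc_lca X)" and "F \<noteq> zer (rc_lca X)"
  then obtain x where "x \<in> X interior_of F"
    using regular_closedD(1)[of F X] closure_of_empty[of X] by (metis ex_in_conv rc_lca_simps(1,2))
  then obtain H where "H \<in> regular_closed_sets X" "compactin X H" "x \<in> X interior_of H"
      "H \<subseteq> X interior_of F"
    by (rule point_neighbourhood[OF openin_interior_of])
  then show "\<exists>H\<in>bounded_elts (rc_lca X) - {zer (rc_lca X)}. way_inside (rc_lca X) H F"
    by (intro bexI[of _ H]) (auto simp: way_inside_rc_iff)
qed

end

section \<open>Skeletal perfect maps\<close>

text \<open>
  In this form skeletal maps visibly compose. If \<open>V\<close> is open then \<open>V \<union> (Y - cl V)\<close> is open and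
  dense and meets \<open>cl V\<close> only in \<open>V\<close>; so a non-empty open set inside the preimage of \<open>cl V\<close>
  meets the preimage of \<open>V\<close> as soon as preimages of dense open sets are dense.
\<close>

lemma skeletal_map_iff_dense:
  assumes f: "continuous_map X Y f"
  shows "skeletal_map X Y f \<longleftrightarrow>
    (\<forall>V. openin Y V \<and> Y closure_of V = topspace Y \<longrightarrow>
         X closure_of {x \<in> topspace X. f x \<in> V} = topspace X)"
proof
  assume sk: "skeletal_map X Y f"
  show "\<forall>V. openin Y V \<and> Y closure_of V = topspace Y \<longrightarrow>
         X closure_of {x \<in> topspace X. f x \<in> V} = topspace X"
  proof (intro allI impI)
    fix V assume V: "openin Y V \<and> Y closure_of V = topspace Y"
    have "{x \<in> topspace X. f x \<in> topspace Y} = topspace X"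
      using continuous_map_image_subset_topspace[OF f] by auto
    moreover have "X interior_of {x \<in> topspace X. f x \<in> Y closure_of V}
        \<subseteq> X closure_of {x \<in> topspace X. f x \<in> V}"
      using sk V unfolding skeletal_map_def by blast
    ultimately have "topspace X \<subseteq> X closure_of {x \<in> topspace X. f x \<in> V}"
      using V by simp
    then show "X closure_of {x \<in> topspace X. f x \<in> V} = topspace X"
      using closure_of_subset_topspace[of X] by blast
  qed
next
  assume dense: "\<forall>V. openin Y V \<and> Y closure_of V = topspace Y \<longrightarrow>
         X closure_of {x \<in> topspace X. f x \<in> V} = topspace X"
  have "X interior_of {x \<in> topspace X. f x \<in> Y closure_of V} \<subseteq> X closure_of {x \<in> topspace X. f x \<in> V}"
    (is "X interior_of ?C \<subseteq> X closure_of ?P") if V: "openin Y V" for V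
  proof -
    let ?V = "V \<union> (topspace Y - Y closure_of V)"
    let ?W = "X interior_of ?C - X closure_of ?P"
    have "topspace Y - Y closure_of V \<subseteq> Y closure_of (topspace Y - Y closure_of V)"
      by (rule closure_of_subset) blast
    then have "Y closure_of ?V = topspace Y"
      using closure_of_subset_topspace[of Y V]
        closure_of_subset_topspace[of Y "topspace Y - Y closure_of V"] by auto
    moreover have "openin Y ?V" using V by (intro openin_Un openin_diff) auto
    ultimately have "X closure_of {x \<in> topspace X. f x \<in> ?V} = topspace X" using dense by blast
    moreover have W: "openin X ?W" by (intro openin_diff) auto
    moreover have "?W \<inter> {x \<in> topspace X. f x \<in> ?V} = {}"
      using closure_of_subset[of ?P X] interior_of_subset[of X ?C] by blast
    ultimately have "?W \<inter> topspace X = {}"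
      using openin_Int_closure_of_eq_empty[OF W, of "{x \<in> topspace X. f x \<in> ?V}"] by simp
    then show ?thesis using openin_subset[OF W] by blast
  qed
  then show "skeletal_map X Y f"
    using continuous_map_image_subset_topspace[OF f] unfolding skeletal_map_def by blast
qed

definition skeletal_perfect_map :: "'a topology \<Rightarrow> 'b topology \<Rightarrow> ('a \<Rightarrow> 'b) \<Rightarrow> bool" where
  "skeletal_perfect_map X Y f \<longleftrightarrow> skeletal_map X Y f \<and> perfect_into X Y f"

lemma skeletal_perfect_mapD:
  assumes "skeletal_perfect_map X Y f"
  shows "continuous_map X Y f" "proper_map X Y f" "skeletal_map X Y f"
    "x \<in> topspace X \<Longrightarrow> f x \<in> topspace Y"
    "openin Y V \<Longrightarrow> openin X {x \<in> topspace X. f x \<in> V}"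
    "closedin Y V \<Longrightarrow> closedin X {x \<in> topspace X. f x \<in> V}"
  using assms
  unfolding skeletal_perfect_map_def perfect_into_def
  by (auto simp: skeletal_map_def Pi_iff openin_continuous_map_preimage closedin_continuous_map_preimage)

lemma skeletal_perfect_map_cong:
  assumes f: "skeletal_perfect_map X Y f" and eq: "\<And>x. x \<in> topspace X \<Longrightarrow> g x = f x"
  shows "skeletal_perfect_map X Y g"
proof -
  have pre: "{x \<in> topspace X. g x \<in> V} = {x \<in> topspace X. f x \<in> V}" for V
    using eq by auto
  have "{x \<in> topspace X. g x = y} = {x \<in> topspace X. f x = y}" for y
    using eq by auto
  then have "proper_map X Y g"
    using skeletal_perfect_mapD(2)[OF f] closed_map_eq[of X Y f g] eq unfolding proper_map_def by simp
  moreover have "continuous_map X Y g"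
    using continuous_map_eq[OF skeletal_perfect_mapD(1)[OF f]] eq by simp
  moreover have "skeletal_map X Y g"
    using skeletal_perfect_mapD(3)[OF f] eq unfolding skeletal_map_def pre by auto
  ultimately show ?thesis
    unfolding skeletal_perfect_map_def perfect_into_def by blast
qed

lemma skeletal_perfect_map_id: "skeletal_perfect_map X X (\<lambda>x. x)"
proof -
  have c: "continuous_map X X (\<lambda>x. x)" using continuous_map_id[of X] by (simp add: id_def)
  have "{x \<in> topspace X. x \<in> V} = V" if "openin X V" for V
    using openin_subset[OF that] by blast
  then have "skeletal_map X X (\<lambda>x. x)"
    unfolding skeletal_map_iff_dense[OF c] by simp
  then show ?thesis
    using c proper_map_id[of X] unfolding skeletal_perfect_map_def perfect_into_def by (simp add: id_def)
qed

lemma skeletal_perfect_map_comp: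
  assumes f: "skeletal_perfect_map X Y f" and g: "skeletal_perfect_map Y Z g"
  shows "skeletal_perfect_map X Z (\<lambda>x. g (f x))"
proof -
  note F = skeletal_perfect_mapD[OF f] and G = skeletal_perfect_mapD[OF g]
  have c: "continuous_map X Z (\<lambda>x. g (f x))"
    using continuous_map_compose[OF F(1) G(1)] by (simp add: o_def)
  have "X closure_of {x \<in> topspace X. g (f x) \<in> V} = topspace X"
    if V: "openin Z V" "Z closure_of V = topspace Z" for V
  proof -
    let ?V = "{y \<in> topspace Y. g y \<in> V}"
    have "{x \<in> topspace X. g (f x) \<in> V} = {x \<in> topspace X. f x \<in> ?V}"
      using F(4) by auto
    moreover have "openin Y ?V" using G(5) V by blast
    moreover have "Y closure_of ?V = topspace Y"
      using G(3) V unfolding skeletal_map_iff_dense[OF G(1)] by blast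
    then have "X closure_of {x \<in> topspace X. f x \<in> ?V} = topspace X"
      using F(3) \<open>openin Y ?V\<close> unfolding skeletal_map_iff_dense[OF F(1)] by blast
    ultimately show ?thesis by argo
  qed
  then have "skeletal_map X Z (\<lambda>x. g (f x))"
    unfolding skeletal_map_iff_dense[OF c] by blast
  then show ?thesis
    using c proper_map_compose[OF F(2) G(2)]
    unfolding skeletal_perfect_map_def perfect_into_def by (simp add: o_def)
qed

lemma is_category_SkePerLC: "is_category (SkePerLC \<S>)"
proof -
  have "skeletal_perfect_map X X (restrict (\<lambda>x. x) (topspace X))" for X :: "'a topology"
    by (rule skeletal_perfect_map_cong[OF skeletal_perfect_map_id]) simp
  moreover have "skeletal_perfect_map X Z (compose (topspace X) g f)"
    if "skeletal_perfect_map X Y f" "skeletal_perfect_map Y Z g" for X Y Z :: "'a topology" and f g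
    by (rule skeletal_perfect_map_cong[OF skeletal_perfect_map_comp[OF that]]) (simp add: compose_eq)
  moreover have "compose (topspace X) f (restrict (\<lambda>x. x) (topspace X)) = f"
    "compose (topspace X) (restrict (\<lambda>x. x) (topspace Y)) f = f"
    if "f \<in> extensional (topspace X)" "skeletal_perfect_map X Y f" for X Y :: "'a topology" and f
    using that skeletal_perfect_mapD(4)[OF that(2)]
    by (auto simp: compose_def fun_eq_iff extensional_def restrict_def)
  moreover have "compose (topspace X) (compose (topspace Y) h g) f
      = compose (topspace X) h (compose (topspace X) g f)"
    if "skeletal_perfect_map X Y f" for X Y :: "'a topology" and f g h :: "'a \<Rightarrow> 'a"
    using skeletal_perfect_mapD(4)[OF that] by (auto simp: compose_def fun_eq_iff)
  ultimately show ?thesis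
    unfolding is_category_def SkePerLC_def skeletal_perfect_map_def[symmetric] by simp blast
qed

section \<open>From maps to morphisms\<close>

definition rc_map :: "'a topology \<Rightarrow> 'b topology \<Rightarrow> ('a \<Rightarrow> 'b) \<Rightarrow> 'b set \<Rightarrow> 'a set" where
  "rc_map X Y f F = X closure_of {x \<in> topspace X. f x \<in> Y interior_of F}"

lemma rc_map_cong:
  assumes "\<And>x. x \<in> topspace X \<Longrightarrow> f x = g x"
  shows "rc_map X Y f F = rc_map X Y g F"
  unfolding rc_map_def using assms by (intro arg_cong[where f = "(closure_of) X"]) auto

lemma rc_map_superset: "{x \<in> topspace X. f x \<in> Y interior_of F} \<subseteq> rc_map X Y f F"
  unfolding rc_map_def by (intro closure_of_subset) auto

context
  fixes X :: "'a topology" and Y :: "'b topology" and f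
  assumes f: "skeletal_perfect_map X Y f"
begin

text \<open>
  The preimage of the interior of \<open>cl V\<close> is open and lies in the preimage of \<open>cl V\<close>, so
  skeletality puts it into the closure of the preimage of \<open>V\<close>. Functoriality and the
  preservation of joins both rest on this identity.
\<close>

lemma rc_map_closure_of:
  assumes V: "openin Y V"
  shows "rc_map X Y f (Y closure_of V) = X closure_of {x \<in> topspace X. f x \<in> V}"
proof
  note F = skeletal_perfect_mapD[OF f]
  have "{x \<in> topspace X. f x \<in> Y interior_of (Y closure_of V)}
      \<subseteq> X interior_of {x \<in> topspace X. f x \<in> Y closure_of V}"
    using F(5)[of "Y interior_of (Y closure_of V)"] interior_of_subset[of Y "Y closure_of V"]
    by (intro interior_of_maximal) auto
  also have "\<dots> \<subseteq> X closure_of {x \<in> topspace X. f x \<in> V}"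
    using F(3) V unfolding skeletal_map_def by blast
  finally show "rc_map X Y f (Y closure_of V) \<subseteq> X closure_of {x \<in> topspace X. f x \<in> V}"
    unfolding rc_map_def by (intro closure_of_minimal) auto
  have "V \<subseteq> Y interior_of (Y closure_of V)"
    using V by (intro interior_of_maximal closure_of_subset) (auto dest: openin_subset)
  then show "X closure_of {x \<in> topspace X. f x \<in> V} \<subseteq> rc_map X Y f (Y closure_of V)"
    unfolding rc_map_def by (intro closure_of_mono) blast
qed

lemma rc_map_regular_closed: "rc_map X Y f F \<in> regular_closed_sets X"
  unfolding rc_map_def using skeletal_perfect_mapD(5)[OF f] by (intro regular_closed_closure_of_open) simp

lemma rc_map_subset:
  assumes "F \<in> regular_closed_sets Y"
  shows "rc_map X Y f F \<subseteq> {x \<in> topspace X. f x \<in> F}"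
  unfolding rc_map_def
  using interior_of_subset[of Y F] skeletal_perfect_mapD(6)[OF f regular_closedD(2)[OF assms]]
  by (intro closure_of_minimal) auto

text \<open>
  The preimage of \<open>Y - F\<close> is open and disjoint from that of \<open>int F\<close>, hence from \<open>rc_map F\<close>; this
  is one inclusion. The other one is skeletality for the open set \<open>int F\<close>.
\<close>

lemma rc_map_cmpl:
  assumes F: "F \<in> regular_closed_sets Y"
  shows "rc_map X Y f (Y closure_of (topspace Y - F)) = X closure_of (topspace X - rc_map X Y f F)"
proof
  have eq: "rc_map X Y f (Y closure_of (topspace Y - F)) = X closure_of {x \<in> topspace X. f x \<in> topspace Y - F}"
    using regular_closedD(2)[OF F] by (intro rc_map_closure_of) auto
  show "rc_map X Y f (Y closure_of (topspace Y - F)) \<subseteq> X closure_of (topspace X - rc_map X Y f F)"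
    unfolding eq using rc_map_subset[OF F] by (intro closure_of_mono) auto
  have "X interior_of {x \<in> topspace X. f x \<in> Y closure_of (Y interior_of F)} \<subseteq> rc_map X Y f F"
    using skeletal_perfect_mapD(3)[OF f] openin_interior_of[of Y F]
    unfolding skeletal_map_def rc_map_def by blast
  then have "X interior_of {x \<in> topspace X. f x \<in> F} \<subseteq> rc_map X Y f F"
    using regular_closedD(1)[OF F] by simp
  then have "topspace X - rc_map X Y f F \<subseteq> topspace X - X interior_of {x \<in> topspace X. f x \<in> F}"
    by blast
  also have "\<dots> = X closure_of (topspace X - {x \<in> topspace X. f x \<in> F})"
    by (simp add: closure_of_complement)
  also have "topspace X - {x \<in> topspace X. f x \<in> F} = {x \<in> topspace X. f x \<in> topspace Y - F}"
    using skeletal_perfect_mapD(4)[OF f] by auto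
  finally show "X closure_of (topspace X - rc_map X Y f F) \<subseteq> rc_map X Y f (Y closure_of (topspace Y - F))"
    unfolding eq by (intro closure_of_minimal) auto
qed

lemma rc_map_join:
  assumes S: "\<S> \<subseteq> regular_closed_sets Y"
  shows "rc_map X Y f (Y closure_of \<Union>\<S>) = X closure_of \<Union>(rc_map X Y f ` \<S>)"
proof -
  have "rc_map X Y f (Y closure_of \<Union>\<S>)
      = X closure_of {x \<in> topspace X. f x \<in> (\<Union>F\<in>\<S>. Y interior_of F)}"
    unfolding closure_of_Union_regular_closed[OF S] by (intro rc_map_closure_of openin_Union) auto
  also have "{x \<in> topspace X. f x \<in> (\<Union>F\<in>\<S>. Y interior_of F)}
      = (\<Union>F\<in>\<S>. {x \<in> topspace X. f x \<in> Y interior_of F})"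
    by auto
  also have "X closure_of \<dots> = X closure_of \<Union>(rc_map X Y f ` \<S>)"
    unfolding rc_map_def by (rule closure_of_UN_closure_of[symmetric])
  finally show ?thesis .
qed

end

text \<open>
  Elements \<open>F\<close> and \<open>G\<close> with \<open>rc_map F\<close> and \<open>rc_map G\<close> in contact are in contact because
  \<open>rc_map F\<close> lies in the preimage of \<open>F\<close>; the same inclusion gives (L3), as preimages of compact
  sets under a proper map are compact. For (L2), the image of a compact set has a compact regular
  closed neighbourhood.
\<close>

lemma rc_map_hom:
  assumes X: "LCH_space X" and Y: "LCH_space Y" and f: "skeletal_perfect_map X Y f"
  shows "DSkePerLC_hom (rc_lca Y) (rc_lca X) (rc_map X Y f)"
proof -
  interpret X: LCH_space X by (rule X)
  interpret Y: LCH_space Y by (rule Y)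
  note F = skeletal_perfect_mapD[OF f]
  note sub = rc_map_subset[OF f]
  have "complete_boolean_hom (rc_lca Y) (rc_lca X) (rc_map X Y f)"
  proof (rule complete_boolean_homI[OF boolean_alg_rc boolean_alg_rc])
    fix S F assume S: "S \<subseteq> carr (rc_lca Y)" and F: "is_join (rc_lca Y) S F"
    have "rc_map X Y f ` S \<subseteq> regular_closed_sets X" using rc_map_regular_closed[OF f] by blast
    then show "is_join (rc_lca X) (rc_map X Y f ` S) (rc_map X Y f F)"
      using rc_map_join[OF f, of S] S F by (simp add: is_join_rc_iff)
  qed (simp_all add: rc_map_regular_closed[OF f] rc_map_cmpl[OF f])
  moreover have "contact (rc_lca Y) F G" if "F \<in> carr (rc_lca Y)" "G \<in> carr (rc_lca Y)"
    "contact (rc_lca X) (rc_map X Y f F) (rc_map X Y f G)" for F G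
    using that sub[of F] sub[of G] by auto
  moreover have "\<exists>H\<in>bounded_elts (rc_lca Y). leq (rc_lca X) G (rc_map X Y f H)"
    if G: "G \<in> bounded_elts (rc_lca X)" for G
  proof -
    have "G \<subseteq> topspace X" "compactin X G" using G regular_closedD(3) by auto
    then have "compactin Y (f ` G)" "f ` G \<subseteq> topspace Y"
      using image_compactin[OF _ F(1)] F(4) by auto
    then obtain H where "H \<in> regular_closed_sets Y" "compactin Y H" "f ` G \<subseteq> Y interior_of H"
        "H \<subseteq> topspace Y"
      by (rule Y.compact_neighbourhood[OF _ openin_topspace])
    moreover from this have "G \<subseteq> rc_map X Y f H"
      using rc_map_superset[where X = X and Y = Y and f = f and F = H] \<open>G \<subseteq> topspace X\<close> by blast
    ultimately show ?thesis
      using G rc_map_regular_closed[OF f] by (intro bexI[of _ H]) (auto simp: leq_rc_iff)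
  qed
  moreover have "rc_map X Y f H \<in> bounded_elts (rc_lca X)" if H: "H \<in> bounded_elts (rc_lca Y)" for H
  proof -
    have "compactin X {x \<in> topspace X. f x \<in> H}"
      using compactin_proper_map_preimage[OF F(2)] H by simp
    then show ?thesis
      using closed_compactin[OF _ sub] H rc_map_regular_closed[OF f] regular_closedD(2) by fastforce
  qed
  ultimately show ?thesis
    unfolding DSkePerLC_hom_iff[OF Y.complete_lca_rc X.complete_lca_rc] by blast
qed

lemma rc_map_id:
  assumes "F \<in> regular_closed_sets X"
  shows "rc_map X X (\<lambda>x. x) F = F"
proof -
  have "{x \<in> topspace X. x \<in> X interior_of F} = X interior_of F"
    using interior_of_subset_topspace[of X F] by blast
  then show ?thesis using regular_closedD(1)[OF assms] unfolding rc_map_def by simp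
qed

lemma rc_map_comp:
  assumes f: "skeletal_perfect_map X Y f" and g: "skeletal_perfect_map Y Z g"
  shows "rc_map X Z (\<lambda>x. g (f x)) F = rc_map X Y f (rc_map Y Z g F)"
proof -
  have "{x \<in> topspace X. g (f x) \<in> Z interior_of F}
      = {x \<in> topspace X. f x \<in> {y \<in> topspace Y. g y \<in> Z interior_of F}}"
    using skeletal_perfect_mapD(4)[OF f] by auto
  then show ?thesis
    using rc_map_closure_of[OF f skeletal_perfect_mapD(5)[OF g]] by (simp add: rc_map_def)
qed

lemma rc_map_faithful:
  assumes Y: "LCH_space Y" and f: "skeletal_perfect_map X Y f" and g: "skeletal_perfect_map X Y g"
    and eq: "\<And>F. F \<in> regular_closed_sets Y \<Longrightarrow> rc_map X Y f F = rc_map X Y g F"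
    and x: "x \<in> topspace X"
  shows "f x = g x"
proof (rule ccontr)
  interpret Y: LCH_space Y by (rule Y)
  assume "f x \<noteq> g x"
  then obtain H G where "H \<in> regular_closed_sets Y" "f x \<in> Y interior_of H"
    "g x \<in> Y interior_of G" "H \<inter> G = {}"
    using Y.separating_neighbourhoods x skeletal_perfect_mapD(4) f g by metis
  moreover have "x \<in> rc_map X Y f H" using rc_map_superset[where X = X and Y = Y and f = f and F = H] x calculation by blast
  ultimately show False
    using eq rc_map_subset[OF g, of H] interior_of_subset[of Y G] by blast
qed

section \<open>Every morphism comes from a map\<close>

text \<open>
  If \<open>\<phi>\<close> is induced by a map then \<open>y\<close> is the value of the map at \<open>x\<close>. The sets \<open>F\<close> with \<open>x\<close>
  in the interior of \<open>\<phi> F\<close> are non-empty and closed under the meet of the algebra, and one of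
  them is compact by (L2) applied to a compact neighbourhood of \<open>x\<close>; so they have a common point.
\<close>

lemma rc_hom_point:
  assumes X: "LCH_space X" and Y: "LCH_space Y"
    and \<phi>: "DSkePerLC_hom (rc_lca Y) (rc_lca X) \<phi>" and x: "x \<in> topspace X"
  shows "\<exists>y\<in>topspace Y. \<forall>F\<in>regular_closed_sets Y. x \<in> X interior_of (\<phi> F) \<longrightarrow> y \<in> F"
proof -
  interpret X: LCH_space X by (rule X)
  interpret Y: LCH_space Y by (rule Y)
  note h = \<phi>[unfolded DSkePerLC_hom_iff[OF Y.complete_lca_rc X.complete_lca_rc]]
  note D = complete_boolean_homD[OF conjunct1[OF h], simplified]
  define \<N> where "\<N> = {F \<in> regular_closed_sets Y. x \<in> X interior_of (\<phi> F)}"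
  have meet: "Y closure_of (Y interior_of (F \<inter> G)) \<in> \<N>" if "F \<in> \<N>" "G \<in> \<N>" for F G
  proof -
    have "X interior_of (\<phi> F \<inter> \<phi> G) \<subseteq> X closure_of (X interior_of (\<phi> F \<inter> \<phi> G))"
      by (intro closure_of_subset interior_of_subset_topspace)
    then have "X interior_of (\<phi> F \<inter> \<phi> G)
        \<subseteq> X interior_of (\<phi> (Y closure_of (Y interior_of (F \<inter> G))))"
      using that D(5) by (intro interior_of_maximal) (auto simp: \<N>_def)
    then show ?thesis
      using that unfolding \<N>_def
      by (auto simp: interior_of_Int regular_closed_closure_of_open openin_Int)
  qed
  have ne: "F \<noteq> {}" if "F \<in> \<N>" for F
    using that D(2) unfolding \<N>_def by auto
  obtain G where G: "G \<in> regular_closed_sets X" "compactin X G" "x \<in> X interior_of G"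
      "G \<subseteq> topspace X"
    by (rule X.point_neighbourhood[OF openin_topspace x])
  then obtain K where K: "K \<in> regular_closed_sets Y" "compactin Y K" "leq (rc_lca X) G (\<phi> K)"
    using h by (simp add: Bex_def) blast
  then have "G \<subseteq> \<phi> K" using leq_rc_iff[OF G(1)] D(1) by blast
  then have KN: "K \<in> \<N>"
    using G(3) K(1) interior_of_mono[of G "\<phi> K" X] unfolding \<N>_def by blast
  have fin: "\<exists>F\<in>\<N>. F \<subseteq> K \<inter> \<Inter>\<G>" if "finite \<G>" "\<G> \<subseteq> \<N>" for \<G>
    using that
  proof (induction \<G>)
    case empty
    then show ?case using KN by auto
  next
    case (insert H \<G>)
    then obtain F where F: "F \<in> \<N>" "F \<subseteq> K \<inter> \<Inter>\<G>" by auto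
    have "Y closure_of (Y interior_of (F \<inter> H)) \<subseteq> F \<inter> H"
      using F(1) insert.prems regular_closedD(2) unfolding \<N>_def
      by (intro closure_of_minimal interior_of_subset closedin_Int) auto
    moreover have "Y closure_of (Y interior_of (F \<inter> H)) \<in> \<N>"
      using meet[OF F(1)] insert.prems by simp
    ultimately show ?case using F(2) by (intro bexI) auto
  qed
  have "K \<inter> \<Inter>\<F> \<noteq> {}" if "finite \<F>" "\<F> \<subseteq> \<N>" for \<F>
    using fin[OF that] ne by blast
  moreover have "\<forall>F\<in>\<N>. closedin Y F" using regular_closedD(2) unfolding \<N>_def by blast
  ultimately have "K \<inter> \<Inter>\<N> \<noteq> {}"
    using K(2) unfolding compactin_fip by meson
  then show ?thesis
    using regular_closedD(3)[OF K(1)] unfolding \<N>_def by blast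
qed

text \<open>
  Let \<open>p x\<close> be the point just found. A regular closed set disjoint from \<open>H\<close> has an image disjoint
  from \<open>\<phi> H\<close> by (L1), and this yields
  \<open>p\<^sup>-(int H) \<subseteq> int (\<phi> H)\<close> and \<open>\<phi> H \<subseteq> p\<^sup>-(H)\<close>, where \<open>p\<^sup>-\<close> denotes preimages.
  Hence \<open>p\<close> is continuous, and proper because of (L3). Since \<open>\<phi>\<close> preserves joins,
  \<open>\<phi> (cl V) \<subseteq> cl p\<^sup>-(V)\<close> for open \<open>V\<close>. The latter, for \<open>V\<close> and for \<open>Y - cl V\<close>, shows that \<open>p\<close>
  is skeletal, and for \<open>V = int F\<close> it shows that \<open>p\<close> induces \<open>\<phi>\<close>.
\<close>

lemma rc_map_full:
  assumes X: "LCH_space X" and Y: "LCH_space Y"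
    and \<phi>: "DSkePerLC_hom (rc_lca Y) (rc_lca X) \<phi>"
  obtains f where "skeletal_perfect_map X Y f"
    "\<And>F. F \<in> regular_closed_sets Y \<Longrightarrow> \<phi> F = rc_map X Y f F"
proof -
  interpret X: LCH_space X by (rule X)
  interpret Y: LCH_space Y by (rule Y)
  note h = \<phi>[unfolded DSkePerLC_hom_iff[OF Y.complete_lca_rc X.complete_lca_rc]]
  note D = complete_boolean_homD[OF conjunct1[OF h], simplified]
  have L1: "\<phi> F \<inter> \<phi> G = {}" if "F \<in> regular_closed_sets Y" "G \<in> regular_closed_sets Y" "F \<inter> G = {}" for F G
    using h that by simp blast
  obtain p where p: "\<And>x. x \<in> topspace X \<Longrightarrow> p x \<in> topspace Y"
    and pF: "\<And>x F. x \<in> topspace X \<Longrightarrow> F \<in> regular_closed_sets Y \<Longrightarrow> x \<in> X interior_of (\<phi> F) \<Longrightarrow> p x \<in> F"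
    using rc_hom_point[OF X Y \<phi>] by metis
  have in_image: "x \<in> \<phi> H"
    if x: "x \<in> topspace X" and H: "H \<in> regular_closed_sets Y" and px: "p x \<in> Y interior_of H" for x H
  proof (rule ccontr)
    assume "x \<notin> \<phi> H"
    then have "x \<in> X interior_of (\<phi> (Y closure_of (topspace Y - H)))"
      using x D(4)[OF H] regular_closed_interior_of_complement[OF D(1)[OF H]] by simp
    moreover have "Y closure_of (topspace Y - H) \<in> regular_closed_sets Y"
      using regular_closedD(2)[OF H] by (intro regular_closed_closure_of_open) auto
    ultimately have "p x \<in> topspace Y - Y interior_of H"
      using pF[OF x] by (metis closure_of_complement)
    then show False using px by blast
  qed
  have image_sub: "p x \<in> H" if x: "x \<in> \<phi> H" and H: "H \<in> regular_closed_sets Y" for x H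
  proof (rule ccontr)
    assume "p x \<notin> H"
    have xX: "x \<in> topspace X" using x regular_closedD(3)[OF D(1)[OF H]] by blast
    have "openin Y (topspace Y - H)" "p x \<in> topspace Y - H"
      using regular_closedD(2)[OF H] p[OF xX] \<open>p x \<notin> H\<close> by auto
    then obtain G where G: "G \<in> regular_closed_sets Y" "p x \<in> Y interior_of G" "G \<subseteq> topspace Y - H"
      using Y.point_neighbourhood by metis
    then have "\<phi> G \<inter> \<phi> H = {}" using L1[OF G(1) H] by blast
    then show False using in_image[OF xX G(1,2)] x by blast
  qed
  have in_interior: "x \<in> X interior_of (\<phi> H)"
    if x: "x \<in> topspace X" and H: "H \<in> regular_closed_sets Y" and px: "p x \<in> Y interior_of H" for x H
  proof (rule ccontr)
    assume "x \<notin> X interior_of (\<phi> H)"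
    then have "x \<in> \<phi> (Y closure_of (topspace Y - H))"
      using x D(4)[OF H] by (simp add: closure_of_complement)
    moreover have "Y closure_of (topspace Y - H) \<in> regular_closed_sets Y"
      using regular_closedD(2)[OF H] by (intro regular_closed_closure_of_open) auto
    ultimately have "p x \<in> topspace Y - Y interior_of H"
      using image_sub by (metis closure_of_complement)
    then show False using px by blast
  qed
  have image_sub': "\<phi> H \<subseteq> {x \<in> topspace X. p x \<in> H}" if "H \<in> regular_closed_sets Y" for H
    using image_sub[OF _ that] regular_closedD(3)[OF D(1)[OF that]] by blast

  have cont: "continuous_map X Y p"
    unfolding continuous_map_def
  proof (intro conjI allI impI)
    show "p \<in> topspace X \<rightarrow> topspace Y" using p by blast
    fix V assume V: "openin Y V"
    show "openin X {x \<in> topspace X. p x \<in> V}"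
    proof (subst openin_subopen, clarify)
      fix x assume x: "x \<in> topspace X" "p x \<in> V"
      then obtain H where H: "H \<in> regular_closed_sets Y" "p x \<in> Y interior_of H" "H \<subseteq> V"
        using Y.point_neighbourhood[OF V] by blast
      then show "\<exists>T. openin X T \<and> x \<in> T \<and> T \<subseteq> {x \<in> topspace X. p x \<in> V}"
        using in_interior[OF x(1) H(1,2)] interior_of_subset[of X "\<phi> H"] image_sub'[OF H(1)]
        by (intro exI[of _ "X interior_of (\<phi> H)"]) auto
    qed
  qed
  have "compactin X {x \<in> topspace X. p x \<in> K}" if K: "compactin Y K" for K
  proof -
    obtain H where H: "H \<in> regular_closed_sets Y" "compactin Y H" "K \<subseteq> Y interior_of H"
        "H \<subseteq> topspace Y"
      by (rule Y.compact_neighbourhood[OF K openin_topspace compactin_subset_topspace[OF K]])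
    have "compactin X (\<phi> H)" using h H by simp
    moreover have "{x \<in> topspace X. p x \<in> K} \<subseteq> \<phi> H" using in_image[OF _ H(1)] H(3) by blast
    moreover have "closedin X {x \<in> topspace X. p x \<in> K}"
      using closedin_continuous_map_preimage[OF cont] compactin_imp_closedin[OF Y.Hausdorff K] by blast
    ultimately show ?thesis by (rule closed_compactin)
  qed
  then have proper: "proper_map X Y p"
    using cont Y.loc_compact Y.Hausdorff p
    by (intro compact_imp_proper_map locally_compact_imp_k_space Hausdorff_imp_kc_space)
       auto

  \<comment> \<open>\<open>cl V\<close> is the join of the regular closed sets inside \<open>V\<close>.\<close>
  have closure_le: "\<phi> (Y closure_of V) \<subseteq> X closure_of {x \<in> topspace X. p x \<in> V}" if V: "openin Y V" for V
  proof -
    let ?S = "{H \<in> regular_closed_sets Y. H \<subseteq> V}"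
    have "V \<subseteq> \<Union>?S"
    proof
      fix y assume "y \<in> V"
      then obtain H where H: "H \<in> regular_closed_sets Y" "compactin Y H" "y \<in> Y interior_of H" "H \<subseteq> V"
        by (rule Y.point_neighbourhood[OF V])
      then have "y \<in> H" using interior_of_subset[of Y H] by blast
      with H show "y \<in> \<Union>?S" by blast
    qed
    then have "\<Union>?S = V" by blast
    then have "is_join (rc_lca Y) ?S (Y closure_of V)"
      by (simp add: is_join_rc_iff)
    then have "is_join (rc_lca X) (\<phi> ` ?S) (\<phi> (Y closure_of V))" by (intro D(7)) auto
    moreover have "\<phi> ` ?S \<subseteq> regular_closed_sets X" using D(1) by blast
    ultimately have "\<phi> (Y closure_of V) = X closure_of \<Union>(\<phi> ` ?S)"
      by (simp add: is_join_rc_iff)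
    also have "\<dots> \<subseteq> X closure_of {x \<in> topspace X. p x \<in> V}"
      using image_sub' by (intro closure_of_mono) blast
    finally show ?thesis .
  qed
  have skel: "skeletal_map X Y p"
    unfolding skeletal_map_def
  proof (intro conjI allI impI)
    show "p \<in> topspace X \<rightarrow> topspace Y" using p by blast
    fix V assume V: "openin Y V"
    let ?C = "{x \<in> topspace X. p x \<in> Y closure_of V}" and ?V' = "topspace Y - Y closure_of V"
    let ?W = "X interior_of ?C - \<phi> (Y closure_of V)"
    have rc: "Y closure_of V \<in> regular_closed_sets Y" using V by (rule regular_closed_closure_of_open)
    have W: "openin X ?W"
      using regular_closedD(2)[OF D(1)[OF rc]] by (intro openin_diff) auto
    have "?W \<subseteq> topspace X - \<phi> (Y closure_of V)" using openin_subset[OF W] by blast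
    also have "\<dots> \<subseteq> \<phi> (Y closure_of ?V')"
      using closure_of_subset[of "topspace X - \<phi> (Y closure_of V)" X] D(4)[OF rc] by auto
    also have "\<dots> \<subseteq> X closure_of {x \<in> topspace X. p x \<in> ?V'}"
      by (intro closure_le openin_diff) auto
    finally have "?W \<subseteq> X closure_of {x \<in> topspace X. p x \<in> ?V'}" .
    moreover have "?W \<inter> {x \<in> topspace X. p x \<in> ?V'} = {}"
      using interior_of_subset[of X ?C] by blast
    ultimately have "?W = {}"
      using openin_Int_closure_of_eq_empty[OF W, of "{x \<in> topspace X. p x \<in> ?V'}"] by blast
    then show "X interior_of ?C \<subseteq> X closure_of {x \<in> topspace X. p x \<in> V}"
      using closure_le[OF V] by blast
  qed
  have "\<phi> F = rc_map X Y p F" if F: "F \<in> regular_closed_sets Y" for F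
  proof
    show "\<phi> F \<subseteq> rc_map X Y p F"
      using closure_le[of "Y interior_of F"] regular_closedD(1)[OF F] unfolding rc_map_def by simp
    show "rc_map X Y p F \<subseteq> \<phi> F"
      unfolding rc_map_def using in_image[OF _ F] regular_closedD(2)[OF D(1)[OF F]]
      by (intro closure_of_minimal) auto
  qed
  with cont proper skel show thesis
    using that unfolding skeletal_perfect_map_def perfect_into_def by blast
qed

section \<open>The space of a complete local contact algebra\<close>

locale complete_LCA =
  fixes A :: "'a lca"
  assumes complete: "complete_lca A"

sublocale complete_LCA \<subseteq> boolean_carrier A
  by (rule complete_lcaD(3)[OF complete])

context complete_LCA
begin

abbreviation bdd :: "'a set" where "bdd \<equiv> bounded_elts A"

abbreviation way (infix "\<lless>" 50) where "a \<lless> b \<equiv> way_inside A a b"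

lemma contact_refl: "a \<in> carr A \<Longrightarrow> a \<noteq> zer A \<Longrightarrow> contact A a a"
  and contact_zer: "a \<in> carr A \<Longrightarrow> b \<in> carr A \<Longrightarrow> contact A a b \<Longrightarrow> a \<noteq> zer A \<and> b \<noteq> zer A"
  and contact_sym: "a \<in> carr A \<Longrightarrow> b \<in> carr A \<Longrightarrow> contact A a b \<Longrightarrow> contact A b a"
  and contact_join: "a \<in> carr A \<Longrightarrow> b \<in> carr A \<Longrightarrow> c \<in> carr A \<Longrightarrow>
    contact A a (join A b c) \<longleftrightarrow> contact A a b \<or> contact A a c"
  using complete_lcaD(4)[OF complete] unfolding contact_algebra_def by blast+

lemma interpolate:
  "a \<in> bdd \<Longrightarrow> c \<in> carr A \<Longrightarrow> a \<lless> c \<Longrightarrow> \<exists>b\<in>bdd. a \<lless> b \<and> b \<lless> c"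
  and contact_bounded:
  "a \<in> carr A \<Longrightarrow> b \<in> carr A \<Longrightarrow> contact A a b \<Longrightarrow> \<exists>c\<in>bdd. contact A a (meet A c b)"
  and bounded_way_inside:
  "a \<in> carr A \<Longrightarrow> a \<noteq> zer A \<Longrightarrow> \<exists>b\<in>bdd. b \<noteq> zer A \<and> b \<lless> a"
  using complete unfolding complete_lca_def local_contact_algebra_def by blast+

lemmas bounded_ideal = complete_lcaD(5)[OF complete]

lemma bounded_carr: "a \<in> bdd \<Longrightarrow> a \<in> carr A"
  using is_idealD(1)[OF bounded_ideal] by blast

lemma bounded_meet: "a \<in> bdd \<Longrightarrow> b \<in> carr A \<Longrightarrow> meet A a b \<in> bdd"
  using is_idealD(3)[OF bounded_ideal, of a "meet A a b"] bounded_carr by simp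

lemma contact_mono2:
  "contact A a b \<Longrightarrow> leq A b c \<Longrightarrow> a \<in> carr A \<Longrightarrow> b \<in> carr A \<Longrightarrow> c \<in> carr A \<Longrightarrow> contact A a c"
  using contact_join[of a b c] leq_join_iff[of b c] by simp

lemma contact_mono:
  assumes "contact A a b" "leq A a c" "leq A b d"
    and "a \<in> carr A" "b \<in> carr A" "c \<in> carr A" "d \<in> carr A"
  shows "contact A c d"
  using assms contact_mono2 contact_sym by metis

lemma way_inside_leq:
  assumes a: "a \<in> carr A" and b: "b \<in> carr A" and ab: "a \<lless> b"
  shows "leq A a b"
proof (rule ccontr)
  assume "\<not> leq A a b"
  then have "meet A a (cmpl A b) \<noteq> zer A" using a b by (simp add: meet_cmpl_zer_iff)
  then have "contact A (meet A a (cmpl A b)) (meet A a (cmpl A b))"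
    using a b by (intro contact_refl) auto
  then have "contact A a (cmpl A b)"
    by (rule contact_mono) (use a b in auto)
  then show False using ab unfolding way_inside_def by simp
qed

lemma way_inside_mono:
  assumes "a \<lless> b" "leq A a' a" "leq A b b'"
    and "a \<in> carr A" "b \<in> carr A" "a' \<in> carr A" "b' \<in> carr A"
  shows "a' \<lless> b'"
  using assms contact_mono[of a' "cmpl A b'" a "cmpl A b"] unfolding way_inside_def
  by (auto simp: cmpl_leq_cmpl)

lemma way_inside_cmpl:
  "a \<lless> b \<Longrightarrow> a \<in> carr A \<Longrightarrow> b \<in> carr A \<Longrightarrow> cmpl A b \<lless> cmpl A a"
  unfolding way_inside_def using contact_sym[of "cmpl A b" a] by auto

lemma way_inside_meet:
  assumes "a \<lless> b" "a' \<lless> b'" and c: "a \<in> carr A" "b \<in> carr A" "a' \<in> carr A" "b' \<in> carr A"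
  shows "meet A a a' \<lless> meet A b b'"
proof -
  have "meet A a a' \<lless> b" "meet A a a' \<lless> b'"
    using way_inside_mono[OF assms(1), of "meet A a a'" b]
      way_inside_mono[OF assms(2), of "meet A a a'" b'] c by auto
  then show ?thesis
    using c unfolding way_inside_def by (simp add: cmpl_meet contact_join)
qed

subsection \<open>Points\<close>

text \<open>
  In the algebra of regular closed sets, the point belonging to \<open>x\<close> consists of all \<open>F\<close> with
  \<open>x \<in> int F\<close>: a proper filter with a base of compact sets in the sense of \<open>\<lless>\<close>. The last clause
  takes the place of primeness; it holds there because \<open>a \<lless> b\<close> makes \<open>int b\<close> and the complement
  of \<open>a\<close> cover the space.
\<close>

definition point :: "'a set \<Rightarrow> bool" where
  "point p \<longleftrightarrow>
     p \<subseteq> carr A \<and> uni A \<in> p \<and> zer A \<notin> p \<and>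
     (\<forall>a\<in>p. \<forall>b\<in>carr A. leq A a b \<longrightarrow> b \<in> p) \<and>
     (\<forall>a\<in>p. \<forall>b\<in>p. meet A a b \<in> p) \<and>
     (\<forall>a\<in>p. \<exists>b\<in>p. b \<in> bdd \<and> b \<lless> a) \<and>
     (\<forall>a\<in>bdd. \<forall>b\<in>carr A. a \<lless> b \<longrightarrow> cmpl A a \<in> p \<or> b \<in> p)"

lemma pointD:
  assumes "point p"
  shows "a \<in> p \<Longrightarrow> a \<in> carr A" "uni A \<in> p" "zer A \<notin> p"
    "a \<in> p \<Longrightarrow> b \<in> carr A \<Longrightarrow> leq A a b \<Longrightarrow> b \<in> p"
    "a \<in> p \<Longrightarrow> b \<in> p \<Longrightarrow> meet A a b \<in> p"
    "a \<in> p \<Longrightarrow> \<exists>b\<in>p. b \<in> bdd \<and> b \<lless> a"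
    "a \<in> bdd \<Longrightarrow> b \<in> carr A \<Longrightarrow> a \<lless> b \<Longrightarrow> cmpl A a \<in> p \<or> b \<in> p"
  using assms unfolding point_def by blast+

lemma point_meet_iff:
  "point p \<Longrightarrow> a \<in> carr A \<Longrightarrow> b \<in> carr A \<Longrightarrow> meet A a b \<in> p \<longleftrightarrow> a \<in> p \<and> b \<in> p"
  using pointD(4,5) meet_leq1 meet_leq2 closed(5) by metis

lemma point_not_both: "point p \<Longrightarrow> a \<in> p \<Longrightarrow> cmpl A a \<notin> p"
  using pointD(1,3,5) units(4) by metis

definition round_part :: "'a set \<Rightarrow> 'a set" where
  "round_part u = {a \<in> carr A. \<exists>b\<in>u. b \<in> bdd \<and> b \<lless> a}"

lemma round_part_subset: "ultrafilter u \<Longrightarrow> round_part u \<subseteq> u"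
  unfolding round_part_def using ultrafilterD(1,4) way_inside_leq by blast

text \<open>
  Every ultrafilter with a bounded element contains a point. For its last property, interpolate
  \<open>a \<lless> d \<lless> b\<close>: either \<open>d\<close> or its complement belongs to \<open>u\<close>, and these are well inside \<open>b\<close> and
  the complement of \<open>a\<close>. The meet with \<open>e\<close> makes the latter bounded.
\<close>

lemma point_round_part:
  assumes u: "ultrafilter u" and e: "e \<in> u" "e \<in> bdd"
  shows "point (round_part u)"
  unfolding point_def
proof (intro conjI ballI impI)
  note U = ultrafilterD[OF u]
  show "round_part u \<subseteq> carr A" unfolding round_part_def by blast
  have "e \<lless> uni A"
    using contact_zer[of e "zer A"] bounded_carr[OF e(2)] unfolding way_inside_def by auto
  then show "uni A \<in> round_part u" using e unfolding round_part_def by auto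
  show "zer A \<notin> round_part u" using round_part_subset[OF u] U(3) by blast
  fix a assume a: "a \<in> round_part u"
  then have aA: "a \<in> carr A" unfolding round_part_def by blast
  obtain c where c: "c \<in> u" "c \<in> bdd" "c \<lless> a" using a unfolding round_part_def by blast
  show "b \<in> round_part u" if b: "b \<in> carr A" "leq A a b" for b
    using way_inside_mono[OF c(3) leq_refl b(2)] bounded_carr[OF c(2)] aA b c
    unfolding round_part_def by blast
  show "meet A a b \<in> round_part u" if b: "b \<in> round_part u" for b
  proof -
    obtain d where d: "d \<in> u" "d \<in> bdd" "d \<lless> b" and bA: "b \<in> carr A"
      using b unfolding round_part_def by blast
    have "meet A c d \<lless> meet A a b"
      using way_inside_meet[OF c(3) d(3)] bounded_carr c(2) d(2) aA bA by blast
    moreover have "meet A c d \<in> u" "meet A c d \<in> bdd"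
      using U(5) c d bounded_meet bounded_carr by blast+
    ultimately show ?thesis using aA bA unfolding round_part_def by auto
  qed
  show "\<exists>b\<in>round_part u. b \<in> bdd \<and> b \<lless> a"
    using interpolate[OF c(2) aA c(3)] c bounded_carr unfolding round_part_def by blast
next
  note U = ultrafilterD[OF u]
  fix a b assume a: "a \<in> bdd" and b: "b \<in> carr A" and ab: "a \<lless> b"
  obtain d where d: "d \<in> bdd" "a \<lless> d" "d \<lless> b" using interpolate[OF a b ab] by blast
  have aA: "a \<in> carr A" and dA: "d \<in> carr A" using a d bounded_carr by blast+
  show "cmpl A a \<in> round_part u \<or> b \<in> round_part u"
  proof (cases "d \<in> u")
    case True
    then show ?thesis using d b unfolding round_part_def by blast
  next
    case False
    then have "meet A e (cmpl A d) \<in> u" using U(5,6) dA e by blast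
    moreover have "meet A e (cmpl A d) \<in> bdd" using bounded_meet e(2) dA by simp
    moreover have "meet A e (cmpl A d) \<lless> cmpl A a"
      using way_inside_mono[OF way_inside_cmpl[OF d(2) aA dA], of "meet A e (cmpl A d)" "cmpl A a"]
        aA dA bounded_carr[OF e(2)] by simp
    ultimately show ?thesis using aA unfolding round_part_def by auto
  qed
qed

lemma point_exists:
  assumes a: "a \<in> carr A" and "a \<noteq> zer A"
  obtains p where "point p" "a \<in> p"
proof -
  obtain b where b: "b \<in> bdd" "b \<noteq> zer A" "b \<lless> a"
    using bounded_way_inside assms by blast
  then obtain u where "ultrafilter u" "b \<in> u"
    using ultrafilter_exists[OF is_ideal_zer bounded_carr] by blast
  then show thesis
    using that[OF point_round_part] b a unfolding round_part_def by blast
qed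

text \<open>
  Given \<open>a \<in> p\<close> with \<open>a \<notin> q\<close>, choose a bounded \<open>b \<in> p\<close> well inside \<open>a\<close>; the last property of the
  point \<open>q\<close> then puts the complement of \<open>b\<close> into \<open>q\<close>.
\<close>

lemma points_separated:
  assumes p: "point p" and q: "point q" and "p \<noteq> q"
  obtains a where "a \<in> p" "cmpl A a \<in> q"
proof -
  have sep: "\<exists>b\<in>p. cmpl A b \<in> q" if p: "point p" and q: "point q" and a: "a \<in> p" "a \<notin> q" for p q a
  proof -
    obtain b where b: "b \<in> p" "b \<in> bdd" "b \<lless> a" using pointD(6)[OF p a(1)] by blast
    then show ?thesis using pointD(7)[OF q b(2) pointD(1)[OF p a(1)] b(3)] a(2) by blast
  qed
  show thesis
  proof (cases "p \<subseteq> q")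
    case True
    then obtain a where "a \<in> q" "a \<notin> p" using \<open>p \<noteq> q\<close> by blast
    then obtain b where "b \<in> q" "cmpl A b \<in> p" using sep[OF q p] by blast
    then show thesis using that[of "cmpl A b"] pointD(1)[OF q] by simp
  next
    case False
    then show thesis using sep[OF p q] that by blast
  qed
qed

text \<open>
  Two elements in contact belong to ultrafilters all of whose elements are in contact: first
  avoid the ideal of all \<open>c\<close> not in contact with \<open>b\<close>, then the ideal of all elements not in contact
  with some element of the first ultrafilter.
\<close>

lemma contact_ultrafilters:
  assumes a: "a \<in> carr A" and b: "b \<in> carr A" and ab: "contact A a b"
  obtains u v where "ultrafilter u" "ultrafilter v" "a \<in> u" "b \<in> v"
    "\<And>c d. c \<in> u \<Longrightarrow> d \<in> v \<Longrightarrow> contact A c d"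
proof -
  define I where "I = {c \<in> carr A. \<not> contact A b c}"
  have "is_ideal A I"
    unfolding is_ideal_def I_def
  proof (intro conjI ballI impI)
    show "zer A \<in> {c \<in> carr A. \<not> contact A b c}" using contact_zer[OF b closed(1)] by auto
  qed (use b contact_mono2 contact_join in auto)
  moreover have "a \<notin> I" using contact_sym[OF a b ab] unfolding I_def by blast
  ultimately obtain u where u: "ultrafilter u" and au: "a \<in> u" and uI: "u \<inter> I = {}"
    using ultrafilter_exists a by blast
  note U = ultrafilterD[OF u]
  have bu: "contact A c b" if "c \<in> u" for c
    using uI U(1) that contact_sym b unfolding I_def by blast
  define J where "J = {d \<in> carr A. \<exists>c\<in>u. \<not> contact A c d}"
  have "is_ideal A J"
    unfolding is_ideal_def J_def
  proof (intro conjI ballI impI)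
    show "zer A \<in> {d \<in> carr A. \<exists>c\<in>u. \<not> contact A c d}"
      using contact_zer[OF closed(2) closed(1)] U(2) by auto
    fix d assume d: "d \<in> {d \<in> carr A. \<exists>c\<in>u. \<not> contact A c d}"
    then obtain c where c: "c \<in> u" "\<not> contact A c d" and dA: "d \<in> carr A" by blast
    show "d' \<in> {d \<in> carr A. \<exists>c\<in>u. \<not> contact A c d}" if "d' \<in> carr A" "leq A d' d" for d'
      using c contact_mono2 that dA U(1) by blast
    fix d' assume "d' \<in> {d \<in> carr A. \<exists>c\<in>u. \<not> contact A c d}"
    then obtain c' where c': "c' \<in> u" "\<not> contact A c' d'" and dA': "d' \<in> carr A" by blast
    have cA: "c \<in> carr A" "c' \<in> carr A" using c c' U(1) by blast+
    have "\<not> contact A (meet A c c') d" "\<not> contact A (meet A c c') d'"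
      using contact_mono[of "meet A c c'" d c d] contact_mono[of "meet A c c'" d' c' d']
        c c' cA dA dA' by auto
    then have "\<not> contact A (meet A c c') (join A d d')"
      using contact_join cA dA dA' by simp
    then show "join A d d' \<in> {d \<in> carr A. \<exists>c\<in>u. \<not> contact A c d}"
      using U(5)[OF c(1) c'(1)] dA dA' by auto
  qed auto
  moreover have "b \<notin> J" using bu unfolding J_def by blast
  ultimately obtain v where v: "ultrafilter v" and bv: "b \<in> v" and vJ: "v \<inter> J = {}"
    using ultrafilter_exists b by blast
  have "contact A c d" if "c \<in> u" "d \<in> v" for c d
    using vJ ultrafilterD(1)[OF v] that unfolding J_def by blast
  with u v au bv show thesis using that by blast
qed

text \<open>Thus ultrafilters whose elements are all in contact contain the same point.\<close>

lemma round_part_subset_if_contact: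
  assumes u: "ultrafilter u" and v: "ultrafilter v"
    and uv: "\<And>c d. c \<in> u \<Longrightarrow> d \<in> v \<Longrightarrow> contact A c d"
  shows "round_part u \<subseteq> round_part v"
proof
  fix a assume "a \<in> round_part u"
  then obtain c where c: "c \<in> u" "c \<in> bdd" "c \<lless> a" and a: "a \<in> carr A"
    unfolding round_part_def by blast
  obtain d where d: "d \<in> bdd" "c \<lless> d" "d \<lless> a" using interpolate[OF c(2) a c(3)] by blast
  have "cmpl A d \<notin> v" using uv[OF c(1)] d(2) unfolding way_inside_def by blast
  then have "d \<in> v" using ultrafilterD(6)[OF v bounded_carr[OF d(1)]] by blast
  then show "a \<in> round_part v" using d a unfolding round_part_def by blast
qed

text \<open>
  By (BC2), elements in contact can be shrunk to bounded elements in contact. These lie in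
  ultrafilters whose elements are all in contact, and the common point of these contains neither
  complement. Conversely, \<open>a \<lless> b*\<close> is inherited by the bounded element \<open>c \<and> a\<close> with \<open>c \<in> p\<close>, and
  the last property of points puts the complement of \<open>a\<close> or that of \<open>b\<close> into \<open>p\<close>.
\<close>

lemma contact_iff_point:
  assumes a: "a \<in> carr A" and b: "b \<in> carr A"
  shows "contact A a b \<longleftrightarrow> (\<exists>p. point p \<and> cmpl A a \<notin> p \<and> cmpl A b \<notin> p)"
proof
  assume ab: "contact A a b"
  obtain c where c: "c \<in> bdd" "contact A a (meet A c b)"
    using contact_bounded[OF a b ab] by blast
  have cA: "c \<in> carr A" using c bounded_carr by blast
  have "contact A (meet A c b) a" using contact_sym c(2) a b cA by simp
  then obtain d where d: "d \<in> bdd" "contact A (meet A c b) (meet A d a)"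
    using contact_bounded a b cA by (metis closed(5))
  have dA: "d \<in> carr A" using d bounded_carr by blast
  obtain u v where u: "ultrafilter u" and v: "ultrafilter v"
    and cu: "meet A c b \<in> u" and dv: "meet A d a \<in> v"
    and uv: "\<And>x y. x \<in> u \<Longrightarrow> y \<in> v \<Longrightarrow> contact A x y"
    using contact_ultrafilters[OF _ _ d(2)] a b cA dA by (metis closed(5))
  have "contact A y x" if "x \<in> u" "y \<in> v" for x y
    using uv[OF that] contact_sym ultrafilterD(1) u v that by blast
  then have eq: "round_part u = round_part v"
    using round_part_subset_if_contact u v uv by blast
  have "b \<in> u" "a \<in> v" "c \<in> u"
    using ultrafilterD(4)[OF u cu] ultrafilterD(4)[OF v dv] a b cA dA by auto
  then have "cmpl A b \<notin> round_part u" "cmpl A a \<notin> round_part v" "point (round_part u)"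
    using round_part_subset ultrafilterD(7) u v point_round_part c(1) by blast+
  then show "\<exists>p. point p \<and> cmpl A a \<notin> p \<and> cmpl A b \<notin> p" using eq by blast
next
  assume "\<exists>p. point p \<and> cmpl A a \<notin> p \<and> cmpl A b \<notin> p"
  then obtain p where p: "point p" "cmpl A a \<notin> p" "cmpl A b \<notin> p" by blast
  obtain c where c: "c \<in> p" "c \<in> bdd" using pointD(6)[OF p(1) pointD(2)[OF p(1)]] by blast
  have cA: "c \<in> carr A" using c bounded_carr by blast
  show "contact A a b"
  proof (rule ccontr)
    assume "\<not> contact A a b"
    then have "a \<lless> cmpl A b" using b unfolding way_inside_def by simp
    then have "meet A c a \<lless> cmpl A b"
      by (rule way_inside_mono) (use a b cA in auto)
    then have "cmpl A (meet A c a) \<in> p"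
      using pointD(7)[OF p(1) bounded_meet[OF c(2) a] closed(3)[OF b]] p(3) by blast
    then have "meet A c (cmpl A (meet A c a)) \<in> p" using pointD(5)[OF p(1) c(1)] by blast
    moreover have "meet A c (cmpl A (meet A c a)) = meet A c (cmpl A a)"
      using a cA join_commute[of "zer A" "meet A c (cmpl A a)"]
      by (simp add: cmpl_meet meet_join_distrib)
    ultimately have "cmpl A a \<in> p" using point_meet_iff[OF p(1) cA] a by simp
    then show False using p(2) by blast
  qed
qed

end

subsection \<open>The topology on the points\<close>

text \<open>
  The points are indexed by a set \<open>P\<close>, so that the space can live on any type that is large
  enough. The sets \<open>basic a\<close> form a base of the topology, and \<open>region a\<close> is the closure of
  \<open>basic a\<close>.
\<close>

locale LCA_points = complete_LCA A for A :: "'a lca" +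
  fixes P :: "'p set" and pt :: "'p \<Rightarrow> 'a set"
  assumes bij: "bij_betw pt P {p. point p}"
begin

definition basic :: "'a \<Rightarrow> 'p set" where
  "basic a = {x \<in> P. a \<in> pt x}"

definition region :: "'a \<Rightarrow> 'p set" where
  "region a = {x \<in> P. cmpl A a \<notin> pt x}"

definition spectrum :: "'p topology" where
  "spectrum = topology (\<lambda>W. W \<subseteq> P \<and> (\<forall>x\<in>W. \<exists>a\<in>pt x. basic a \<subseteq> W))"

lemma point_pt: "x \<in> P \<Longrightarrow> point (pt x)"
  using bij bij_betwE by fastforce

lemma pt_surj: "point p \<Longrightarrow> \<exists>x\<in>P. pt x = p"
  using bij unfolding bij_betw_def by (metis imageE mem_Collect_eq)

lemma basic_meet: "a \<in> carr A \<Longrightarrow> b \<in> carr A \<Longrightarrow> basic (meet A a b) = basic a \<inter> basic b"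
  unfolding basic_def using point_meet_iff[OF point_pt] by auto

lemma basic_nonempty: "a \<in> carr A \<Longrightarrow> a \<noteq> zer A \<Longrightarrow> basic a \<noteq> {}"
  using point_exists pt_surj unfolding basic_def by blast

lemma openin_spectrum: "openin spectrum W \<longleftrightarrow> W \<subseteq> P \<and> (\<forall>x\<in>W. \<exists>a\<in>pt x. basic a \<subseteq> W)"
proof -
  have "istopology (\<lambda>W. W \<subseteq> P \<and> (\<forall>x\<in>W. \<exists>a\<in>pt x. basic a \<subseteq> W))"
    unfolding istopology_def
  proof (intro conjI allI impI ballI)
    fix S T x
    assume S: "S \<subseteq> P \<and> (\<forall>x\<in>S. \<exists>a\<in>pt x. basic a \<subseteq> S)"
      and T: "T \<subseteq> P \<and> (\<forall>x\<in>T. \<exists>a\<in>pt x. basic a \<subseteq> T)" and x: "x \<in> S \<inter> T"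
    obtain a b where ab: "a \<in> pt x" "basic a \<subseteq> S" "b \<in> pt x" "basic b \<subseteq> T" using S T x by blast
    have p: "point (pt x)" using S x point_pt by blast
    have "basic (meet A a b) \<subseteq> S \<inter> T"
      using basic_meet[of a b] pointD(1)[OF p] ab by blast
    then show "\<exists>a\<in>pt x. basic a \<subseteq> S \<inter> T" using pointD(5)[OF p ab(1,3)] by blast
  next
    fix \<K> x
    assume K: "\<forall>W\<in>\<K>. W \<subseteq> P \<and> (\<forall>x\<in>W. \<exists>a\<in>pt x. basic a \<subseteq> W)" and "x \<in> \<Union>\<K>"
    then obtain W where "W \<in> \<K>" "x \<in> W" by blast
    moreover from this obtain a where "a \<in> pt x" "basic a \<subseteq> W" using K by blast
    ultimately show "\<exists>a\<in>pt x. basic a \<subseteq> \<Union>\<K>" by blast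
  qed auto
  then show ?thesis unfolding spectrum_def by simp
qed

lemma openin_basic: "openin spectrum (basic a)"
  unfolding openin_spectrum basic_def by blast

lemma topspace_spectrum [simp]: "topspace spectrum = P"
proof -
  have "openin spectrum P"
    unfolding openin_spectrum using pointD(2)[OF point_pt] by (auto simp: basic_def)
  then show ?thesis
    unfolding topspace_def using openin_spectrum by blast
qed

lemma complement_region: "a \<in> carr A \<Longrightarrow> P - region a = basic (cmpl A a)"
  unfolding region_def basic_def by auto

lemma closedin_region: "a \<in> carr A \<Longrightarrow> closedin spectrum (region a)"
  unfolding closedin_def using complement_region openin_basic by (auto simp: region_def)

lemma basic_subset_region: "basic a \<subseteq> region a"
  unfolding basic_def region_def using point_not_both point_pt by blast

text \<open>An element of the point that is disjoint from \<open>a\<close> would put the complement of \<open>a\<close> into the point.\<close>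

lemma region_meet:
  assumes "x \<in> region a" "b \<in> pt x" "a \<in> carr A"
  shows "meet A b a \<noteq> zer A" "b \<in> carr A"
proof -
  have x: "x \<in> P" "cmpl A a \<notin> pt x" using assms unfolding region_def by auto
  note p = pointD[OF point_pt[OF x(1)]]
  show b: "b \<in> carr A" using p(1) assms by blast
  show "meet A b a \<noteq> zer A"
    using p(4)[OF assms(2), of "cmpl A a"] x(2) assms(3) b leq_cmpl_iff[of b a] by auto
qed

lemma closure_of_basic:
  assumes a: "a \<in> carr A"
  shows "spectrum closure_of (basic a) = region a"
proof
  show "spectrum closure_of (basic a) \<subseteq> region a"
    using closedin_region[OF a] basic_subset_region by (rule closure_of_minimal[rotated])
  show "region a \<subseteq> spectrum closure_of (basic a)"
  proof
    fix x assume x: "x \<in> region a"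
    have "\<exists>y\<in>basic a. y \<in> T" if T: "x \<in> T" "openin spectrum T" for T
    proof -
      obtain b where b: "b \<in> pt x" "basic b \<subseteq> T" using T unfolding openin_spectrum by blast
      have "basic (meet A b a) \<noteq> {}" using region_meet[OF x b(1) a] a by (intro basic_nonempty) auto
      then show ?thesis using basic_meet[OF region_meet(2)[OF x b(1) a] a] b(2) by blast
    qed
    then show "x \<in> spectrum closure_of (basic a)"
      using x unfolding in_closure_of region_def by auto
  qed
qed

lemma region_leq_iff:
  assumes a: "a \<in> carr A" and b: "b \<in> carr A"
  shows "region a \<subseteq> region b \<longleftrightarrow> leq A a b"
proof
  assume ab: "region a \<subseteq> region b"
  show "leq A a b"
  proof (rule ccontr)
    assume "\<not> leq A a b"
    then have "basic (meet A a (cmpl A b)) \<noteq> {}"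
      using a b by (intro basic_nonempty) (auto simp: meet_cmpl_zer_iff)
    then obtain x where "x \<in> basic a" "x \<in> basic (cmpl A b)" using basic_meet a b by auto
    then show False
      using ab basic_subset_region[of a] unfolding region_def basic_def by blast
  qed
next
  assume "leq A a b"
  then have "leq A (cmpl A b) (cmpl A a)" using a b cmpl_leq_cmpl by simp
  then show "region a \<subseteq> region b"
    using pointD(4)[OF point_pt] a unfolding region_def by auto
qed

lemma region_join:
  assumes "a \<in> carr A" "b \<in> carr A"
  shows "region (join A a b) = region a \<union> region b"
  using assms point_meet_iff[OF point_pt] unfolding region_def by (auto simp: cmpl_join)

lemma region_subset_basic:
  assumes "a \<in> bdd" "b \<in> carr A" "a \<lless> b"
  shows "region a \<subseteq> basic b"
  unfolding region_def basic_def using pointD(7)[OF point_pt] assms by blast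

text \<open>A regular closed set is the region of the join of all \<open>s\<close> with \<open>basic s\<close> in its interior.\<close>

lemma regular_closed_sets_spectrum: "regular_closed_sets spectrum = region ` carr A"
proof
  show "region ` carr A \<subseteq> regular_closed_sets spectrum"
    by (metis closure_of_basic image_subsetI openin_basic regular_closed_closure_of_open)
  show "regular_closed_sets spectrum \<subseteq> region ` carr A"
  proof
    fix R assume R: "R \<in> regular_closed_sets spectrum"
    let ?O = "spectrum interior_of R"
    define S where "S = {s \<in> carr A. basic s \<subseteq> ?O}"
    have "S \<subseteq> carr A" unfolding S_def by blast
    then obtain a where a: "is_join A S a"
      using complete_lcaD(1)[OF complete] unfolding complete_boolean_alg_def by blast
    have aA: "a \<in> carr A" and ub: "\<And>s. s \<in> S \<Longrightarrow> leq A s a"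
      using a unfolding is_join_def by blast+
    have O: "?O \<subseteq> P" "\<And>x. x \<in> ?O \<Longrightarrow> \<exists>s\<in>pt x. basic s \<subseteq> ?O"
      using openin_interior_of[of spectrum R] unfolding openin_spectrum by blast+
    have "spectrum closure_of ?O = region a"
    proof
      have "x \<in> region a" if x: "x \<in> ?O" for x
      proof -
        have p: "point (pt x)" using O(1) x point_pt by blast
        obtain s where s: "s \<in> pt x" "basic s \<subseteq> ?O" using O(2)[OF x] by blast
        then have "s \<in> S" using pointD(1)[OF p] unfolding S_def by blast
        then have "a \<in> pt x" using pointD(4)[OF p s(1) aA] ub by blast
        then have "x \<in> basic a" using O(1) x unfolding basic_def by blast
        then show ?thesis using basic_subset_region by blast
      qed
      then show "spectrum closure_of ?O \<subseteq> region a"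
        using closedin_region[OF aA] by (intro closure_of_minimal) auto
      show "region a \<subseteq> spectrum closure_of ?O"
      proof
        fix x assume x: "x \<in> region a"
        have "\<exists>y\<in>?O. y \<in> T" if T: "x \<in> T" "openin spectrum T" for T
        proof -
          obtain b where b: "b \<in> pt x" "basic b \<subseteq> T" using T unfolding openin_spectrum by blast
          note bA = region_meet(2)[OF x b(1) aA]
          have "\<exists>s\<in>S. meet A s b \<noteq> zer A"
          proof (rule ccontr)
            assume "\<not> ?thesis"
            then have "\<forall>s\<in>S. leq A s (cmpl A b)" using leq_cmpl_iff[OF _ bA] unfolding S_def by blast
            then have "leq A a (cmpl A b)" using a bA unfolding is_join_def by simp
            then have "meet A b a = zer A" using leq_cmpl_iff[OF aA bA] meet_commute[OF aA bA] by simp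
            then show False using region_meet(1)[OF x b(1) aA] by blast
          qed
          then obtain s where s: "s \<in> carr A" "basic s \<subseteq> ?O" "meet A s b \<noteq> zer A"
            unfolding S_def by blast
          have "basic (meet A s b) \<noteq> {}" using basic_nonempty s bA by simp
          then show ?thesis using basic_meet[OF s(1) bA] s(2) b(2) by blast
        qed
        then show "x \<in> spectrum closure_of ?O"
          using x unfolding in_closure_of region_def by auto
      qed
    qed
    then show "R \<in> region ` carr A" using regular_closedD(1)[OF R] aA by blast
  qed
qed

text \<open>
  If \<open>region a\<close> is compact then finitely many bounded \<open>c\<close> cover it, and \<open>a\<close> lies below their join.
  For the converse let \<open>I\<close> be the ideal of all \<open>d\<close> such that finitely many members of the cover
  contain \<open>region d\<close>. An ultrafilter with \<open>a\<close> in it that avoids \<open>I\<close> contains a point of \<open>region a\<close>,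
  hence a point in some member \<open>V\<close> of the cover. Then \<open>V\<close> contains \<open>basic s\<close> for some \<open>s\<close> in the
  point, and thus \<open>region d\<close> for some \<open>d \<lless> s\<close> in the ultrafilter, so that \<open>d \<in> I\<close> after all.
\<close>

lemma region_compact_iff:
  assumes a: "a \<in> carr A"
  shows "compactin spectrum (region a) \<longleftrightarrow> a \<in> bdd"
proof
  assume comp: "compactin spectrum (region a)"
  have "region a \<subseteq> \<Union>(basic ` bdd)"
  proof
    fix x assume "x \<in> region a"
    then have x: "x \<in> P" unfolding region_def by blast
    note p = pointD[OF point_pt[OF x]]
    obtain b where "b \<in> pt x" "b \<in> bdd" using p(6)[OF p(2)] by blast
    then show "x \<in> \<Union>(basic ` bdd)" using x unfolding basic_def by blast
  qed
  then obtain \<F> where "finite \<F>" "\<F> \<subseteq> basic ` bdd" "region a \<subseteq> \<Union>\<F>"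
    using compactinD[OF comp, of "basic ` bdd"] openin_basic by blast
  then obtain C where C: "finite C" "C \<subseteq> bdd" "region a \<subseteq> \<Union>(basic ` C)"
    by (metis finite_subset_image)
  have "\<exists>c\<in>bdd. \<Union>(basic ` C) \<subseteq> region c"
    using C(1,2)
  proof (induction C)
    case empty
    then show ?case using is_idealD(2)[OF bounded_ideal] by auto
  next
    case (insert d C)
    then obtain c where c: "c \<in> bdd" "\<Union>(basic ` C) \<subseteq> region c" by auto
    have "join A d c \<in> bdd" using insert.prems c(1) is_idealD(4)[OF bounded_ideal] by simp
    moreover have "region (join A d c) = region d \<union> region c"
      using region_join bounded_carr insert.prems c(1) by auto
    moreover have "\<Union>(basic ` insert d C) \<subseteq> region d \<union> region c"
      using basic_subset_region[of d] c(2) by auto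
    ultimately show ?case by metis
  qed
  then obtain c where c: "c \<in> bdd" "region a \<subseteq> region c" using C(3) by blast
  then show "a \<in> bdd"
    using region_leq_iff[OF a bounded_carr[OF c(1)]] is_idealD(3)[OF bounded_ideal c(1) a] by blast
next
  assume bd: "a \<in> bdd"
  show "compactin spectrum (region a)"
    unfolding compactin_def
  proof (intro conjI allI impI)
    show "region a \<subseteq> topspace spectrum" unfolding region_def by auto
    fix \<U> assume cover: "Ball \<U> (openin spectrum) \<and> region a \<subseteq> \<Union>\<U>"
    define I where "I = {d \<in> carr A. \<exists>\<F>. finite \<F> \<and> \<F> \<subseteq> \<U> \<and> region d \<subseteq> \<Union>\<F>}"
    have I: "is_ideal A I"
      unfolding is_ideal_def
    proof (intro conjI ballI impI)
      show "I \<subseteq> carr A" unfolding I_def by blast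
      have "region (zer A) = {}"
        using pointD(2)[OF point_pt] unfolding region_def by auto
      then show "zer A \<in> I" unfolding I_def by auto
      fix c assume c: "c \<in> I"
      then obtain \<F> where F: "finite \<F>" "\<F> \<subseteq> \<U>" "region c \<subseteq> \<Union>\<F>" and cA: "c \<in> carr A"
        unfolding I_def by blast
      show "d \<in> I" if d: "d \<in> carr A" "leq A d c" for d
      proof -
        have "region d \<subseteq> \<Union>\<F>" using region_leq_iff[OF d(1) cA] d(2) F(3) by blast
        then show ?thesis using F d unfolding I_def by blast
      qed
      fix d assume "d \<in> I"
      then obtain \<G> where G: "finite \<G>" "\<G> \<subseteq> \<U>" "region d \<subseteq> \<Union>\<G>" and dA: "d \<in> carr A"
        unfolding I_def by blast
      have "region (join A c d) \<subseteq> \<Union>(\<F> \<union> \<G>)" using F G region_join[OF cA dA] by blast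
      then show "join A c d \<in> I"
        using F G cA dA unfolding I_def by (auto intro!: exI[of _ "\<F> \<union> \<G>"])
    qed
    have "a \<in> I"
    proof (rule ccontr)
      assume "a \<notin> I"
      then obtain u where u: "ultrafilter u" and au: "a \<in> u" and uI: "u \<inter> I = {}"
        using ultrafilter_exists[OF I a] by blast
      obtain x where x: "x \<in> P" "pt x = round_part u"
        using pt_surj[OF point_round_part[OF u au bd]] by blast
      have "cmpl A a \<notin> pt x"
        using x(2) round_part_subset[OF u] ultrafilterD(7)[OF u au] by blast
      then have "x \<in> \<Union>\<U>" using cover x(1) unfolding region_def by blast
      then obtain V where V: "V \<in> \<U>" "x \<in> V" by blast
      then have "openin spectrum V" using cover by blast
      then obtain s where s: "s \<in> pt x" "basic s \<subseteq> V" using V(2) unfolding openin_spectrum by blast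
      then obtain d where d: "d \<in> u" "d \<in> bdd" "d \<lless> s" "s \<in> carr A"
        unfolding x(2) round_part_def by blast
      then have "region d \<subseteq> \<Union>{V}" using region_subset_basic s(2) by blast
      then have "d \<in> I" using V(1) bounded_carr[OF d(2)] unfolding I_def by blast
      then show False using d(1) uI by blast
    qed
    then show "\<exists>\<F>. finite \<F> \<and> \<F> \<subseteq> \<U> \<and> region a \<subseteq> \<Union>\<F>" unfolding I_def by blast
  qed
qed

lemma LCH_space_spectrum: "LCH_space spectrum"
proof
  show "Hausdorff_space spectrum"
    unfolding Hausdorff_space_def
  proof (intro allI impI)
    fix x y assume "x \<in> topspace spectrum \<and> y \<in> topspace spectrum \<and> x \<noteq> y"
    then have xy: "x \<in> P" "y \<in> P" "x \<noteq> y" by auto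
    then have "pt x \<noteq> pt y" using bij unfolding bij_betw_def inj_on_def by blast
    then obtain a where a: "a \<in> pt x" "cmpl A a \<in> pt y"
      using points_separated[OF point_pt[OF xy(1)] point_pt[OF xy(2)]] by blast
    have "disjnt (basic a) (basic (cmpl A a))"
      using point_not_both point_pt unfolding disjnt_def basic_def by blast
    then show "\<exists>U V. openin spectrum U \<and> openin spectrum V \<and> x \<in> U \<and> y \<in> V \<and> disjnt U V"
      using openin_basic a xy unfolding basic_def by blast
  qed
  show "locally_compact_space spectrum"
    unfolding locally_compact_space_def
  proof
    fix x assume "x \<in> topspace spectrum"
    then have x: "x \<in> P" by simp
    note p = pointD[OF point_pt[OF x]]
    obtain b where b: "b \<in> pt x" "b \<in> bdd" using p(6)[OF p(2)] by blast
    have "x \<in> basic b" using x b unfolding basic_def by blast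
    then show "\<exists>U K. openin spectrum U \<and> compactin spectrum K \<and> x \<in> U \<and> U \<subseteq> K"
      using openin_basic basic_subset_region region_compact_iff[OF bounded_carr[OF b(2)]] b(2) by blast
  qed
qed

lemma region_iso: "lca_iso A (rc_lca spectrum) region"
  unfolding lca_iso_def
proof (intro conjI ballI)
  show "bij_betw region (carr A) (carr (rc_lca spectrum))"
    unfolding bij_betw_def rc_lca_simps regular_closed_sets_spectrum
  proof
    show "inj_on region (carr A)"
      by (rule inj_onI) (metis region_leq_iff leq_antisym order_refl)
  qed simp
  fix a assume a: "a \<in> carr A"
  show "region (cmpl A a) = cmpl (rc_lca spectrum) (region a)"
    using closure_of_basic[of "cmpl A a"] complement_region[OF a] a by simp
  show "region a \<in> bounded_elts (rc_lca spectrum) \<longleftrightarrow> a \<in> bdd"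
    using region_compact_iff[OF a] a by (simp add: regular_closed_sets_spectrum)
  fix b assume b: "b \<in> carr A"
  show "leq (rc_lca spectrum) (region a) (region b) \<longleftrightarrow> leq A a b"
    using region_leq_iff[OF a b] a b leq_rc_iff[of "region a" spectrum "region b"]
    by (simp add: regular_closed_sets_spectrum)
  have "region a \<inter> region b \<noteq> {} \<longleftrightarrow> (\<exists>p. point p \<and> cmpl A a \<notin> p \<and> cmpl A b \<notin> p)"
    using point_pt pt_surj unfolding region_def by blast
  then show "contact (rc_lca spectrum) (region a) (region b) \<longleftrightarrow> contact A a b"
    using contact_iff_point[OF a b] by simp
qed

end

section \<open>The duality\<close>

text \<open>
  The encoding \<open>enc X\<close> is there because the regular closed sets of \<open>X\<close> have type \<open>'p set\<close>, while
  the objects of the target category live on \<open>'q\<close>.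
\<close>

definition rc_functor ::
  "('p topology \<Rightarrow> 'p set \<Rightarrow> 'q) \<Rightarrow> ('p topology, 'p \<Rightarrow> 'p, 'q lca, 'q \<Rightarrow> 'q) fctr" where
  "rc_functor enc =
     \<lparr>OMap = (\<lambda>X. transport_lca (enc X) (rc_lca X)),
      AMap = (\<lambda>X Y f. restrict
        (\<lambda>a. enc X (rc_map X Y f (inv_into (regular_closed_sets Y) (enc Y) a)))
        (enc Y ` regular_closed_sets Y))\<rparr>"

lemma carr_transport_lca [simp]: "carr (transport_lca i A) = i ` carr A"
  by (simp add: transport_lca_def Let_def)

text \<open>
  The size of the spaces and of the algebras enters only through the two assumptions: the
  algebra of a space in \<open>\<S>\<close> has a copy in \<open>\<A>\<close>, and every complete algebra in \<open>\<A>\<close> is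
  represented by a space in \<open>\<S>\<close>.
\<close>

lemma dually_equivalentI:
  fixes \<S> :: "'p topology set" and \<A> :: "'q lca set"
  assumes enc: "\<And>X. X \<in> \<S> \<Longrightarrow> LCH_space X \<Longrightarrow>
      \<exists>i. inj_on i (regular_closed_sets X) \<and> transport_lca i (rc_lca X) \<in> \<A>"
    and rep: "\<And>A. A \<in> \<A> \<Longrightarrow> complete_lca A \<Longrightarrow> \<exists>X\<in>\<S>. LCH_space X \<and> (\<exists>\<phi>. lca_iso A (rc_lca X) \<phi>)"
  shows "dually_equivalent (SkePerLC \<S>) (DSkePerLC \<A>)"
proof -
  obtain e where e: "\<And>X. X \<in> \<S> \<Longrightarrow> LCH_space X \<Longrightarrow>
      inj_on (e X) (regular_closed_sets X) \<and> transport_lca (e X) (rc_lca X) \<in> \<A>"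
    using enc by metis
  define d where "d X = inv_into (regular_closed_sets X) (e X)" for X
  define T where "T X = transport_lca (e X) (rc_lca X)" for X
  define Ob where "Ob = {X \<in> \<S>. LCH_space X}"
  define Mor where "Mor X Y = {f \<in> extensional (topspace X). skeletal_perfect_map X Y f}"
    for X Y :: "'p topology"
  have Obj: "Obj (SkePerLC \<S>) = Ob"
    by (auto simp: SkePerLC_def Ob_def LCH_space_def)
  have Hom: "Hom (SkePerLC \<S>) = Mor"
    by (auto simp: SkePerLC_def Mor_def skeletal_perfect_map_def fun_eq_iff)
  have Obj': "Obj (opposite (DSkePerLC \<A>)) = {A \<in> \<A>. complete_lca A}"
    by (simp add: opposite_def DSkePerLC_def)
  have Hom': "Hom (opposite (DSkePerLC \<A>)) A B = {\<phi> \<in> extensional (carr B). DSkePerLC_hom B A \<phi>}" for A B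
    by (simp add: opposite_def DSkePerLC_def)
  let ?F = "rc_functor e"
  have OMap: "OMap ?F X = T X" for X by (simp add: rc_functor_def T_def)
  have carrT: "carr (T X) = e X ` regular_closed_sets X" for X by (simp add: T_def)
  have AMap: "AMap ?F X Y f = restrict (\<lambda>a. e X (rc_map X Y f (d Y a))) (carr (T Y))" for X Y f
    by (simp add: rc_functor_def d_def carrT)
  have LCH: "LCH_space X" if "X \<in> Ob" for X using that unfolding Ob_def by blast
  have rc: "complete_lca (rc_lca X)" if "X \<in> Ob" for X
    using LCH_space.complete_lca_rc[OF LCH[OF that]] .
  have inj: "inj_on (e X) (carr (rc_lca X))" if "X \<in> Ob" for X
    using e[of X] that unfolding Ob_def by simp
  have lcaT: "complete_lca (T X)" and TA: "T X \<in> \<A>" if "X \<in> Ob" for X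
    using transport_lca(1)[OF rc[OF that] inj[OF that]] e[of X] that unfolding T_def Ob_def by auto
  have isoT: "lca_iso (rc_lca X) (T X) (e X)" if "X \<in> Ob" for X
    using transport_lca(2)[OF rc[OF that] inj[OF that]] unfolding T_def .
  have e_hom: "DSkePerLC_hom (rc_lca X) (T X) (e X)" if "X \<in> Ob" for X
    by (rule lca_iso_hom[OF rc[OF that] lcaT[OF that] isoT[OF that]])
  have d_hom: "DSkePerLC_hom (T X) (rc_lca X) (d X)" if "X \<in> Ob" for X
    using lca_iso_hom[OF lcaT[OF that] rc[OF that] lca_iso_inverse[OF rc[OF that] isoT[OF that]]]
    unfolding d_def by simp
  have de: "d X (e X F) = F" if "X \<in> Ob" "F \<in> regular_closed_sets X" for X F
    using inv_into_f_f[of "e X" "regular_closed_sets X"] inj[OF that(1)] that(2) unfolding d_def by simp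
  have ed: "e X (d X a) = a" if "a \<in> carr (T X)" for X a
    using f_inv_into_f[of a "e X" "regular_closed_sets X"] that unfolding d_def carrT by simp
  have dT: "d X a \<in> regular_closed_sets X" if "a \<in> carr (T X)" for X a
    using inv_into_into[of a "e X" "regular_closed_sets X"] that unfolding d_def carrT by simp
  have hom_maps: "\<phi> a \<in> carr B" if "DSkePerLC_hom A B \<phi>" "a \<in> carr A" for A :: "'x lca" and B :: "'y lca" and \<phi> a
    using that unfolding DSkePerLC_hom_def complete_boolean_hom_def boolean_hom_def by blast

  have AMap_hom: "DSkePerLC_hom (T Y) (T X) (AMap ?F X Y f)"
    if X: "X \<in> Ob" and Y: "Y \<in> Ob" and f: "skeletal_perfect_map X Y f" for X Y f
  proof (rule DSkePerLC_hom_cong[OF lcaT[OF Y] lcaT[OF X]])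
    show "DSkePerLC_hom (T Y) (T X) (\<lambda>a. e X (rc_map X Y f (d Y a)))"
      by (rule DSkePerLC_hom_comp[OF lcaT[OF Y] rc[OF X] lcaT[OF X] _ e_hom[OF X]],
          rule DSkePerLC_hom_comp[OF lcaT[OF Y] rc[OF Y] rc[OF X] d_hom[OF Y]
            rc_map_hom[OF LCH[OF X] LCH[OF Y] f]])
  qed (simp add: AMap)

  have F_functor: "is_functor (SkePerLC \<S>) (opposite (DSkePerLC \<A>)) ?F"
    unfolding is_functor_def Obj Hom OMap
  proof (intro conjI ballI)
    fix X assume X: "X \<in> Ob"
    then show "T X \<in> Obj (opposite (DSkePerLC \<A>))" using TA lcaT Obj' by simp
    have "rc_map X X (restrict (\<lambda>x. x) (topspace X)) F = F" if "F \<in> regular_closed_sets X" for F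
      using rc_map_cong[of X "restrict (\<lambda>x. x) (topspace X)" "\<lambda>x. x" X F] rc_map_id[OF that] by simp
    then have "AMap ?F X X (restrict (\<lambda>x. x) (topspace X)) = restrict (\<lambda>x. x) (carr (T X))"
      unfolding AMap using dT ed by (intro restrict_ext) simp
    then show "AMap ?F X X (Idt (SkePerLC \<S>) X) = Idt (opposite (DSkePerLC \<A>)) (T X)"
      by (simp add: SkePerLC_def DSkePerLC_def opposite_def)
  next
    fix X Y f assume "X \<in> Ob" "Y \<in> Ob" "f \<in> Mor X Y"
    then show "AMap ?F X Y f \<in> Hom (opposite (DSkePerLC \<A>)) (T X) (T Y)"
      using AMap_hom unfolding Hom' Mor_def by (auto simp: AMap)
  next
    fix X Y Z f g
    assume X: "X \<in> Ob" and Y: "Y \<in> Ob" and Z: "Z \<in> Ob" and "f \<in> Mor X Y" "g \<in> Mor Y Z"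
    then have f: "skeletal_perfect_map X Y f" and g: "skeletal_perfect_map Y Z g"
      unfolding Mor_def by auto
    have "AMap ?F X Z (compose (topspace X) g f) a
        = compose (carr (T Z)) (AMap ?F X Y f) (AMap ?F Y Z g) a" for a
    proof (cases "a \<in> carr (T Z)")
      case True
      have "rc_map X Z (compose (topspace X) g f) (d Z a) = rc_map X Y f (rc_map Y Z g (d Z a))"
        using rc_map_cong[of X "compose (topspace X) g f" "\<lambda>x. g (f x)" Z] rc_map_comp[OF f g]
        by (simp add: compose_eq)
      moreover have "AMap ?F Y Z g a \<in> carr (T Y)"
        using hom_maps[OF AMap_hom[OF Y Z g] True] .
      ultimately show ?thesis
        using True de[OF Y rc_map_regular_closed[OF g]] by (simp add: AMap compose_eq)
    qed (simp add: AMap compose_def)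
    then show "AMap ?F X Z (Cmp (SkePerLC \<S>) X Y Z g f)
        = Cmp (opposite (DSkePerLC \<A>)) (T X) (T Y) (T Z) (AMap ?F Y Z g) (AMap ?F X Y f)"
      by (simp add: SkePerLC_def DSkePerLC_def opposite_def fun_eq_iff)
  qed

  have "f = g" if X: "X \<in> Ob" and Y: "Y \<in> Ob" and fg: "f \<in> Mor X Y" "g \<in> Mor X Y"
    and eq: "AMap ?F X Y f = AMap ?F X Y g" for X Y f g
  proof (rule extensionalityI)
    show "f \<in> extensional (topspace X)" "g \<in> extensional (topspace X)"
      using fg unfolding Mor_def by auto
    have f: "skeletal_perfect_map X Y f" and g: "skeletal_perfect_map X Y g"
      using fg unfolding Mor_def by auto
    have "rc_map X Y f F = rc_map X Y g F" if F: "F \<in> regular_closed_sets Y" for F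
    proof -
      have "e Y F \<in> carr (T Y)" using F carrT by blast
      then have "e X (rc_map X Y f F) = e X (rc_map X Y g F)"
        using fun_cong[OF eq, of "e Y F"] de[OF Y F] by (simp add: AMap)
      then show ?thesis
        using inj_onD[OF inj[OF X]] rc_map_regular_closed f g by (metis rc_lca_simps(1))
    qed
    then show "f x = g x" if "x \<in> topspace X" for x
      using rc_map_faithful[OF LCH[OF Y] f g _ that] by blast
  qed
  then have faithful: "faithful_functor (SkePerLC \<S>) (opposite (DSkePerLC \<A>)) ?F"
    unfolding faithful_functor_def Obj Hom inj_on_def by blast

  have "\<psi> \<in> AMap ?F X Y ` Mor X Y"
    if X: "X \<in> Ob" and Y: "Y \<in> Ob" and \<psi>: "\<psi> \<in> extensional (carr (T Y))" "DSkePerLC_hom (T Y) (T X) \<psi>"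
    for X Y \<psi>
  proof -
    have "DSkePerLC_hom (rc_lca Y) (rc_lca X) (\<lambda>F. d X (\<psi> (e Y F)))"
      by (rule DSkePerLC_hom_comp[OF rc[OF Y] lcaT[OF X] rc[OF X] _ d_hom[OF X]],
          rule DSkePerLC_hom_comp[OF rc[OF Y] lcaT[OF Y] lcaT[OF X] e_hom[OF Y] \<psi>(2)])
    then obtain f where f: "skeletal_perfect_map X Y f"
      "\<And>F. F \<in> regular_closed_sets Y \<Longrightarrow> d X (\<psi> (e Y F)) = rc_map X Y f F"
      using rc_map_full[OF LCH[OF X] LCH[OF Y]] by blast
    let ?f = "restrict f (topspace X)"
    have "?f \<in> Mor X Y"
      using skeletal_perfect_map_cong[OF f(1), of ?f] unfolding Mor_def by simp
    moreover have "AMap ?F X Y ?f a = \<psi> a" for a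
    proof (cases "a \<in> carr (T Y)")
      case True
      have "rc_map X Y ?f (d Y a) = d X (\<psi> a)"
        using rc_map_cong[of X ?f f Y "d Y a"] f(2)[OF dT[OF True]] ed[OF True] by simp
      then show ?thesis
        using ed[OF hom_maps[OF \<psi>(2) True]] True by (simp add: AMap)
    next
      case False
      then show ?thesis using \<psi>(1) by (simp add: AMap extensional_def)
    qed
    ultimately show ?thesis by (metis ext imageI)
  qed
  then have full: "full_functor (SkePerLC \<S>) (opposite (DSkePerLC \<A>)) ?F"
    unfolding full_functor_def Obj Hom OMap Hom' by blast

  have "\<exists>X\<in>Ob. \<exists>\<psi>. is_iso (DSkePerLC \<A>) A (T X) \<psi>" if A: "A \<in> \<A>" "complete_lca A" for A
  proof -
    obtain X \<phi> where X: "X \<in> Ob" and \<phi>: "lca_iso A (rc_lca X) \<phi>"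
      using rep[OF A] unfolding Ob_def by blast
    let ?\<psi> = "restrict (\<lambda>a. e X (\<phi> a)) (carr A)"
    let ?\<psi>' = "restrict (\<lambda>b. inv_into (carr A) \<phi> (d X b)) (carr (T X))"
    have bij: "bij_betw \<phi> (carr A) (regular_closed_sets X)"
      using \<phi> unfolding lca_iso_def by simp
    have "DSkePerLC_hom A (T X) (\<lambda>a. e X (\<phi> a))"
      by (rule DSkePerLC_hom_comp[OF A(2) rc[OF X] lcaT[OF X] lca_iso_hom[OF A(2) rc[OF X] \<phi>] e_hom[OF X]])
    then have \<psi>: "DSkePerLC_hom A (T X) ?\<psi>"
      by (rule DSkePerLC_hom_cong[OF A(2) lcaT[OF X]]) simp
    have "DSkePerLC_hom (T X) A (\<lambda>b. inv_into (carr A) \<phi> (d X b))"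
      by (rule DSkePerLC_hom_comp[OF lcaT[OF X] rc[OF X] A(2) d_hom[OF X]
            lca_iso_hom[OF rc[OF X] A(2) lca_iso_inverse[OF A(2) \<phi>]]])
    then have \<psi>': "DSkePerLC_hom (T X) A ?\<psi>'"
      by (rule DSkePerLC_hom_cong[OF lcaT[OF X] A(2)]) simp
    have "\<phi> a \<in> regular_closed_sets X" if "a \<in> carr A" for a
      using bij that bij_betwE by blast
    then have "compose (carr A) ?\<psi>' ?\<psi> = restrict (\<lambda>a. a) (carr A)"
      using hom_maps[OF \<psi>] de[OF X] bij_betw_inv_into_left[OF bij]
      unfolding compose_def by (intro restrict_ext) simp
    moreover have "compose (carr (T X)) ?\<psi> ?\<psi>' = restrict (\<lambda>b. b) (carr (T X))"
      using hom_maps[OF \<psi>'] dT ed bij_betw_inv_into_right[OF bij]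
      unfolding compose_def by (intro restrict_ext) simp
    ultimately have "is_iso (DSkePerLC \<A>) A (T X) ?\<psi>"
      using \<psi> \<psi>' unfolding is_iso_def DSkePerLC_def by auto
    then show ?thesis using X by blast
  qed
  then have surj: "essentially_surjective (SkePerLC \<S>) (opposite (DSkePerLC \<A>)) ?F"
    unfolding essentially_surjective_def Obj Obj' OMap is_iso_opposite by blast

  show ?thesis
    unfolding dually_equivalent_def
    by (rule equivalentI[OF is_category_SkePerLC is_category_opposite[OF is_category_DSkePerLC]
          F_functor full faithful surj])
qed

text \<open>The points of \<open>A\<close> are subsets of \<open>A\<close>, so an injection defined on these gives a space on any type.\<close>

lemma representing_space:
  fixes A :: "'a lca" and j :: "'a set \<Rightarrow> 'p"
  assumes A: "complete_lca A" and j: "inj_on j (Pow (carr A))"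
  obtains X :: "'p topology" and \<phi> where "LCH_space X" "lca_iso A (rc_lca X) \<phi>"
    "topspace X \<subseteq> j ` Pow (carr A)"
proof -
  interpret complete_LCA A by (rule complete_LCA.intro[OF A])
  let ?P = "{p. point p}"
  have sub: "?P \<subseteq> Pow (carr A)" using pointD(1) by blast
  have "bij_betw (inv_into ?P j) (j ` ?P) ?P"
    using inj_on_subset[OF j sub] by (intro bij_betw_inv_into) (simp add: bij_betw_def)
  then interpret LCA_points A "j ` ?P" "inv_into ?P j" by unfold_locales
  show thesis
    using that[OF LCH_space_spectrum region_iso] sub by auto
qed

lemma regular_closed_sets_lepoll: "regular_closed_sets X \<lesssim> Pow (topspace X)"
  using regular_closedD(3) by (intro subset_imp_lepoll) blast

text \<open>
  For a strong limit cardinal, a small space has a small set of regular closed sets and a small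
  algebra has a small set of points.
\<close>

lemma dual_small_spaces:
  assumes U: "universe (UNIV :: 'u set)"
  shows "dually_equivalent (SkePerLC (small_spaces :: 'u topology set))
           (DSkePerLC (small_algebras :: 'u lca set))"
proof (rule dually_equivalentI)
  fix X :: "'u topology" assume "X \<in> small_spaces"
  then have "Pow (topspace X) \<prec> (UNIV :: 'u set)"
    using U unfolding universe_def small_spaces_def by blast
  then have "regular_closed_sets X \<prec> (UNIV :: 'u set)"
    using lesspoll_trans1[OF regular_closed_sets_lepoll] by blast
  moreover from this obtain i :: "'u set \<Rightarrow> 'u" where i: "inj_on i (regular_closed_sets X)"
    using lesspoll_imp_lepoll unfolding lepoll_def by blast
  moreover from this have "i ` regular_closed_sets X \<approx> regular_closed_sets X"
    by (rule inj_on_image_eqpoll_self)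
  ultimately have "transport_lca i (rc_lca X) \<in> small_algebras"
    unfolding small_algebras_def using eq_lesspoll_trans by auto
  then show "\<exists>i :: 'u set \<Rightarrow> 'u. inj_on i (regular_closed_sets X) \<and>
      transport_lca i (rc_lca X) \<in> small_algebras"
    using i by blast
next
  fix A :: "'u lca" assume "A \<in> small_algebras" and A: "complete_lca A"
  then have small: "Pow (carr A) \<prec> (UNIV :: 'u set)"
    using U unfolding universe_def small_algebras_def by blast
  then obtain j :: "'u set \<Rightarrow> 'u" where "inj_on j (Pow (carr A))"
    using lesspoll_imp_lepoll unfolding lepoll_def by blast
  then obtain X :: "'u topology" and \<phi> where X: "LCH_space X" "lca_iso A (rc_lca X) \<phi>"
    "topspace X \<subseteq> j ` Pow (carr A)"
    by (rule representing_space[OF A])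
  have "topspace X \<lesssim> Pow (carr A)" using subset_image_lepoll[OF X(3)] .
  then have "X \<in> small_spaces"
    unfolding small_spaces_def using lesspoll_trans1[OF _ small] by blast
  then show "\<exists>X\<in>small_spaces :: 'u topology set. LCH_space X \<and> (\<exists>\<phi>. lca_iso A (rc_lca X) \<phi>)" using X by blast
qed

lemma dual_bounded_spaces:
  "dually_equivalent (SkePerLC (bounded_spaces :: 'v set topology set)) (DSkePerLC (UNIV :: 'v lca set))"
proof (rule dually_equivalentI)
  fix X :: "'v set topology" assume "X \<in> bounded_spaces"
  then show "\<exists>i :: 'v set set \<Rightarrow> 'v. inj_on i (regular_closed_sets X) \<and>
      transport_lca i (rc_lca X) \<in> (UNIV :: 'v lca set)"
    unfolding bounded_spaces_def lepoll_def by auto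
next
  fix A :: "'v lca" assume A: "complete_lca A"
  obtain X :: "'v set topology" and \<phi> where X: "LCH_space X" "lca_iso A (rc_lca X) \<phi>"
    by (rule representing_space[OF A inj_on_id2])
  have "bij_betw \<phi> (carr A) (regular_closed_sets X)"
    using X(2) unfolding lca_iso_def by simp
  then have "regular_closed_sets X \<lesssim> (UNIV :: 'v set)"
    using image_lepoll[of \<phi> "carr A"] subset_imp_lepoll[of "carr A" UNIV] lepoll_trans
    unfolding bij_betw_def by auto
  then show "\<exists>X\<in>bounded_spaces :: 'v set topology set. LCH_space X \<and> (\<exists>\<phi>. lca_iso A (rc_lca X) \<phi>)"
    using X unfolding bounded_spaces_def by blast
qed

theorem theorem2p15:
  shows "(universe (UNIV :: 'u set) \<longrightarrow>
            dually_equivalent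
              (SkePerLC (small_spaces :: 'u topology set))
              (DSkePerLC (small_algebras :: 'u lca set))) \<and>
         dually_equivalent
           (SkePerLC (bounded_spaces :: 'v set topology set))
           (DSkePerLC (UNIV :: 'v lca set))"
  using dual_small_spaces dual_bounded_spaces by blast

end
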